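(* Let $1<q=p<+\infty$, let $f$ satisfy the standing hypotheses given in the context, let $\lambda>0$, and let $E_\lambda$ be the set of solutions of $$-\left(|\phi_x|^{p-2}\phi_x\right)_x=\lambda\left(|\phi|^{q-2}\phi-f(\phi)\right)\ \text{in }(0,1),\qquad \phi(0)=\phi(1)=0 .$$ For $n=1,2,\dots$ let $\lambda_n=n^p(p-1)\left[2\int_0^1(1-t^p)^{-1/p}\,dt\right]^p$. (i) If $\lambda\le\lambda_1$, then $E_\lambda=\{0\}$. (ii) If $\lambda_n<\lambda\le\lambda_{n+1}$ for some $n\in\{1,2,\dots\}$, then $$E_\lambda=\{0\}\cup\bigcup_{k=1}^n\left(E_k^+\cup E_k^-\right),$$ where, for each $k=1,\dots,n$ and each sign $\pm$, $E_k^\pm\subset S_k^\pm$ satisfies: if $\lambda_k<\lambda\le\lambda_k^\pm$, then $E_k^\pm=\{\phi_k^\pm\}$ consists of a single solution; if $\lambda_k^\pm<\lambda$, then $E_k^\pm$ is homeomorphic to $[0,1]^{\mathcal E^\pm(k)}$ (where $[0,1]^0$ is a single point).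
   Context: Standing hypotheses on $f$: $p,q>1$ and $f:\mathbb R\to\mathbb R$ is continuous (not necessarily odd). The function $s\mapsto |s|^{q-2}s-f(s)$ vanishes at $0$, has a first positive zero $z^+>0$ and a first negative zero $z^-<0$. The function $g(s)=\frac{f(s)}{|s|^{q-2}s}$, $s\in(z^-,z^+)$, is strictly decreasing on $(z^-,0)$ and strictly increasing on $(0,z^+)$, and $$\lim_{s\to0}g(s)=0,\qquad \lim_{s\to(z^\pm)^\mp}\frac{|s|^{q-2}s-f(s)-|z^\pm|^{q-2}z^\pm+f(z^\pm)}{|s|^{q-2}s-|z^\pm|^{q-2}z^\pm}=L<0 .$$ A solution is a $C^1([0,1])$ function $\phi$ with $|\phi_x|^{p-2}\phi_x$ of class $C^1$ satisfying the equation and the boundary conditions (equivalently, a weak solution in $W^{1,p}_0(0,1)$). For $k\ge1$, $S_k^\pm$ is the set of $\varphi\in C^1([0,1])$ with $\varphi(0)=\varphi(1)=0$, $\pm\varphi_x(0)>0$, having exactly $k-1$ zeros in $(0,1)$, all of them simple. Subsets of $C^1([0,1])$ carry the $C^1$ topology. Notation: $F(s)=\int_0^sf(\xi)\,d\xi$ and $A(s)=\frac{|s|^q}{q}-F(s)$ for $s\in[z^-,z^+]$. Set $$I(a)=\int_0^a\left(F(t)-F(a)+\tfrac{a^q-t^q}{q}\right)^{-1/p}dt\ (0<a\le z^+),\qquad J(a)=\int_a^0\left(F(t)-F(a)+\tfrac{|a|^q-|t|^q}{q}\right)^{-1/p}dt\ (z^-\le a<0).$$ Let $r(\lambda),r^-(\lambda)>0$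 be given by $r(\lambda)^p=\frac{\lambda p}{p-1}A(z^+)$, $r^-(\lambda)^p=\frac{\lambda p}{p-1}A(z^-)$, and $r^*(\lambda)=\min\{r(\lambda),r^-(\lambda)\}$. For $0<r\le r(\lambda)$ let $z(r)\in(0,z^+]$ be the unique point with $r^p=\frac{\lambda p}{p-1}A(z(r))$; for $0<r\le r^-(\lambda)$ let $S(r)\in[z^-,0)$ be the unique point with $r^p=\frac{\lambda p}{p-1}A(S(r))$. (The points $z(r^*(\lambda))$ and $S(r^*(\lambda))$ do not depend on $\lambda$.) The numbers $\lambda_k^\pm$: if $1<p\le2$, $\lambda_k^\pm=+\infty$ for all $k\ge1$. If $p>2$, $$\lambda_1^+=\tfrac{p-1}{p}[2I(z^+)]^p,\qquad \lambda_1^-=\tfrac{p-1}{p}[2J(z^-)]^p,$$ $$\lambda_{2k}^\pm=\tfrac{p-1}{p}\left[2kI(z(r^*(\lambda)))+2kJ(S(r^*(\lambda)))\right]^p\quad(k\ge1),$$ $$\lambda_{2k-1}^+=\tfrac{p-1}{p}\left[2kI(z(r^*(\lambda)))+2(k-1)J(S(r^*(\lambda)))\right]^p\quad(k\ge2),$$ $$\lambda_{2k-1}^-=\tfrac{p-1}{p}\left[2(k-1)I(z(r^*(\lambda)))+2kJ(S(r^*(\lambda)))\right]^p\quad(k\ge2).$$ The exponents $\mathcal E^\pm$: $\mathcal E^\pm(1)=0$ in all cases, and - if $A(z^+)=A(z^-)$: $\mathcal E^\pm(2k)=2k-1$ $(k\ge1)$, $\mathcal E^+(2k-1)=\mathcal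 E^-(2k-1)=2k-2$ $(k\ge2)$; - if $A(z^+)<A(z^-)$: $\mathcal E^\pm(2k)=k-1$ $(k\ge1)$, $\mathcal E^+(2k-1)=k-1$, $\mathcal E^-(2k-1)=k-2$ $(k\ge2)$; - if $A(z^+)>A(z^-)$: $\mathcal E^\pm(2k)=k-1$ $(k\ge1)$, $\mathcal E^+(2k-1)=k-2$, $\mathcal E^-(2k-1)=k-1$ $(k\ge2)$.
   Formalization: E_λ is taken as the set of solutions with values in [z⁻,z⁺], or as all solutions if |s|^{q-2}s−f(s) is ≤0 for s>z⁺ and ≥0 for s<z⁻; for f unrestricted outside [z⁻,z⁺] further solutions can exist and the claim fails. *)

theory Defs
  imports "HOL-Analysis.Analysis"
begin

text \<open>
  The signed power \<open>|s|^(r-2) s\<close>; its value at \<open>0\<close> is \<open>0\<close>.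
\<close>
definition spow :: "real \<Rightarrow> real \<Rightarrow> real" where
  "spow r s = \<bar>s\<bar> powr (r - 2) * s"

section \<open>The space of continuously differentiable functions on the unit interval\<close>

text \<open>The derivative on \<open>[0,1]\<close>, one-sided at the end points.\<close>
definition D01 :: "(real \<Rightarrow> real) \<Rightarrow> real \<Rightarrow> real" where
  "D01 \<phi> x = vector_derivative \<phi> (at x within {0..1})"

definition is_C1 :: "(real \<Rightarrow> real) \<Rightarrow> bool" where
  "is_C1 \<phi> \<longleftrightarrow> (\<forall>x\<in>{0..1}. \<phi> differentiable (at x within {0..1})) \<and> continuous_on {0..1} (D01 \<phi>)"

text \<open>
  An element of \<open>C\<^sup>1([0,1])\<close> is represented by its unique extensional representative
  (the value \<open>undefined\<close> outside \<open>[0,1]\<close>), so that equality of elements is equality on \<open>[0,1]\<close>.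
\<close>
definition C1 :: "(real \<Rightarrow> real) set" where
  "C1 = {\<phi> \<in> extensional {0..1}. is_C1 \<phi>}"

definition zero_fn :: "real \<Rightarrow> real" where
  "zero_fn = restrict (\<lambda>_. 0) {0..1}"

text \<open>
  The guard is needed because \<^locale>\<open>Metric_space\<close> asks for nonnegativity on the whole type,
  and the supremum of an unbounded set of reals is unspecified.
\<close>
definition C1_dist :: "(real \<Rightarrow> real) \<Rightarrow> (real \<Rightarrow> real) \<Rightarrow> real" where
  "C1_dist \<phi> \<psi> =
     (if \<phi> \<in> C1 \<and> \<psi> \<in> C1
      then (SUP x\<in>{0..1}. \<bar>\<phi> x - \<psi> x\<bar>) + (SUP x\<in>{0..1}. \<bar>D01 \<phi> x - D01 \<psi> x\<bar>)
      else 0)"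

definition C1_topology :: "(real \<Rightarrow> real) topology" where
  "C1_topology = Metric_space.mtopology C1 C1_dist"

lemma continuous_on_C1:
  assumes "\<phi> \<in> C1"
  shows "continuous_on {0..1} \<phi>" "continuous_on {0..1} (D01 \<phi>)"
  using assms unfolding C1_def is_C1_def
  by (auto intro: differentiable_imp_continuous_on simp: differentiable_on_def)

lemma bdd_above_abs_diff:
  fixes u v :: "real \<Rightarrow> real"
  assumes "continuous_on {0..1} u" "continuous_on {0..1} v"
  shows "bdd_above ((\<lambda>x. \<bar>u x - v x\<bar>) ` {0..1})"
  by (intro bounded_imp_bdd_above compact_imp_bounded compact_continuous_image
        continuous_intros assms) auto

lemma SUP_abs_diff_nonneg:
  fixes u v :: "real \<Rightarrow> real"
  assumes "continuous_on {0..1} u" "continuous_on {0..1} v"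
  shows "0 \<le> (SUP x\<in>{0..1}. \<bar>u x - v x\<bar>)"
  using cSUP_upper2[OF bdd_above_abs_diff[OF assms], of 0 0] by auto

lemma SUP_abs_diff_triangle:
  fixes u v w :: "real \<Rightarrow> real"
  assumes u: "continuous_on {0..1} u" and v: "continuous_on {0..1} v" and w: "continuous_on {0..1} w"
  shows "(SUP x\<in>{0..1}. \<bar>u x - w x\<bar>) \<le> (SUP x\<in>{0..1}. \<bar>u x - v x\<bar>) + (SUP x\<in>{0..1}. \<bar>v x - w x\<bar>)"
proof (rule cSUP_least)
  fix x :: real assume x: "x \<in> {0..1}"
  have "\<bar>u x - v x\<bar> \<le> (SUP x\<in>{0..1}. \<bar>u x - v x\<bar>)" "\<bar>v x - w x\<bar> \<le> (SUP x\<in>{0..1}. \<bar>v x - w x\<bar>)"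
    using x by (auto intro!: cSUP_upper bdd_above_abs_diff u v w)
  then show "\<bar>u x - w x\<bar> \<le> (SUP x\<in>{0..1}. \<bar>u x - v x\<bar>) + (SUP x\<in>{0..1}. \<bar>v x - w x\<bar>)" by linarith
qed auto

lemma Metric_space_C1: "Metric_space C1 C1_dist"
proof
  fix \<phi> \<psi> :: "real \<Rightarrow> real"
  show "0 \<le> C1_dist \<phi> \<psi>"
    unfolding C1_dist_def by (auto intro!: add_nonneg_nonneg SUP_abs_diff_nonneg continuous_on_C1)
  show "C1_dist \<phi> \<psi> = C1_dist \<psi> \<phi>"
    unfolding C1_dist_def by (simp add: abs_minus_commute conj_commute)
next
  fix \<phi> \<psi> assume m: "\<phi> \<in> C1" "\<psi> \<in> C1"
  show "C1_dist \<phi> \<psi> = 0 \<longleftrightarrow> \<phi> = \<psi>"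
  proof
    assume "C1_dist \<phi> \<psi> = 0"
    moreover have "0 \<le> (SUP x\<in>{0..1}. \<bar>\<phi> x - \<psi> x\<bar>)" "0 \<le> (SUP x\<in>{0..1}. \<bar>D01 \<phi> x - D01 \<psi> x\<bar>)"
      using m by (auto intro!: SUP_abs_diff_nonneg continuous_on_C1)
    ultimately have z: "(SUP x\<in>{0..1}. \<bar>\<phi> x - \<psi> x\<bar>) = 0"
      using m unfolding C1_dist_def by auto
    have "\<phi> x = \<psi> x" if "x \<in> {0..1}" for x
      using cSUP_upper[OF that bdd_above_abs_diff[OF continuous_on_C1(1)[OF m(1)] continuous_on_C1(1)[OF m(2)]]] z
      by auto
    then show "\<phi> = \<psi>"
      using m unfolding C1_def by (auto intro: extensionalityI)
  qed (use m in \<open>auto simp: C1_dist_def\<close>)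
next
  fix \<phi> \<psi> \<eta> assume m: "\<phi> \<in> C1" "\<psi> \<in> C1" "\<eta> \<in> C1"
  show "C1_dist \<phi> \<eta> \<le> C1_dist \<phi> \<psi> + C1_dist \<psi> \<eta>"
    using SUP_abs_diff_triangle[OF continuous_on_C1(1)[OF m(1)] continuous_on_C1(1)[OF m(2)] continuous_on_C1(1)[OF m(3)]]
      SUP_abs_diff_triangle[OF continuous_on_C1(2)[OF m(1)] continuous_on_C1(2)[OF m(2)] continuous_on_C1(2)[OF m(3)]] m
    unfolding C1_dist_def by simp
qed

text \<open>The cube \<open>[0,1]^m\<close>; for \<open>m = 0\<close> it is a one-point space.\<close>
definition cube :: "nat \<Rightarrow> (nat \<Rightarrow> real) topology" where
  "cube m = product_topology (\<lambda>_. top_of_set {0..1}) {..<m}"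

section \<open>The boundary value problem\<close>

text \<open>
  The hypotheses on \<open>f\<close>, with \<open>zm\<close>, \<open>zp\<close> standing for the first negative and first positive zero
  of \<open>|s|^(q-2) s - f(s)\<close>. The two one-sided limits are not required to coincide.
\<close>
definition standing :: "real \<Rightarrow> real \<Rightarrow> (real \<Rightarrow> real) \<Rightarrow> real \<Rightarrow> real \<Rightarrow> bool" where
  "standing p q f zm zp \<longleftrightarrow>
     1 < p \<and> 1 < q \<and> continuous_on UNIV f \<and>
     spow q 0 - f 0 = 0 \<and>
     0 < zp \<and> spow q zp - f zp = 0 \<and> (\<forall>s\<in>{0<..<zp}. spow q s - f s \<noteq> 0) \<and>
     zm < 0 \<and> spow q zm - f zm = 0 \<and> (\<forall>s\<in>{zm<..<0}. spow q s - f s \<noteq> 0) \<and>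
     strict_antimono_on {zm<..<0} (\<lambda>s. f s / spow q s) \<and>
     strict_mono_on {0<..<zp} (\<lambda>s. f s / spow q s) \<and>
     ((\<lambda>s. f s / spow q s) \<longlongrightarrow> 0) (at 0) \<and>
     (\<exists>L<0. ((\<lambda>s. (spow q s - f s - spow q zp + f zp) / (spow q s - spow q zp)) \<longlongrightarrow> L) (at_left zp)) \<and>
     (\<exists>L<0. ((\<lambda>s. (spow q s - f s - spow q zm + f zm) / (spow q s - spow q zm)) \<longlongrightarrow> L) (at_right zm))"

definition solutions :: "real \<Rightarrow> real \<Rightarrow> (real \<Rightarrow> real) \<Rightarrow> real \<Rightarrow> (real \<Rightarrow> real) set" where
  "solutions p q f lam =
     {\<phi> \<in> C1. is_C1 (\<lambda>x. spow p (D01 \<phi> x)) \<and>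
        (\<forall>x\<in>{0<..<1}. - D01 (\<lambda>y. spow p (D01 \<phi> y)) x = lam * (spow q (\<phi> x) - f (\<phi> x))) \<and>
        \<phi> 0 = 0 \<and> \<phi> 1 = 0}"

definition simple_zeros :: "nat \<Rightarrow> (real \<Rightarrow> real) \<Rightarrow> bool" where
  "simple_zeros m \<phi> \<longleftrightarrow>
     finite {x\<in>{0<..<1}. \<phi> x = 0} \<and> card {x\<in>{0<..<1}. \<phi> x = 0} = m \<and>
     (\<forall>x\<in>{0<..<1}. \<phi> x = 0 \<longrightarrow> D01 \<phi> x \<noteq> 0)"

definition S_plus :: "nat \<Rightarrow> (real \<Rightarrow> real) set" where
  "S_plus k = {\<phi> \<in> C1. \<phi> 0 = 0 \<and> \<phi> 1 = 0 \<and> D01 \<phi> 0 > 0 \<and> simple_zeros (k - 1) \<phi>}"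

definition S_minus :: "nat \<Rightarrow> (real \<Rightarrow> real) set" where
  "S_minus k = {\<phi> \<in> C1. \<phi> 0 = 0 \<and> \<phi> 1 = 0 \<and> D01 \<phi> 0 < 0 \<and> simple_zeros (k - 1) \<phi>}"

section \<open>Time maps, thresholds and exponents\<close>

definition Fprim :: "(real \<Rightarrow> real) \<Rightarrow> real \<Rightarrow> real" where
  "Fprim f s = (LBINT \<xi>=ereal 0..ereal s. f \<xi>)"

definition Apot :: "real \<Rightarrow> (real \<Rightarrow> real) \<Rightarrow> real \<Rightarrow> real" where
  "Apot q f s = \<bar>s\<bar> powr q / q - Fprim f s"

text \<open>
  The integrand is singular at \<open>t = a\<close> (where \<open>powr\<close> returns \<open>0\<close>). For \<open>p \<le> 2\<close> the integral
  diverges at \<open>a = zp\<close>; the definitions below use \<open>timeI\<close> and \<open>timeJ\<close> only when \<open>p > 2\<close>, where it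
  is finite.
\<close>
definition timeI :: "real \<Rightarrow> real \<Rightarrow> (real \<Rightarrow> real) \<Rightarrow> real \<Rightarrow> real" where
  "timeI p q f a =
     integral {0..a} (\<lambda>t. (Fprim f t - Fprim f a + (a powr q - t powr q) / q) powr (- 1 / p))"

definition timeJ :: "real \<Rightarrow> real \<Rightarrow> (real \<Rightarrow> real) \<Rightarrow> real \<Rightarrow> real" where
  "timeJ p q f a =
     integral {a..0} (\<lambda>t. (Fprim f t - Fprim f a + (\<bar>a\<bar> powr q - \<bar>t\<bar> powr q) / q) powr (- 1 / p))"

text \<open>
  \<open>rmax \<dots> z\<close> is the positive number \<open>r\<close> with \<open>r^p = \<lambda> p / (p-1) A(z)\<close>, used for \<open>z = zp\<close>
  and \<open>z = zm\<close>.
\<close>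
definition rmax :: "real \<Rightarrow> real \<Rightarrow> (real \<Rightarrow> real) \<Rightarrow> real \<Rightarrow> real \<Rightarrow> real" where
  "rmax p q f lam z = (lam * p / (p - 1) * Apot q f z) powr (1 / p)"

definition rstar :: "real \<Rightarrow> real \<Rightarrow> (real \<Rightarrow> real) \<Rightarrow> real \<Rightarrow> real \<Rightarrow> real \<Rightarrow> real" where
  "rstar p q f zm zp lam = min (rmax p q f lam zp) (rmax p q f lam zm)"

definition zpt :: "real \<Rightarrow> real \<Rightarrow> (real \<Rightarrow> real) \<Rightarrow> real \<Rightarrow> real \<Rightarrow> real \<Rightarrow> real" where
  "zpt p q f zp lam r = (THE z. z \<in> {0<..zp} \<and> r powr p = lam * p / (p - 1) * Apot q f z)"

definition Spt :: "real \<Rightarrow> real \<Rightarrow> (real \<Rightarrow> real) \<Rightarrow> real \<Rightarrow> real \<Rightarrow> real \<Rightarrow> real" where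
  "Spt p q f zm lam r = (THE z. z \<in> {zm..<0} \<and> r powr p = lam * p / (p - 1) * Apot q f z)"

definition Istar :: "real \<Rightarrow> real \<Rightarrow> (real \<Rightarrow> real) \<Rightarrow> real \<Rightarrow> real \<Rightarrow> real \<Rightarrow> real" where
  "Istar p q f zm zp lam = timeI p q f (zpt p q f zp lam (rstar p q f zm zp lam))"

definition Jstar :: "real \<Rightarrow> real \<Rightarrow> (real \<Rightarrow> real) \<Rightarrow> real \<Rightarrow> real \<Rightarrow> real \<Rightarrow> real" where
  "Jstar p q f zm zp lam = timeJ p q f (Spt p q f zm lam (rstar p q f zm zp lam))"

definition lambda_eig :: "real \<Rightarrow> nat \<Rightarrow> real" where
  "lambda_eig p n =
     real n powr p * (p - 1) * (2 * integral {0..1} (\<lambda>t. (1 - t powr p) powr (- 1 / p))) powr p"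

text \<open>
  The thresholds \<open>\<lambda>\<^sub>n\<^sup>\<plusminus>\<close>, for \<open>n \<ge> 1\<close>, with value \<open>\<infinity>\<close> for \<open>p \<le> 2\<close>. Even indices are \<open>n = 2m\<close> and
  odd indices are \<open>n = 2m - 1\<close>. The argument \<open>lam\<close> enters only through \<open>zpt\<close> and \<open>Spt\<close> at
  \<open>rstar\<close>, and the values do not depend on it as long as \<open>lam > 0\<close>.
\<close>
definition lambda_plus ::
  "real \<Rightarrow> real \<Rightarrow> (real \<Rightarrow> real) \<Rightarrow> real \<Rightarrow> real \<Rightarrow> real \<Rightarrow> nat \<Rightarrow> ereal" where
  "lambda_plus p q f zm zp lam n =
     (if p \<le> 2 then \<infinity>
      else if n = 1 then ereal ((p - 1) / p * (2 * timeI p q f zp) powr p)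
      else if even n then
        (let m = real (n div 2) in
          ereal ((p - 1) / p * (2 * m * Istar p q f zm zp lam + 2 * m * Jstar p q f zm zp lam) powr p))
      else
        (let m = real ((n + 1) div 2) in
          ereal ((p - 1) / p * (2 * m * Istar p q f zm zp lam + 2 * (m - 1) * Jstar p q f zm zp lam) powr p)))"

definition lambda_minus ::
  "real \<Rightarrow> real \<Rightarrow> (real \<Rightarrow> real) \<Rightarrow> real \<Rightarrow> real \<Rightarrow> real \<Rightarrow> nat \<Rightarrow> ereal" where
  "lambda_minus p q f zm zp lam n =
     (if p \<le> 2 then \<infinity>
      else if n = 1 then ereal ((p - 1) / p * (2 * timeJ p q f zm) powr p)
      else if even n then
        (let m = real (n div 2) in
          ereal ((p - 1) / p * (2 * m * Istar p q f zm zp lam + 2 * m * Jstar p q f zm zp lam) powr p))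
      else
        (let m = real ((n + 1) div 2) in
          ereal ((p - 1) / p * (2 * (m - 1) * Istar p q f zm zp lam + 2 * m * Jstar p q f zm zp lam) powr p)))"

text \<open>Truncated subtraction is harmless below: \<open>m \<ge> 1\<close> for even \<open>n \<ge> 2\<close> and \<open>m \<ge> 2\<close> for odd \<open>n \<ge> 3\<close>.\<close>
definition exp_plus :: "real \<Rightarrow> (real \<Rightarrow> real) \<Rightarrow> real \<Rightarrow> real \<Rightarrow> nat \<Rightarrow> nat" where
  "exp_plus q f zm zp n =
     (if n = 1 then 0
      else if even n then
        (let m = n div 2 in if Apot q f zp = Apot q f zm then 2 * m - 1 else m - 1)
      else
        (let m = (n + 1) div 2 in
          if Apot q f zp = Apot q f zm then 2 * m - 2
          else if Apot q f zp < Apot q f zm then m - 1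
          else m - 2))"

definition exp_minus :: "real \<Rightarrow> (real \<Rightarrow> real) \<Rightarrow> real \<Rightarrow> real \<Rightarrow> nat \<Rightarrow> nat" where
  "exp_minus q f zm zp n =
     (if n = 1 then 0
      else if even n then
        (let m = n div 2 in if Apot q f zp = Apot q f zm then 2 * m - 1 else m - 1)
      else
        (let m = (n + 1) div 2 in
          if Apot q f zp = Apot q f zm then 2 * m - 2
          else if Apot q f zp < Apot q f zm then m - 2
          else m - 1))"

text \<open>
  The hypotheses \<open>standing\<close> say nothing about \<open>f\<close> outside \<open>[zm, zp]\<close> beyond continuity, and without
  further information there may be additional solutions with values outside \<open>[zm, zp]\<close>. For example,
  let \<open>p = q = 2\<close> and let \<open>h(s) = s - f(s)\<close> be \<open>s (1 - |s|)\<close> for \<open>|s| \<le> 1\<close> and \<open>4 (s - sgn s)\<close> for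
  \<open>|s| > 1\<close>. Then \<open>standing\<close> holds with \<open>zp = 1 = - zm\<close>, but for \<open>\<lambda> = \<lambda>\<^sub>1\<close> the half-period of the
  oscillation of amplitude \<open>a > 1\<close> is continuous in \<open>a\<close> and runs from \<open>\<infinity>\<close> (as \<open>a \<rightarrow> 1\<close>) to \<open>1/2\<close>
  (as \<open>a \<rightarrow> \<infinity>\<close>), so there is a nonzero solution. The set \<open>E\<^sub>\<lambda>\<close> therefore collects the solutions with
  values in \<open>[zm, zp]\<close>; these are all the solutions as soon as \<open>outer_sign\<close> holds.
\<close>
definition E_set :: "real \<Rightarrow> real \<Rightarrow> (real \<Rightarrow> real) \<Rightarrow> real \<Rightarrow> real \<Rightarrow> real \<Rightarrow> (real \<Rightarrow> real) set" where
  "E_set p q f zm zp lam = {\<phi> \<in> solutions p q f lam. \<phi> ` {0..1} \<subseteq> {zm..zp}}"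

definition outer_sign :: "real \<Rightarrow> (real \<Rightarrow> real) \<Rightarrow> real \<Rightarrow> real \<Rightarrow> bool" where
  "outer_sign q f zm zp \<longleftrightarrow>
     (\<forall>s>zp. spow q s - f s \<le> 0) \<and> (\<forall>s<zm. spow q s - f s \<ge> 0)"

end

theory Submission
  imports Defs
begin

text \<open>
  Put \<open>h(s) = |s|^(p-2) s - f(s)\<close>, let \<open>A\<close> be the primitive of \<open>h\<close> with \<open>A(0) = 0\<close> (the function \<open>Apot\<close>), and
  let \<open>\<mu>^p = \<lambda> p / (p-1)\<close>. Along a solution \<open>|\<phi>'|^p + \<mu>^p A(\<phi>)\<close> is constant; write the constant as
  \<open>\<mu>^p e\<close> and call \<open>e\<close> the level. Between two zeros a positive solution climbs to the point \<open>a\<close> with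
  \<open>A(a) = e\<close>, in the time \<open>I(a) / \<mu>\<close> obtained by separating variables, may then rest at the height \<open>a\<close>,
  and descends as it climbed. It can rest only at a zero of \<open>h\<close>, that is for \<open>a = zp\<close>, and it reaches
  \<open>zp\<close> in finite time only if \<open>p > 2\<close>, because \<open>A(zp) - A(t)\<close> is comparable to \<open>(zp - t)^2\<close>. This is the
  lemma \<open>bump\<close>; the negative bumps are covered by applying it to \<open>-h(-s)\<close>. So a solution with \<open>k\<close>
  nodal intervals is given by the sign of its initial slope, its level, and the lengths of the resting
  intervals (the cores), subject to the one condition that the time \<open>T k e\<close> that the bumps take to climb
  and descend and the lengths of the cores add up to \<open>1\<close> (\<open>bvp_arcs\<close>, \<open>arcs_level\<close>,
  \<open>up_solutions_is_profile\<close>).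

  The exponents of the two sides of the equation agree, so the substitution \<open>t = a s\<close> turns \<open>I(a)\<close> into
  the integral of \<open>R(a,s)^(-1/p)\<close> over \<open>[0,1]\<close>, where \<open>R(a,s)\<close> is the integral of
  \<open>\<sigma>^(p-1) (1 - g(a \<sigma>))\<close> over \<open>[s,1]\<close>. Monotonicity of \<open>g\<close> makes \<open>R\<close> decrease in \<open>a\<close>; hence \<open>I\<close> increases
  strictly, from the limit \<open>I0\<close> at \<open>a = 0\<close>, which belongs to the equation with \<open>f = 0\<close>. It
  follows that \<open>T k\<close> is continuous and strictly increasing on the levels up to \<open>estar\<close>, the smaller of
  \<open>A(zp)\<close> and \<open>A(zm)\<close>; its infimum is below \<open>1\<close> exactly if \<open>\<lambda> > \<lambda>_k\<close>, and its final value
  \<open>T k estar\<close> is below \<open>1\<close> exactly if \<open>\<lambda>\<close> exceeds the threshold \<open>\<lambda>_k^+\<close> (for \<open>p \<le> 2\<close> it is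
  infinite). If \<open>\<lambda> > \<lambda>_k\<close> and \<open>T k estar \<ge> 1\<close>, exactly one level fills the unit interval and it leaves
  no time for cores, so there is one solution (\<open>up_solutions_singleton\<close>). If \<open>T k estar < 1\<close>, the level must be \<open>estar\<close>, and the time
  \<open>1 - T k estar\<close> is distributed freely over the bumps that reach a zero of \<open>h\<close>: the solutions are
  parametrized by a simplex whose dimension is the number of these bumps minus one
  (\<open>up_solutions_homeomorphic_cube\<close>).

  For the topology, let \<open>phi0\<close> be the periodic wave without cores. The solution with cores \<open>c\<close> is
  \<open>phi0 \<circ> tau c\<close>, where the clock \<open>tau c\<close> stops at the extrema of \<open>phi0\<close>. The derivative of \<open>phi0\<close>
  vanishes where the clock stops, so the derivative of the solution is \<open>phi0' \<circ> tau c\<close>, and uniform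
  continuity of \<open>phi0\<close> and \<open>phi0'\<close> gives continuous dependence on \<open>c\<close> in the \<open>C\<^sup>1\<close> topology. A continuous
  bijection from a compact space to a Hausdorff space is a homeomorphism, and a radial rescaling maps
  the cube onto the simplex.

  Two reductions shorten the case analysis. Passing from \<open>f(s)\<close> to \<open>-f(-s)\<close> exchanges the solutions with
  positive and with negative initial slope. For \<open>k = 1\<close> only the positive half of \<open>h\<close> matters, and
  replacing \<open>h\<close> by its odd extension makes \<open>A(zp) = A(zm)\<close>, so that the general statement applies.
\<close>

section \<open>Signed powers\<close>

lemma spow_zero [simp]: "spow r 0 = 0"
  by (simp add: spow_def)

lemma spow_minus [simp]: "spow r (- s) = - spow r s"
  by (simp add: spow_def)

lemma spow_nonneg_eq: "0 \<le> s \<Longrightarrow> spow r s = s powr (r - 1)"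
proof (cases "s = 0")
  case False
  assume "0 \<le> s"
  have "s powr (r - 2) * s powr 1 = s powr (r - 1)"
    by (simp only: powr_add[symmetric]) simp
  with False \<open>0 \<le> s\<close> show ?thesis by (simp add: spow_def)
qed simp

text \<open>
  The exponents \<open>p\<close> and \<open>p / (p - 1)\<close> are conjugate: \<open>(p - 1) (p / (p - 1) - 1) = 1\<close>. The equation controls
  \<open>spow p \<phi>'\<close>, and this lemma recovers \<open>\<phi>'\<close> from it.
\<close>
lemma spow_inverse:
  assumes "1 < p"
  shows "spow (p / (p - 1)) (spow p s) = s"
proof -
  have pos: "spow (p / (p - 1)) (spow p s) = s" if "0 \<le> s" for s
  proof (cases "s = 0")
    case False
    with that have "0 < s" by simp
    moreover have "(p - 1) * (p / (p - 1) - 1) = 1" using assms by (simp add: field_simps)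
    ultimately show ?thesis by (simp add: spow_nonneg_eq powr_powr)
  qed simp
  show ?thesis
  proof (cases "0 \<le> s")
    case False
    then show ?thesis using pos[of "- s"] by simp
  qed (simp add: pos)
qed

lemma spow_strict_mono:
  assumes "1 < p" "s < t"
  shows "spow p s < spow p t"
proof -
  have pos: "spow p s < spow p t" if "0 \<le> s" "s < t" for s t
    using that assms by (simp add: spow_nonneg_eq powr_less_mono2)
  consider "0 \<le> s" | "s < 0" "t \<le> 0" | "s < 0" "0 < t" by linarith
  then show ?thesis
  proof cases
    case 2 then show ?thesis using pos[of "-t" "-s"] assms by simp
  next
    case 3 then show ?thesis using pos[of 0 "-s"] pos[of 0 t] by simp
  qed (use pos assms in blast)
qed

lemma spow_less_iff: "1 < p \<Longrightarrow> spow p s < spow p t \<longleftrightarrow> s < t"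
  by (metis linorder_neqE_linordered_idom order_less_asym spow_strict_mono)

lemma DERIV_abs_powr:
  assumes "1 < r"
  shows "((\<lambda>s. \<bar>s\<bar> powr r) has_real_derivative r * spow r s) (at s)"
proof -
  consider "0 < s" | "s < 0" | "s = 0" by linarith
  then show ?thesis
  proof cases
    case 1
    have "((\<lambda>s. s powr r) has_real_derivative r * spow r s) (at s)"
      using 1 by (auto intro!: derivative_eq_intros simp: spow_nonneg_eq)
    then show ?thesis
      by (rule has_field_derivative_transform_within_open[of _ _ _ "{0<..}"]) (use 1 in auto)
  next
    case 2
    have eq: "spow r s = - ((- s) powr (r - 1))" using 2 spow_nonneg_eq[of "-s" r] by simp
    have "((\<lambda>s. (- s) powr r) has_real_derivative r * spow r s) (at s)"
      using 2 by (auto intro!: derivative_eq_intros simp: eq)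
    then show ?thesis
      by (rule has_field_derivative_transform_within_open[of _ _ _ "{..<0}"]) (use 2 in auto)
  next
    case 3
    have "((\<lambda>s. \<bar>s\<bar> powr (r - 1)) \<longlongrightarrow> \<bar>0\<bar> powr (r - 1)) (at (0::real))"
      using assms by (intro tendsto_powr' tendsto_intros) auto
    then have "((\<lambda>s. \<bar>s\<bar> powr r / s) \<longlongrightarrow> 0) (at (0::real))"
    proof (rule Lim_null_comparison[rotated, OF tendsto_eq_rhs])
      show "\<forall>\<^sub>F s in at (0::real). norm (\<bar>s\<bar> powr r / s) \<le> \<bar>s\<bar> powr (r - 1)"
        by (auto simp: eventually_at powr_diff intro!: exI[of _ 1])
    qed simp
    then show ?thesis using 3 by (simp add: DERIV_def)
  qed
qed

lemma continuous_on_spow [continuous_intros]: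
  assumes "1 < p" "continuous_on S f"
  shows "continuous_on S (\<lambda>x. spow p (f x))"
proof -
  have "isCont (spow p) s" for s
  proof -
    have "((\<lambda>s. \<bar>s\<bar> powr (p - 1) * sgn s) \<longlongrightarrow> \<bar>s\<bar> powr (p - 1) * sgn s) (at s)"
    proof (cases "s = 0")
      case True
      have "((\<lambda>s. \<bar>s\<bar> powr (p - 1)) \<longlongrightarrow> \<bar>0\<bar> powr (p - 1)) (at (0::real))"
        using assms by (intro tendsto_powr' tendsto_intros) auto
      then have "((\<lambda>s. \<bar>s\<bar> powr (p - 1) * sgn s) \<longlongrightarrow> 0) (at (0::real))"
        by (rule Lim_null_comparison[rotated, OF tendsto_eq_rhs])
           (auto simp: eventually_at sgn_if intro!: exI[of _ 1])
      then show ?thesis using True by simp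
    next
      case False
      then show ?thesis using assms by (intro tendsto_intros) auto
    qed
    moreover have "spow p = (\<lambda>s. \<bar>s\<bar> powr (p - 1) * sgn s)"
    proof
      fix s show "spow p s = \<bar>s\<bar> powr (p - 1) * sgn s"
        using spow_nonneg_eq[of s p] spow_nonneg_eq[of "-s" p] by (cases "0 \<le> s") (auto simp: sgn_if)
    qed
    ultimately show ?thesis by (simp add: isCont_def)
  qed
  then have "continuous_on UNIV (spow p)" by (simp add: continuous_at_imp_continuous_on)
  from continuous_on_compose2[OF this assms(2)] show ?thesis by simp
qed

section \<open>Comparison of functions and of integrals\<close>

text \<open>
  The gaps of the potential are compared through their slopes: functions that meet at the right end
  point are ordered to the left of it inversely to their derivatives.
\<close>
lemma greater_left_if_slope_less:
  fixes f g :: "real \<Rightarrow> real"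
  assumes "s < b" "continuous_on {s..b} f" "continuous_on {s..b} g" "f b = g b"
    and "\<And>x. s < x \<Longrightarrow> x < b \<Longrightarrow> \<exists>y z. (f has_real_derivative y) (at x) \<and> (g has_real_derivative z) (at x) \<and> y < z"
  shows "g s < f s"
proof -
  have "(\<lambda>x. f x - g x) b < (\<lambda>x. f x - g x) s"
  proof (rule DERIV_neg_imp_decreasing_open[OF assms(1)])
    fix x assume "s < x" "x < b"
    then obtain y z where "(f has_real_derivative y) (at x)" "(g has_real_derivative z) (at x)" "y < z"
      using assms(5) by blast
    then show "\<exists>y. ((\<lambda>x. f x - g x) has_real_derivative y) (at x) \<and> y < 0"
      by (intro exI[of _ "y - z"]) (auto intro!: derivative_eq_intros)
  qed (intro continuous_intros assms)
  then show ?thesis using assms(4) by simp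
qed

lemma greater_left_if_slope_le:
  fixes f g :: "real \<Rightarrow> real"
  assumes "s \<le> b" "continuous_on {s..b} f" "continuous_on {s..b} g" "f b = g b"
    and "\<And>x. s < x \<Longrightarrow> x < b \<Longrightarrow> \<exists>y z. (f has_real_derivative y) (at x) \<and> (g has_real_derivative z) (at x) \<and> y \<le> z"
  shows "g s \<le> f s"
proof -
  have "(\<lambda>x. g x - f x) s \<le> (\<lambda>x. g x - f x) b"
  proof (rule DERIV_nonneg_imp_increasing_open[OF assms(1)])
    fix x assume "s < x" "x < b"
    then obtain y z where "(f has_real_derivative y) (at x)" "(g has_real_derivative z) (at x)" "y \<le> z"
      using assms(5) by blast
    then show "\<exists>y. ((\<lambda>x. g x - f x) has_real_derivative y) (at x) \<and> 0 \<le> y"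
      by (intro exI[of _ "z - y"]) (auto intro!: derivative_eq_intros)
  qed (intro continuous_intros assms)
  then show ?thesis using assms(4) by simp
qed

text \<open>
  The integrands of the time maps blow up at \<open>1\<close>. Strict inequality is therefore taken from the left
  half of the interval, where they are continuous.
\<close>
lemma integral_strict_less:
  fixes f g :: "real \<Rightarrow> real"
  assumes "f integrable_on {0..1}" "g integrable_on {0..1}"
    and "\<And>s. s \<in> {0..1} \<Longrightarrow> f s \<le> g s"
    and "continuous_on {0..1/2} f" "continuous_on {0..1/2} g"
    and "\<And>s. s \<in> {0..1/2} \<Longrightarrow> f s < g s"
  shows "integral {0..1} f < integral {0..1} g"
proof -
  have "integral {0..1/2} f < integral {0..1/2} g"
    by (rule integral_less_real) (use assms in auto)
  moreover have "integral {1/2..1} f \<le> integral {1/2..1} g"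
    by (rule integral_le) (use assms in \<open>auto intro: integrable_on_subinterval\<close>)
  moreover have "integral {0..1} u = integral {0..1/2} u + integral {1/2..1} u"
    if "u integrable_on {0..1}" for u :: "real \<Rightarrow> real"
    using Henstock_Kurzweil_Integration.integral_combine[of 0 "1/2" 1 u] that by simp
  ultimately show ?thesis using assms by simp
qed

lemma borel_measurable_lebesgue_on:
  fixes f :: "real \<Rightarrow> real"
  assumes "f \<in> borel_measurable borel"
  shows "f \<in> borel_measurable (lebesgue_on S)"
  using assms by (intro measurable_restrict_space1 measurable_completion) simp

lemma powr_end_integrable:
  fixes a :: real
  assumes "0 < a" "\<alpha> < 1"
  shows "(\<lambda>t. (a - t) powr (- \<alpha>)) integrable_on {0..a}"
proof -
  define F where "F = (\<lambda>t. - ((a - t) powr (1 - \<alpha>)) / (1 - \<alpha>))"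
  have "((\<lambda>t. (a - t) powr (- \<alpha>)) has_integral (F a - F 0)) {0..a}"
  proof (rule fundamental_theorem_of_calculus_interior)
    show "continuous_on {0..a} F"
      unfolding F_def using assms by (intro continuous_intros continuous_on_powr') auto
    fix x assume "x \<in> {0<..<a}"
    then show "(F has_vector_derivative (a - x) powr (- \<alpha>)) (at x)"
      unfolding F_def has_real_derivative_iff_has_vector_derivative[symmetric] using assms
      by (auto intro!: derivative_eq_intros)
  qed (use assms in simp)
  then show ?thesis by blast
qed

section \<open>One side of the potential well and its time map\<close>

text \<open>
  The data of one side of the well, with \<open>A\<close> a primitive of \<open>h\<close>. The side of the negative values of \<open>h\<close> is
  an instance with \<open>- h (- s)\<close>, \<open>A (- s)\<close> in place of \<open>h s\<close>, \<open>A s\<close>. The quotient in \<open>ratio_anti\<close> and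
  \<open>ratio_lim\<close> is \<open>1 - g\<close> in terms of the function \<open>g\<close> of the standing hypotheses, and \<open>h_linear\<close> is what
  the finite negative slope \<open>L\<close> at the end point gives.
\<close>
locale half_well =
  fixes p lam :: real and h A :: "real \<Rightarrow> real" and zb :: real
  assumes p_gt1: "1 < p" and lam_pos: "0 < lam" and zb_pos: "0 < zb"
    and A_deriv: "\<And>s. (A has_real_derivative h s) (at s)"
    and h_cont: "continuous_on UNIV h"
    and A_0: "A 0 = 0"
    and h_pos: "\<And>s. 0 < s \<Longrightarrow> s < zb \<Longrightarrow> 0 < h s"
    and h_zb: "h zb = 0"
    and ratio_anti: "\<And>s t. 0 < s \<Longrightarrow> s < t \<Longrightarrow> t < zb \<Longrightarrow> h t / t powr (p - 1) < h s / s powr (p - 1)"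
    and ratio_lim: "((\<lambda>s. h s / s powr (p - 1)) \<longlongrightarrow> 1) (at_right 0)"
    and h_linear: "\<exists>\<kappa>1>0. \<exists>\<kappa>2>0. \<exists>\<delta>>0. \<forall>s. zb - \<delta> \<le> s \<and> s \<le> zb \<longrightarrow>
                      \<kappa>1 * (zb - s) \<le> h s \<and> h s \<le> \<kappa>2 * (zb - s)"
begin

lemma A_cont: "continuous_on S A"
  using A_deriv by (meson DERIV_continuous_on has_field_derivative_at_within)

lemma A_borel: "A \<in> borel_measurable borel"
  by (rule borel_measurable_continuous_onI[OF A_cont])

lemma A_less: "0 \<le> s \<Longrightarrow> s < t \<Longrightarrow> t \<le> zb \<Longrightarrow> A s < A t"
  by (rule DERIV_pos_imp_increasing_open[of s t A]) (use A_deriv h_pos A_cont in force)+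

lemma A_le: "0 \<le> s \<Longrightarrow> s \<le> t \<Longrightarrow> t \<le> zb \<Longrightarrow> A s \<le> A t"
  using A_less[of s t] by (cases "s = t") auto

lemma A_pos: "0 < s \<Longrightarrow> s \<le> zb \<Longrightarrow> 0 < A s"
  using A_less[of 0 s] A_0 by simp

lemma A_inj: "inj_on A {0..zb}"
  by (rule inj_onI) (metis A_less atLeastAtMost_iff linorder_neqE_linordered_idom order_less_irrefl)

lemma h_zero: "h 0 = 0"
proof -
  have "((\<lambda>s. h s / s powr (p - 1) * s powr (p - 1)) \<longlongrightarrow> 1 * 0 powr (p - 1)) (at_right 0)"
    using p_gt1 by (intro tendsto_mult ratio_lim tendsto_powr' tendsto_intros) (auto simp: eventually_at_filter)
  then have "(h \<longlongrightarrow> 0) (at_right 0)"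
    by (rule tendsto_cong[THEN iffD1, rotated, OF tendsto_eq_rhs]) (auto simp: eventually_at_filter)
  moreover have "(h \<longlongrightarrow> h 0) (at_right 0)"
    using h_cont by (simp add: continuous_on_eq_continuous_at isCont_def filterlim_at_split)
  ultimately show ?thesis using tendsto_unique[of "at_right (0::real)"] by auto
qed

lemma h_nonneg: "0 \<le> s \<Longrightarrow> s \<le> zb \<Longrightarrow> 0 \<le> h s"
  using h_pos[of s] h_zero h_zb by (cases "s = 0 \<or> s = zb") force+

definition ratio :: "real \<Rightarrow> real" where
  "ratio s = h s / s powr (p - 1)"

lemma ratio_less_1: "0 < s \<Longrightarrow> s < zb \<Longrightarrow> ratio s < 1"
proof -
  assume s: "0 < s" "s < zb"
  have "ratio (s/2) \<le> 1"
  proof (rule tendsto_lowerbound[OF ratio_lim])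
    show "\<forall>\<^sub>F x in at_right 0. ratio (s / 2) \<le> h x / x powr (p - 1)"
      unfolding ratio_def eventually_at_right_field
      by (rule exI[of _ "s/2"]) (use s ratio_anti[of _ "s/2"] in \<open>auto intro: less_imp_le\<close>)
  qed simp
  moreover have "ratio s < ratio (s/2)" using ratio_anti[of "s/2" s] s unfolding ratio_def by simp
  ultimately show ?thesis by simp
qed

lemma ratio_pos: "0 < s \<Longrightarrow> s < zb \<Longrightarrow> 0 < ratio s"
  unfolding ratio_def using h_pos by simp

subsection \<open>Finiteness of the time map\<close>

text \<open>
  The amplitudes with a finite climbing time: at \<open>zb\<close> the integrand has a singularity of order \<open>2 / p\<close>,
  below \<open>zb\<close> one of order \<open>1 / p\<close>.
\<close>
definition adm :: "real \<Rightarrow> bool" where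
  "adm a \<longleftrightarrow> 0 < a \<and> a \<le> zb \<and> (a < zb \<or> 2 < p)"

definition ig :: "real \<Rightarrow> real \<Rightarrow> real" where
  "ig a t = (A a - A t) powr (- 1 / p)"

definition I :: "real \<Rightarrow> real" where
  "I a = integral {0..a} (ig a)"

lemma ig_nonneg: "0 \<le> ig a t"
  by (simp add: ig_def)

lemma ig_measurable: "ig a \<in> borel_measurable (lebesgue_on S)"
  unfolding ig_def
  by (intro borel_measurable_lebesgue_on powr_real_measurable borel_measurable_diff A_borel) auto

lemma ig_cont: "0 < a \<Longrightarrow> a \<le> zb \<Longrightarrow> S \<subseteq> {0..<a} \<Longrightarrow> continuous_on S (ig a)"
  unfolding ig_def by (intro continuous_intros A_cont) (use A_less in force)

text \<open>
  Two cases are needed: \<open>j = 0\<close> at a turning point below \<open>zb\<close>, where \<open>h\<close> is positive, and \<open>j = 1\<close> at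
  \<open>zb\<close>, where \<open>h\<close> vanishes to first order. The estimate comes from \<open>[b, a]\<close>; to the left of \<open>b\<close> it
  persists with a smaller constant because the gap grows and \<open>a - t\<close> is bounded.
\<close>
lemma gap_lower_power:
  fixes j :: nat
  assumes b: "0 \<le> b" "b < a" "a \<le> zb" and m: "0 < m"
    and h_low: "\<And>s. b \<le> s \<Longrightarrow> s \<le> a \<Longrightarrow> m * (a - s) ^ j \<le> h s"
  shows "\<exists>m'>0. \<forall>t\<in>{0..a}. m' * (a - t) ^ (j + 1) \<le> A a - A t"
proof -
  define q where "q = (a - b) / a"
  have q: "0 < q" "q \<le> 1" using b by (auto simp: q_def)
  have near: "m / (j + 1) * (a - t) ^ (j + 1) \<le> A a - A t" if "b \<le> t" "t \<le> a" for t
  proof -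
    have "(\<lambda>t. m / (j + 1) * (a - t) ^ (j + 1)) t \<le> (\<lambda>t. A a - A t) t"
    proof (rule greater_left_if_slope_le[of t a])
      fix x assume x: "t < x" "x < a"
      have "((\<lambda>t. A a - A t) has_real_derivative - h x) (at x)"
        using A_deriv[of x] by (auto intro!: derivative_eq_intros)
      moreover have "((\<lambda>t. m / (j + 1) * (a - t) ^ (j + 1)) has_real_derivative - (m * (a - x) ^ j)) (at x)"
        by (rule derivative_eq_intros | simp)+
      moreover have "- h x \<le> - (m * (a - x) ^ j)" using h_low[of x] x that by simp
      ultimately show "\<exists>y z. ((\<lambda>t. A a - A t) has_real_derivative y) (at x) \<and>
          ((\<lambda>t. m / (j + 1) * (a - t) ^ (j + 1)) has_real_derivative z) (at x) \<and> y \<le> z" by blast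
    qed (use that in \<open>auto intro!: continuous_intros A_cont\<close>)
    then show ?thesis by simp
  qed
  have "m / (j + 1) * q ^ (j + 1) * (a - t) ^ (j + 1) \<le> A a - A t" if t: "0 \<le> t" "t \<le> a" for t
  proof (cases "b \<le> t")
    case True
    have "q ^ (j + 1) \<le> 1" using q by (intro power_le_one) auto
    then have "m / (j + 1) * q ^ (j + 1) \<le> m / (j + 1)"
      using m by (intro mult_left_le) auto
    then have "m / (j + 1) * q ^ (j + 1) * (a - t) ^ (j + 1) \<le> m / (j + 1) * (a - t) ^ (j + 1)"
      using t by (intro mult_right_mono) auto
    with near[OF True] t show ?thesis by linarith
  next
    case False
    have "q * (a - t) \<le> q * a" using b t q by (intro mult_left_mono) auto
    also have "\<dots> = a - b" using b by (simp add: q_def)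
    finally have "q * (a - t) \<le> a - b" .
    then have "(q * (a - t)) ^ (j + 1) \<le> (a - b) ^ (j + 1)"
      using q t by (intro power_mono) auto
    then have "m / (j + 1) * (q * (a - t)) ^ (j + 1) \<le> m / (j + 1) * (a - b) ^ (j + 1)"
      using m by (intro mult_left_mono) auto
    also have "\<dots> \<le> A a - A b" using near[of b] b by simp
    also have "\<dots> \<le> A a - A t" using A_le[of t b] False t b by simp
    finally show ?thesis by (simp only: power_mult_distrib mult.assoc)
  qed
  moreover have "0 < m / (j + 1) * q ^ (j + 1)" using m q by simp
  ultimately show ?thesis by (intro exI[of _ "m / (j + 1) * q ^ (j + 1)"]) auto
qed

text \<open>
  The condition \<open>j + 1 < p\<close> is what makes \<open>(a - t) powr (- (j + 1) / p)\<close> an integrable majorant.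
\<close>
lemma adm_gap_lower:
  assumes "adm a"
  shows "\<exists>m>0. \<exists>j::nat. real (j + 1) < p \<and> (\<forall>t\<in>{0..a}. m * (a - t) ^ (j + 1) \<le> A a - A t)"
proof (cases "a < zb")
  case True
  have a: "0 < a" using assms by (simp add: adm_def)
  have "continuous_on {a/2..a} h" using h_cont continuous_on_subset by blast
  then obtain x where x: "x \<in> {a/2..a}" "\<And>y. y \<in> {a/2..a} \<Longrightarrow> h x \<le> h y"
    using continuous_attains_inf[of "{a/2..a}" h] a by force
  have "0 < h x" using x(1) a True by (intro h_pos) auto
  then obtain m' where "m' > 0" "\<forall>t\<in>{0..a}. m' * (a - t) ^ (0 + 1) \<le> A a - A t"
    using gap_lower_power[of "a/2" a "h x" 0] a True x by auto
  then show ?thesis using p_gt1 by (intro exI[of _ m'] conjI exI[of _ "0::nat"]) auto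
next
  case False
  then have a: "a = zb" "2 < p" using assms by (auto simp: adm_def)
  obtain \<kappa> \<delta> where k: "\<kappa> > 0" "\<delta> > 0" "\<And>s. zb - \<delta> \<le> s \<Longrightarrow> s \<le> zb \<Longrightarrow> \<kappa> * (zb - s) \<le> h s"
    using h_linear by blast
  obtain m' where "m' > 0" "\<forall>t\<in>{0..a}. m' * (a - t) ^ (1 + 1) \<le> A a - A t"
    using gap_lower_power[of "max 0 (zb - \<delta>)" a \<kappa> 1] a k zb_pos by auto
  then show ?thesis using a by (intro exI[of _ m'] conjI exI[of _ "1::nat"]) auto
qed

lemma ig_integrable:
  assumes "adm a"
  shows "ig a integrable_on {0..a}"
proof -
  obtain m and j :: nat where m: "m > 0" "real (j + 1) < p"
    "\<And>t. t \<in> {0..a} \<Longrightarrow> m * (a - t) ^ (j + 1) \<le> A a - A t"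
    using adm_gap_lower[OF assms] by blast
  have a: "0 < a" using assms by (simp add: adm_def)
  define \<alpha> where "\<alpha> = real (j + 1) / p"
  have \<alpha>: "\<alpha> < 1" using m p_gt1 by (simp add: \<alpha>_def)
  show ?thesis
  proof (rule measurable_bounded_by_integrable_imp_integrable[OF ig_measurable])
    show "(\<lambda>t. m powr (- 1 / p) * (a - t) powr (- \<alpha>)) integrable_on {0..a}"
      by (intro integrable_on_mult_right powr_end_integrable a \<alpha>)
    fix t assume t: "t \<in> {0..a}"
    show "norm (ig a t) \<le> m powr (- 1 / p) * (a - t) powr (- \<alpha>)"
    proof (cases "t = a")
      case False
      then have ta: "0 < a - t" using t by simp
      have "ig a t \<le> (m * (a - t) ^ (j + 1)) powr (- 1 / p)"
        unfolding ig_def using m(1) m(3)[OF t] ta p_gt1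
        by (intro powr_mono2') auto
      also have "\<dots> = m powr (- 1 / p) * ((a - t) powr real (j + 1)) powr (- 1 / p)"
        using m(1) ta by (simp only: powr_realpow powr_mult)
      also have "\<dots> = m powr (- 1 / p) * (a - t) powr (- \<alpha>)"
        by (simp add: powr_powr \<alpha>_def)
      finally show ?thesis by (simp add: ig_nonneg)
    qed (simp add: ig_def)
  qed auto
qed

lemma ig_integrable_sub: "0 < a \<Longrightarrow> a \<le> zb \<Longrightarrow> y < a \<Longrightarrow> ig a integrable_on {0..y}"
  by (intro integrable_continuous_real ig_cont) auto

lemma ig_anti:
  assumes "0 \<le> t" "t < a" "a \<le> b" "b \<le> zb"
  shows "ig b t \<le> ig a t"
  unfolding ig_def using A_less[of t a] A_le[of a b] assms p_gt1 by (intro powr_mono2') auto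

text \<open>
  For \<open>p \<le> 2\<close> the point \<open>zb\<close> is not reached in finite time: the gap \<open>A zb - A t\<close> is at most quadratic in
  \<open>zb - t\<close>, so the integrand is at least a multiple of \<open>1 / (zb - t)\<close>, whose integral diverges
  logarithmically.
\<close>
lemma ig_zb_unbounded:
  assumes "p \<le> 2"
  shows "\<exists>y. 0 < y \<and> y < zb \<and> K < integral {0..y} (ig zb)"
proof -
  obtain \<kappa> \<delta> where k: "\<kappa> > 0" "\<delta> > 0" "\<And>s. zb - \<delta> \<le> s \<Longrightarrow> s \<le> zb \<Longrightarrow> h s \<le> \<kappa> * (zb - s)"
    using h_linear by blast
  define b where "b = max (zb / 2) (zb - min \<delta> 1)"
  have b: "0 < b" "b < zb" "zb - b \<le> 1" "zb - \<delta> \<le> b" using zb_pos k by (auto simp: b_def)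
  have gap: "A zb - A t \<le> \<kappa> / 2 * (zb - t)\<^sup>2" if "b \<le> t" "t \<le> zb" for t
  proof -
    have "(\<lambda>t. A zb - A t) t \<le> (\<lambda>t. \<kappa> / 2 * (zb - t)\<^sup>2) t"
    proof (rule greater_left_if_slope_le[of t zb])
      fix x assume x: "t < x" "x < zb"
      have "((\<lambda>t. A zb - A t) has_real_derivative - h x) (at x)"
        using A_deriv[of x] by (auto intro!: derivative_eq_intros)
      moreover have "((\<lambda>t. \<kappa> / 2 * (zb - t)\<^sup>2) has_real_derivative - (\<kappa> * (zb - x))) (at x)"
        by (auto intro!: derivative_eq_intros simp: field_simps)
      moreover have "- (\<kappa> * (zb - x)) \<le> - h x" using k(3)[of x] x that b by simp
      ultimately show "\<exists>y z. ((\<lambda>t. \<kappa> / 2 * (zb - t)\<^sup>2) has_real_derivative y) (at x) \<and>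
          ((\<lambda>t. A zb - A t) has_real_derivative z) (at x) \<and> y \<le> z" by blast
    qed (use that in \<open>auto intro!: continuous_intros A_cont\<close>)
    then show ?thesis by simp
  qed
  define C where "C = (\<kappa> / 2) powr (- 1 / p)"
  have C: "0 < C" using k by (simp add: C_def)
  have low: "C / (zb - t) \<le> ig zb t" if t: "b \<le> t" "t < zb" for t
  proof -
    have "(zb - t) powr 1 \<ge> (zb - t) powr (2 / p)"
      using t b assms p_gt1 by (intro powr_mono') auto
    then have "inverse (zb - t) \<le> inverse ((zb - t) powr (2 / p))"
      using t by (intro le_imp_inverse_le) auto
    then have "C / (zb - t) \<le> C * (zb - t) powr (- (2 / p))"
      using C t by (simp add: divide_inverse powr_minus)
    also have "\<dots> = C * ((zb - t) powr 2) powr (- 1 / p)" by (simp add: powr_powr)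
    also have "\<dots> = (\<kappa> / 2 * (zb - t)\<^sup>2) powr (- 1 / p)"
      using k t powr_mult[of "\<kappa> / 2" "(zb - t)\<^sup>2" "- 1 / p"] by (simp only: C_def) simp
    also have "\<dots> \<le> ig zb t"
      unfolding ig_def using gap[of t] A_less[of t zb] t b p_gt1 by (intro powr_mono2') auto
    finally show ?thesis .
  qed
  \<comment> \<open>With this choice the logarithmic lower bound integrates to exactly \<open>\<bar>K\<bar> + 1\<close> on \<open>[b, y]\<close>.\<close>
  define w where "w = exp (- ((\<bar>K\<bar> + 1) / C))"
  have w: "0 < w" "w < 1" using C by (auto simp: w_def)
  define y where "y = zb - (zb - b) * w"
  have "0 < (zb - b) * (1 - w)" using w b by simp
  moreover have "y - b = (zb - b) * (1 - w)" by (simp add: y_def algebra_simps)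
  ultimately have "b < y" by linarith
  moreover have "y < zb" using b w by (simp add: y_def)
  ultimately have y: "b < y" "y < zb" by blast+
  have "((\<lambda>t. C / (zb - t)) has_integral ((\<lambda>t. - C * ln (zb - t)) y - (\<lambda>t. - C * ln (zb - t)) b)) {b..y}"
  proof (rule fundamental_theorem_of_calculus)
    fix x assume "x \<in> {b..y}"
    then show "((\<lambda>t. - C * ln (zb - t)) has_vector_derivative C / (zb - x)) (at x within {b..y})"
      unfolding has_real_derivative_iff_has_vector_derivative[symmetric] using y
      by (auto intro!: derivative_eq_intros)
  qed (use y in simp)
  moreover have "ln (zb - y) = ln (zb - b) - (\<bar>K\<bar> + 1) / C"
    using b by (simp add: y_def w_def ln_mult)
  moreover from this have "- C * ln (zb - y) - - C * ln (zb - b) = \<bar>K\<bar> + 1"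
    using C by (simp add: right_diff_distrib)
  ultimately have "((\<lambda>t. C / (zb - t)) has_integral \<bar>K\<bar> + 1) {b..y}" by simp
  then have "\<bar>K\<bar> + 1 \<le> integral {b..y} (ig zb)"
    by (rule has_integral_le[OF _ integrable_integral])
       (use low b y zb_pos in \<open>auto intro!: integrable_continuous_real ig_cont\<close>)
  also have "\<dots> \<le> integral {0..y} (ig zb)"
    by (rule integral_subset_le)
       (use b y zb_pos in \<open>auto intro!: integrable_continuous_real ig_cont ig_nonneg\<close>)
  finally show ?thesis using y b by (intro exI[of _ y]) auto
qed

text \<open>
  Up to height \<open>y\<close> a bump of amplitude \<open>y\<close> is slower than a bump of amplitude \<open>zb\<close>, because its gap is
  smaller; and the latter takes arbitrarily long.
\<close>
lemma I_unbounded: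
  assumes "p \<le> 2"
  shows "\<exists>a. 0 < a \<and> a < zb \<and> K < I a"
proof -
  obtain y where y: "0 < y" "y < zb" "K < integral {0..y} (ig zb)"
    using ig_zb_unbounded[OF assms] by blast
  have adm: "adm y" using y by (simp add: adm_def)
  have "integral {0..y} (ig zb) = integral {0<..<y} (ig zb)"
    by (rule integral_open_interval_real)
  also have "\<dots> \<le> integral {0<..<y} (ig y)"
  proof (rule integral_le)
    show "ig zb integrable_on {0<..<y}" "ig y integrable_on {0<..<y}"
      using ig_integrable_sub[of zb y] ig_integrable[OF adm] y
      by (simp_all add: integrable_on_open_interval_real)
    show "ig zb t \<le> ig y t" if "t \<in> {0<..<y}" for t
      using that y by (intro ig_anti) auto
  qed
  also have "\<dots> = I y"
    unfolding I_def by (rule integral_open_interval_real[symmetric])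
  finally show ?thesis using y by (intro exI[of _ y]) auto
qed

subsection \<open>Monotonicity of the time map\<close>

text \<open>
  The gap in the variable \<open>s = t / a\<close>, normalized so that \<open>I a\<close> is the integral of \<open>R a s powr (- 1 / p)\<close>
  over \<open>[0,1]\<close>. Its derivative \<open>- s powr (p - 1) * ratio (a * s)\<close> depends on \<open>a\<close> through \<open>ratio\<close> alone.
\<close>
definition R :: "real \<Rightarrow> real \<Rightarrow> real" where
  "R a s = (A a - A (a * s)) / a powr p"

text \<open>
  The limit of \<open>R a\<close> as \<open>a\<close> tends to \<open>0\<close>; it belongs to the equation with \<open>f = 0\<close>.
\<close>
definition R0 :: "real \<Rightarrow> real" where
  "R0 s = (1 - s powr p) / p"

definition I0 :: real where
  "I0 = integral {0..1} (\<lambda>s. R0 s powr (- 1 / p))"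

lemma R_eq_ig:
  assumes "0 < a" "a \<le> zb" "s \<in> {0..1}"
  shows "R a s powr (- 1 / p) = a * ig a (a * s)"
proof -
  have "0 \<le> A a - A (a * s)"
    using A_le[of "a * s" a] assms by (simp add: mult_left_le)
  then have "R a s powr (- 1 / p) = ig a (a * s) / (a powr p) powr (- 1 / p)"
    unfolding R_def ig_def using assms by (intro powr_divide)
  also have "(a powr p) powr (- 1 / p) = inverse a"
    using assms p_gt1 by (simp add: powr_powr powr_minus)
  finally show ?thesis by (simp add: divide_inverse mult.commute)
qed

lemma I_scaled:
  assumes "0 < a" "a \<le> zb"
  shows "I a = integral {0..1} (\<lambda>s. R a s powr (- 1 / p))"
proof -
  have img: "(\<lambda>x. x / a) ` {0..a} = {0..1}" using assms by simp
  have "integral {0..1} (\<lambda>s. R a s powr (- 1 / p)) = integral {0..1} (\<lambda>s. a * ig a (a * s))"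
    using R_eq_ig[OF assms] by (intro integral_cong) auto
  also have "\<dots> = a * integral {0..1} (\<lambda>s. ig a (a * s))" by simp
  also have "\<dots> = I a"
    using integral_stretch_real[of a 0 a "ig a"] assms by (simp add: img I_def)
  finally show ?thesis by simp
qed

lemma R_integrable:
  assumes "adm a"
  shows "(\<lambda>s. R a s powr (- 1 / p)) integrable_on {0..1}"
proof -
  have a: "0 < a" "a \<le> zb" using assms by (auto simp: adm_def)
  have img: "(\<lambda>x. x / a) ` {0..a} = {0..1}" using a by simp
  have "(\<lambda>s. ig a (a * s)) integrable_on {0..1}"
    using integrable_stretch_real[OF ig_integrable[OF assms], of a] a by (simp add: img)
  then have "(\<lambda>s. a * ig a (a * s)) integrable_on {0..1}"
    by (rule integrable_on_mult_right)
  then show ?thesis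
    by (rule integrable_eq) (use R_eq_ig[OF a] in auto)
qed

lemma R_cont: "0 < a \<Longrightarrow> continuous_on S (R a)"
  unfolding R_def by (intro continuous_intros continuous_on_compose2[OF A_cont[of UNIV]]) auto

lemma R0_cont: "continuous_on {0..1} R0"
  unfolding R0_def using p_gt1 by (intro continuous_intros continuous_on_powr') auto

lemma R_one [simp]: "R a 1 = 0" and R0_one [simp]: "R0 1 = 0"
  by (simp_all add: R_def R0_def)

lemma R_deriv:
  assumes "0 < a" "0 < s"
  shows "(R a has_real_derivative - (s powr (p - 1)) * ratio (a * s)) (at s)"
proof -
  have "((\<lambda>s. A (a * s)) has_real_derivative h (a * s) * a) (at s)"
    by (rule DERIV_chain2[OF A_deriv]) (auto intro!: derivative_eq_intros)
  then have "((\<lambda>s. (A a - A (a * s)) / a powr p) has_real_derivative (0 - h (a * s) * a) / a powr p) (at s)"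
    by (intro DERIV_cdivide DERIV_diff DERIV_const)
  then have "(R a has_real_derivative - (a * h (a * s)) / a powr p) (at s)"
    by (simp add: R_def[abs_def] mult.commute)
  moreover have "a * h (a * s) / a powr p = s powr (p - 1) * ratio (a * s)"
  proof -
    have "a powr p = a * a powr (p - 1)" using assms by (simp add: powr_diff)
    then show ?thesis using assms by (simp add: ratio_def powr_mult)
  qed
  ultimately show ?thesis by simp
qed

lemma R0_deriv:
  assumes "0 < s"
  shows "(R0 has_real_derivative - (s powr (p - 1))) (at s)"
  unfolding R0_def using assms p_gt1 by (auto intro!: derivative_eq_intros)

text \<open>
  Both functions vanish at \<open>1\<close>, and since \<open>ratio\<close> decreases, the one with the larger amplitude has the
  flatter slope.
\<close>
lemma R_less_R:
  assumes "0 < a" "a < b" "b \<le> zb" "0 \<le> s" "s < 1"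
  shows "R b s < R a s"
proof (rule greater_left_if_slope_less[of s 1])
  fix x assume x: "s < x" "x < 1"
  then have "b * x < zb" using assms mult_strict_left_mono[of x 1 b] by linarith
  then have "ratio (b * x) < ratio (a * x)"
    unfolding ratio_def using x assms by (intro ratio_anti) auto
  then have "- (x powr (p - 1)) * ratio (a * x) < - (x powr (p - 1)) * ratio (b * x)"
    using x assms by simp
  then show "\<exists>y z. (R a has_real_derivative y) (at x) \<and> (R b has_real_derivative z) (at x) \<and> y < z"
    using R_deriv[of a x] R_deriv[of b x] x assms by force
qed (use assms in \<open>auto intro: R_cont\<close>)

lemma R_less_R0:
  assumes "0 < a" "a \<le> zb" "0 \<le> s" "s < 1"
  shows "R a s < R0 s"
proof (rule greater_left_if_slope_less[of s 1])
  fix x assume x: "s < x" "x < 1"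
  then have "a * x < zb" using assms mult_strict_left_mono[of x 1 a] by linarith
  then have "ratio (a * x) < 1" using x assms by (intro ratio_less_1) auto
  then have "- (x powr (p - 1)) < - (x powr (p - 1)) * ratio (a * x)"
    using x assms by simp
  then show "\<exists>y z. (R0 has_real_derivative y) (at x) \<and> (R a has_real_derivative z) (at x) \<and> y < z"
    using R_deriv[of a x] R0_deriv[of x] x assms by force
qed (use assms in \<open>auto intro: R_cont continuous_on_subset[OF R0_cont]\<close>)

lemma R_ge_ratio_R0:
  assumes "0 < a" "a < zb" "0 \<le> s" "s \<le> 1"
  shows "ratio a * R0 s \<le> R a s"
proof (rule greater_left_if_slope_le[of s 1])
  fix x assume x: "s < x" "x < 1"
  then have "a * x < a * 1" using assms by (intro mult_strict_left_mono) auto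
  then have "ratio a < ratio (a * x)"
    unfolding ratio_def using x assms by (intro ratio_anti) auto
  then have "- (x powr (p - 1)) * ratio (a * x) \<le> ratio a * - (x powr (p - 1))"
    using x assms by simp
  moreover have "((\<lambda>s. ratio a * R0 s) has_real_derivative ratio a * - (x powr (p - 1))) (at x)"
    using R0_deriv x assms by (intro DERIV_cmult) auto
  ultimately show "\<exists>y z. (R a has_real_derivative y) (at x) \<and> ((\<lambda>s. ratio a * R0 s) has_real_derivative z) (at x) \<and> y \<le> z"
    using R_deriv[of a x] x assms by force
qed (use assms in \<open>auto intro!: R_cont continuous_intros continuous_on_subset[OF R0_cont]\<close>)

lemma R_pos: "0 < a \<Longrightarrow> a \<le> zb \<Longrightarrow> 0 \<le> s \<Longrightarrow> s < 1 \<Longrightarrow> 0 < R a s"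
  unfolding R_def using A_less[of "a * s" a] by simp

lemma R0_pos: "0 \<le> s \<Longrightarrow> s < 1 \<Longrightarrow> 0 < R0 s"
  using R_less_R0[of zb s] R_pos[of zb s] zb_pos by simp

lemma inv_power_mono: "0 < x \<Longrightarrow> x \<le> y \<Longrightarrow> y powr (- 1 / p) \<le> x powr (- 1 / p)"
  using p_gt1 by (intro powr_mono2') auto

lemma inv_power_strict: "0 < x \<Longrightarrow> x < y \<Longrightarrow> y powr (- 1 / p) < x powr (- 1 / p)"
  using p_gt1 by (intro powr_less_mono2_neg) auto

lemma I_strict_mono:
  assumes "0 < a" "a < b" "adm b"
  shows "I a < I b"
proof -
  have b: "b \<le> zb" using assms by (simp add: adm_def)
  have a: "adm a" using assms b by (simp add: adm_def)
  have "integral {0..1} (\<lambda>s. R a s powr (- 1 / p)) < integral {0..1} (\<lambda>s. R b s powr (- 1 / p))"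
  proof (rule integral_strict_less)
    fix s :: real assume "s \<in> {0..1}"
    then show "R a s powr (- 1 / p) \<le> R b s powr (- 1 / p)"
      using assms b
      by (cases "s = 1") (auto intro!: inv_power_mono[simplified] less_imp_le[OF R_less_R] R_pos)
  next
    fix s :: real assume "s \<in> {0..1/2}"
    then show "R a s powr (- 1 / p) < R b s powr (- 1 / p)"
      using R_less_R[OF assms(1,2) b] R_pos[of b s] assms b by (auto intro!: inv_power_strict[simplified])
  next
    have "continuous_on {0..1/2} (\<lambda>s. R x s powr (- 1 / p))" if "0 < x" "x \<le> zb" for x
      using R_pos[OF that] that by (intro continuous_intros R_cont) force+
    then show "continuous_on {0..1/2} (\<lambda>s. R a s powr (- 1 / p))" "continuous_on {0..1/2} (\<lambda>s. R b s powr (- 1 / p))"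
      using assms b by auto
  qed (use R_integrable assms a in auto)
  then show ?thesis using assms b by (simp add: I_scaled)
qed

lemma R0_measurable: "(\<lambda>s. R0 s powr (- 1 / p)) \<in> borel_measurable (lebesgue_on S)"
  unfolding R0_def by (intro borel_measurable_lebesgue_on powr_real_measurable borel_measurable_divide
      borel_measurable_diff borel_measurable_const) auto

lemma R0_integrable: "(\<lambda>s. R0 s powr (- 1 / p)) integrable_on {0..1}"
proof (rule measurable_bounded_by_integrable_imp_integrable[OF R0_measurable])
  have adm: "adm (zb / 2)" using zb_pos by (simp add: adm_def)
  then show "(\<lambda>s. R (zb / 2) s powr (- 1 / p)) integrable_on {0..1}" by (rule R_integrable)
  fix s :: real assume s: "s \<in> {0..1}"
  show "norm (R0 s powr (- 1 / p)) \<le> R (zb / 2) s powr (- 1 / p)"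
    using s zb_pos
    by (cases "s = 1") (auto intro!: inv_power_mono[simplified] less_imp_le[OF R_less_R0] R_pos)
qed simp

lemma I0_less_I:
  assumes "adm a"
  shows "I0 < I a"
proof -
  have a: "0 < a" "a \<le> zb" using assms by (auto simp: adm_def)
  have "integral {0..1} (\<lambda>s. R0 s powr (- 1 / p)) < integral {0..1} (\<lambda>s. R a s powr (- 1 / p))"
  proof (rule integral_strict_less)
    fix s :: real assume "s \<in> {0..1}"
    then show "R0 s powr (- 1 / p) \<le> R a s powr (- 1 / p)"
      using a
      by (cases "s = 1") (auto intro!: inv_power_mono[simplified] less_imp_le[OF R_less_R0] R_pos)
  next
    fix s :: real assume "s \<in> {0..1/2}"
    then show "R0 s powr (- 1 / p) < R a s powr (- 1 / p)"
      using R_less_R0[OF a] R_pos[OF a] by (auto intro!: inv_power_strict[simplified])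
  next
    show "continuous_on {0..1/2} (\<lambda>s. R a s powr (- 1 / p))"
      using R_pos[OF a] a by (intro continuous_intros R_cont) force+
    show "continuous_on {0..1/2} (\<lambda>s. R0 s powr (- 1 / p))"
      using R0_pos by (intro continuous_intros continuous_on_subset[OF R0_cont]) force+
  qed (use R_integrable R0_integrable assms in auto)
  then show ?thesis using a by (simp add: I_scaled I0_def)
qed

lemma I0_pos: "0 < I0"
proof -
  have "integral {0..1} (\<lambda>s::real. 0::real) < integral {0..1} (\<lambda>s. R0 s powr (- 1 / p))"
  proof (rule integral_strict_less[of "\<lambda>_. 0"])
    show "continuous_on {0..1/2} (\<lambda>s. R0 s powr (- 1 / p))"
      using R0_pos by (intro continuous_intros continuous_on_subset[OF R0_cont]) force+
    show "0 < R0 s powr (- 1 / p)" if "s \<in> {0..1/2}" for s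
      using R0_pos[of s] that by simp
  qed (use R0_integrable in auto)
  then show ?thesis by (simp add: I0_def)
qed

lemma I_le_I0:
  assumes "0 < a" "a < zb"
  shows "I a \<le> ratio a powr (- 1 / p) * I0"
proof -
  have adm: "adm a" using assms by (simp add: adm_def)
  have "I a = integral {0..1} (\<lambda>s. R a s powr (- 1 / p))" using assms by (simp add: I_scaled)
  also have "\<dots> \<le> integral {0..1} (\<lambda>s. ratio a powr (- 1 / p) * R0 s powr (- 1 / p))"
  proof (rule integral_le)
    fix s :: real assume s: "s \<in> {0..1}"
    have "R a s powr (- 1 / p) \<le> (ratio a * R0 s) powr (- 1 / p)"
    proof (cases "s = 1")
      case False
      then show ?thesis
        using R_ge_ratio_R0[of a s] ratio_pos[of a] R0_pos[of s] s assms by (intro inv_power_mono) auto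
    qed simp
    then show "R a s powr (- 1 / p) \<le> ratio a powr (- 1 / p) * R0 s powr (- 1 / p)"
      by (simp add: powr_mult)
  qed (use R_integrable[OF adm] R0_integrable in \<open>auto intro: integrable_on_mult_right\<close>)
  also have "\<dots> = ratio a powr (- 1 / p) * I0" by (simp add: I0_def)
  finally show ?thesis .
qed

text \<open>
  Since \<open>ratio\<close> decreases, \<open>R a\<close> lies between \<open>ratio a * R0\<close> and \<open>R0\<close>; the limit follows by squeezing
  because \<open>ratio a\<close> tends to \<open>1\<close>.
\<close>
lemma I_tendsto_I0: "(I \<longlongrightarrow> I0) (at_right 0)"
proof (rule tendsto_sandwich)
  have ev: "\<forall>\<^sub>F a in at_right 0. 0 < a \<and> a < zb"
    unfolding eventually_at_right_field by (rule exI[of _ zb]) (use zb_pos in auto)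
  show "\<forall>\<^sub>F a in at_right 0. I0 \<le> I a"
    using ev by eventually_elim (auto simp: adm_def intro!: less_imp_le[OF I0_less_I])
  show "\<forall>\<^sub>F a in at_right 0. I a \<le> ratio a powr (- 1 / p) * I0"
    using ev by eventually_elim (auto intro: I_le_I0[simplified])
  have "((\<lambda>a. ratio a powr (- 1 / p) * I0) \<longlongrightarrow> 1 powr (- 1 / p) * I0) (at_right 0)"
    using ratio_lim unfolding ratio_def by (intro tendsto_intros) auto
  then show "((\<lambda>a. ratio a powr (- 1 / p) * I0) \<longlongrightarrow> I0) (at_right 0)" by simp
qed simp

text \<open>
  Dominated convergence: the integrands for the amplitudes up to an admissible \<open>b\<close> are all bounded by the
  one for \<open>b\<close>. For \<open>p > 2\<close> this includes \<open>b = zb\<close>.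
\<close>
lemma I_cont:
  assumes "adm b"
  shows "continuous_on {0<..b} I"
proof (rule continuous_on_sequentiallyI)
  fix u a assume u: "\<forall>n. u n \<in> {0<..b}" and a: "a \<in> {0<..b}" and lim: "u \<longlonglongrightarrow> a"
  have b: "b \<le> zb" using assms by (simp add: adm_def)
  have adm: "adm x" if "x \<in> {0<..b}" for x using that assms by (auto simp: adm_def)
  have dom: "R x s powr (- 1 / p) \<le> R b s powr (- 1 / p)" if "x \<in> {0<..b}" "s \<in> {0..1}" for x s
  proof (cases "s = 1 \<or> x = b")
    case False
    then show ?thesis using that b R_less_R[of x b s] R_pos[of b s] by (intro inv_power_mono) auto
  qed auto
  \<comment> \<open>At \<open>s = 1\<close> all integrands are \<open>0 powr (- 1 / p) = 0\<close>.\<close>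
  have "(\<lambda>n. integral {0..1} (\<lambda>s. R (u n) s powr (- 1 / p))) \<longlonglongrightarrow> integral {0..1} (\<lambda>s. R a s powr (- 1 / p))"
  proof (rule dominated_convergence(2))
    show "(\<lambda>s. R (u n) s powr (- 1 / p)) integrable_on {0..1}" for n
      using u adm by (intro R_integrable) auto
    show "(\<lambda>s. R b s powr (- 1 / p)) integrable_on {0..1}" using assms by (rule R_integrable)
    show "norm (R (u n) s powr (- 1 / p)) \<le> R b s powr (- 1 / p)" if "s \<in> {0..1}" for n s
      using dom[of "u n" s] u that by simp
    fix s :: real assume s: "s \<in> {0..1}"
    have A: "isCont A x" for x using A_deriv by (rule DERIV_isCont)
    show "(\<lambda>n. R (u n) s powr (- 1 / p)) \<longlonglongrightarrow> R a s powr (- 1 / p)"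
    proof (cases "s = 1")
      case False
      have "(\<lambda>n. R (u n) s) \<longlonglongrightarrow> R a s"
        unfolding R_def using a
        by (intro tendsto_intros isCont_tendsto_compose[OF A] lim) auto
      then show ?thesis
        using R_pos[of a s] a b s False by (intro tendsto_intros) auto
    qed simp
  qed
  moreover have "I a = integral {0..1} (\<lambda>s. R a s powr (- 1 / p))" using a b by (intro I_scaled) auto
  moreover have "I (u n) = integral {0..1} (\<lambda>s. R (u n) s powr (- 1 / p))" for n
    using u[rule_format, of n] b by (intro I_scaled) auto
  ultimately show "(\<lambda>n. I (u n)) \<longlonglongrightarrow> I a" by simp
qed

subsection \<open>The turning point and the quarter period as functions of the energy level\<close>

text \<open>
  The turning point of the level \<open>e\<close>.
\<close>
definition lev :: "real \<Rightarrow> real" where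
  "lev e = inv_into {0..zb} A e"

definition mu :: real where
  "mu = (lam * p / (p - 1)) powr (1 / p)"

definition quarter :: "real \<Rightarrow> real" where
  "quarter e = I (lev e) / mu"

definition adml :: "real \<Rightarrow> bool" where
  "adml e \<longleftrightarrow> 0 < e \<and> e \<le> A zb \<and> (e < A zb \<or> 2 < p)"

lemma mu_pos: "0 < mu"
  using lam_pos p_gt1 by (simp add: mu_def)

lemma mu_powr: "mu powr p = lam * p / (p - 1)"
  using lam_pos p_gt1 by (simp add: mu_def powr_powr)

lemma A_image: "A ` {0..zb} = {0..A zb}"
proof (intro equalityI subsetI)
  fix e assume "e \<in> {0..A zb}"
  then obtain x where "0 \<le> x" "x \<le> zb" "A x = e"
    using IVT'[of A 0 e zb] A_cont A_0 zb_pos by auto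
  then show "e \<in> A ` {0..zb}" by auto
next
  fix e assume "e \<in> A ` {0..zb}"
  then obtain x where "0 \<le> x" "x \<le> zb" "e = A x" by auto
  then show "e \<in> {0..A zb}" using A_le[of 0 x] A_le[of x zb] A_0 by auto
qed

lemma lev_A: "0 \<le> s \<Longrightarrow> s \<le> zb \<Longrightarrow> lev (A s) = s"
  unfolding lev_def using A_inj by (simp add: inv_into_f_f)

lemma lev_mem: "0 \<le> e \<Longrightarrow> e \<le> A zb \<Longrightarrow> 0 \<le> lev e \<and> lev e \<le> zb \<and> A (lev e) = e"
  unfolding lev_def using inv_into_into[of e A "{0..zb}"] f_inv_into_f[of e A "{0..zb}"] A_image by auto

lemma lev_zb [simp]: "lev (A zb) = zb"
  using lev_A[of zb] zb_pos by simp

lemma lev_pos: "0 < e \<Longrightarrow> e \<le> A zb \<Longrightarrow> 0 < lev e"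
  using lev_mem[of e] A_0 by (cases "lev e = 0") auto

lemma lev_less: "0 \<le> d \<Longrightarrow> d < e \<Longrightarrow> e \<le> A zb \<Longrightarrow> lev d < lev e"
  using lev_mem[of d] lev_mem[of e] A_le[of "lev e" "lev d"] by (intro not_le_imp_less) auto

lemma lev_cont: "continuous_on {0..A zb} lev"
proof -
  have "continuous_on (A ` {0..zb}) lev"
    by (rule continuous_on_inv[OF A_cont]) (auto simp: lev_A)
  then show ?thesis by (simp add: A_image)
qed

lemma lev_0 [simp]: "lev 0 = 0"
  using lev_A[of 0] zb_pos A_0 by simp

lemma adml_adm: "adml e \<Longrightarrow> adm (lev e)"
  using lev_mem[of e] lev_pos[of e] lev_less[of e "A zb"] by (auto simp: adml_def adm_def)

lemma quarter_gt: "adml e \<Longrightarrow> I0 / mu < quarter e"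
  unfolding quarter_def using mu_pos I0_less_I[OF adml_adm] by (simp add: divide_strict_right_mono)

lemma quarter_pos: "adml e \<Longrightarrow> 0 < quarter e"
  using quarter_gt[of e] I0_pos mu_pos by (meson divide_pos_pos order_less_trans)

lemma quarter_less:
  assumes "0 < d" "d < e" "adml e"
  shows "quarter d < quarter e"
  unfolding quarter_def using mu_pos assms
  by (intro divide_strict_right_mono I_strict_mono lev_pos lev_less adml_adm) (auto simp: adml_def)

lemma quarter_cont:
  assumes "adml e"
  shows "continuous_on {0<..e} quarter"
proof -
  have e: "0 < e" "e \<le> A zb" using assms by (auto simp: adml_def)
  have "continuous_on {0<..e} (\<lambda>d. I (lev d))"
  proof (rule continuous_on_compose2[OF I_cont[OF adml_adm[OF assms]]])
    show "continuous_on {0<..e} lev" by (rule continuous_on_subset[OF lev_cont]) (use e in auto)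
    show "lev ` {0<..e} \<subseteq> {0<..lev e}"
    proof
      fix y assume "y \<in> lev ` {0<..e}"
      then obtain d where d: "0 < d" "d \<le> e" "y = lev d" by auto
      then show "y \<in> {0<..lev e}"
        using lev_pos[of d] lev_less[of d e] e by (cases "d = e") auto
    qed
  qed
  then show ?thesis unfolding quarter_def using mu_pos by (intro continuous_intros) auto
qed

lemma quarter_tendsto: "(quarter \<longlongrightarrow> I0 / mu) (at_right 0)"
proof -
  have A: "0 < A zb" using A_pos zb_pos by simp
  have "(lev \<longlongrightarrow> 0) (at_right 0)"
    using lev_cont A unfolding continuous_on_def by (force simp: at_within_Icc_at_right)
  moreover have "\<forall>\<^sub>F d in at_right 0. lev d \<in> {0<..}"
    unfolding eventually_at_right_field by (rule exI[of _ "A zb"]) (use A lev_pos in auto)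
  ultimately have "filterlim lev (at_right 0) (at_right 0)"
    by (auto simp: filterlim_at elim: eventually_mono)
  then have "((\<lambda>d. I (lev d)) \<longlongrightarrow> I0) (at_right 0)"
    by (rule filterlim_compose[OF I_tendsto_I0])
  then show ?thesis unfolding quarter_def using mu_pos by (intro tendsto_intros) auto
qed

text \<open>
  Divergence at \<open>zb\<close> is turned from amplitudes into levels; \<open>d\<close> makes the level as close to \<open>A zb\<close> as
  desired.
\<close>
lemma quarter_unbounded:
  assumes "p \<le> 2" "d < A zb"
  shows "\<exists>e. 0 < e \<and> d < e \<and> e < A zb \<and> K < quarter e"
proof -
  define d' where "d' = max d (A zb / 2)"
  have A: "0 < A zb" using A_pos zb_pos by simp
  have d': "0 < d'" "d \<le> d'" "d' < A zb" using A assms by (auto simp: d'_def)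
  have adm': "adml d'" using d' by (simp add: adml_def)
  obtain a where a: "0 < a" "a < zb" "max (K * mu) (I (lev d')) < I a" using I_unbounded[OF assms(1)] by blast
  have "lev d' < a"
  proof (rule ccontr)
    assume "\<not> lev d' < a"
    then have "I a \<le> I (lev d')"
      using I_strict_mono[of a "lev d'"] adml_adm[OF adm'] a by (cases "a = lev d'") auto
    then show False using a by simp
  qed
  then have "d' < A a" using A_less[of "lev d'" a] lev_mem[of d'] d' a by auto
  moreover have "K < quarter (A a)"
    using a mu_pos lev_A[of a] by (simp add: quarter_def pos_less_divide_eq)
  moreover have "A a < A zb" using A_less[of a zb] a by simp
  ultimately show ?thesis using d' by (intro exI[of _ "A a"]) auto
qed

end

section \<open>Energy conservation and the shape of a single bump\<close>

text \<open>
  The equation with \<open>D\<close> in the role of the derivative of \<open>\<phi>\<close>. Differentiability is asked for in the open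
  interval only; with the continuity of \<open>\<phi>\<close> and \<open>D\<close> up to the end points it extends to the closed one.
\<close>
definition ode :: "real \<Rightarrow> real \<Rightarrow> (real \<Rightarrow> real) \<Rightarrow> real \<Rightarrow> real \<Rightarrow> (real \<Rightarrow> real) \<Rightarrow> (real \<Rightarrow> real) \<Rightarrow> bool" where
  "ode p lam h a b \<phi> D \<longleftrightarrow> continuous_on {a..b} \<phi> \<and> continuous_on {a..b} D \<and>
     (\<forall>x. a < x \<and> x < b \<longrightarrow> (\<phi> has_real_derivative D x) (at x) \<and>
        ((\<lambda>y. spow p (D y)) has_real_derivative - (lam * h (\<phi> x))) (at x))"

lemma odeD:
  assumes "ode p lam h a b \<phi> D"
  shows "continuous_on {a..b} \<phi>" "continuous_on {a..b} D"
    "\<And>x. a < x \<Longrightarrow> x < b \<Longrightarrow> (\<phi> has_real_derivative D x) (at x)"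
    "\<And>x. a < x \<Longrightarrow> x < b \<Longrightarrow> ((\<lambda>y. spow p (D y)) has_real_derivative - (lam * h (\<phi> x))) (at x)"
  using assms by (auto simp: ode_def)

lemma ode_subinterval:
  assumes "ode p lam h a b \<phi> D" "a \<le> c" "d \<le> b"
  shows "ode p lam h c d \<phi> D"
  using assms unfolding ode_def by (auto elim!: continuous_on_subset)

lemma ode_negate:
  assumes "ode p lam h a b \<phi> D"
  shows "ode p lam (\<lambda>s. - h (- s)) a b (\<lambda>x. - \<phi> x) (\<lambda>x. - D x)"
  using assms unfolding ode_def by (auto intro!: continuous_intros derivative_eq_intros)

text \<open>
  The equation does not change under time reversal; the descent of a bump is the ascent of its reversal.
\<close>
lemma ode_reverse:
  assumes "ode p lam h a b \<phi> D"
  shows "ode p lam h a b (\<lambda>x. \<phi> (a + b - x)) (\<lambda>x. - D (a + b - x))"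
proof -
  have sub: "(\<lambda>x. a + b - x) ` {a..b} \<subseteq> {a..b}" by auto
  have c: "continuous_on {a..b} (\<lambda>x. a + b - x)" by (intro continuous_intros)
  have d: "((\<lambda>x. a + b - x) has_real_derivative - 1) (at x)" for x
    by (auto intro!: derivative_eq_intros)
  have d1: "((\<lambda>x. \<phi> (a + b - x)) has_real_derivative D (a + b - x) * - 1) (at x)" if "a < x" "x < b" for x
    by (rule DERIV_chain2[OF odeD(3)[OF assms] d]) (use that in auto)
  have d2: "((\<lambda>x. spow p (D (a + b - x))) has_real_derivative - (lam * h (\<phi> (a + b - x))) * - 1) (at x)"
    if "a < x" "x < b" for x
    by (rule DERIV_chain2[OF odeD(4)[OF assms] d]) (use that in auto)
  have "((\<lambda>x. \<phi> (a + b - x)) has_real_derivative - D (a + b - x)) (at x)"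
    "((\<lambda>x. spow p (- D (a + b - x))) has_real_derivative - (lam * h (\<phi> (a + b - x)))) (at x)"
    if "a < x" "x < b" for x
    using d1[OF that] DERIV_minus[OF d2[OF that]] by simp_all
  moreover have "continuous_on {a..b} (\<lambda>x. \<phi> (a + b - x))" "continuous_on {a..b} (\<lambda>x. - D (a + b - x))"
    using continuous_on_compose2[OF odeD(1)[OF assms] c sub] continuous_on_compose2[OF odeD(2)[OF assms] c sub]
    by (auto intro: continuous_on_minus)
  ultimately show ?thesis unfolding ode_def by simp
qed

lemma abs_spow_powr:
  assumes "1 < p"
  shows "\<bar>spow p s\<bar> powr (p / (p - 1)) = \<bar>s\<bar> powr p"
proof -
  have "\<bar>spow p s\<bar> = \<bar>s\<bar> powr (p - 1)"
    using spow_nonneg_eq[of "\<bar>s\<bar>" p] by (simp add: spow_def abs_mult)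
  then show ?thesis using assms by (simp add: powr_powr)
qed

text \<open>
  With \<open>v = spow p D\<close> and the conjugate exponent \<open>p' = p / (p - 1)\<close>, the derivative of \<open>\<bar>D\<bar> powr p = \<bar>v\<bar> powr p'\<close>
  is \<open>p' * spow p' v\<close> times that of \<open>v\<close>, and \<open>spow p' v = D\<close>. The chain rule is applied to \<open>v\<close> since
  only \<open>v\<close>, not \<open>D\<close>, is known to be differentiable.
\<close>
lemma energy:
  assumes p: "1 < p" and ode: "ode p lam h a b \<phi> D"
    and A: "\<And>s. (A has_real_derivative h s) (at s)" and x: "x \<in> {a..b}"
  shows "\<bar>D x\<bar> powr p + lam * p / (p - 1) * A (\<phi> x) = \<bar>D a\<bar> powr p + lam * p / (p - 1) * A (\<phi> a)"
proof (cases "a = b")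
  case False
  let ?q = "p / (p - 1)"
  have q: "1 < ?q" using p by (simp add: field_simps)
  define H where "H = (\<lambda>x. \<bar>spow p (D x)\<bar> powr ?q + lam * p / (p - 1) * A (\<phi> x))"
  have A_cont: "continuous_on UNIV A"
    using A by (meson DERIV_continuous_on has_field_derivative_at_within)
  have "H x = H a"
  proof (rule DERIV_isconst2[of a b H x])
    show "continuous_on {a..b} H"
      unfolding H_def using p q odeD(1,2)[OF ode]
      by (intro continuous_intros continuous_on_powr' continuous_on_compose2[OF A_cont]) auto
    fix y assume y: "a < y" "y < b"
    have "((\<lambda>y. \<bar>spow p (D y)\<bar> powr ?q) has_real_derivative
        ?q * spow ?q (spow p (D y)) * - (lam * h (\<phi> y))) (at y)"
      by (rule DERIV_chain2[OF DERIV_abs_powr[OF q] odeD(4)[OF ode y]])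
    moreover have "((\<lambda>y. A (\<phi> y)) has_real_derivative h (\<phi> y) * D y) (at y)"
      by (rule DERIV_chain2[OF A odeD(3)[OF ode y]])
    ultimately have "(H has_real_derivative
        ?q * spow ?q (spow p (D y)) * - (lam * h (\<phi> y)) + lam * p / (p - 1) * (h (\<phi> y) * D y)) (at y)"
      unfolding H_def by (intro DERIV_add DERIV_cmult)
    then show "(H has_real_derivative 0) (at y)"
      using spow_inverse[OF p] by (simp add: algebra_simps)
  qed (use x False in auto)
  then show ?thesis by (simp add: H_def abs_spow_powr[OF p])
qed (use x in simp)

context half_well
begin

text \<open>
  The time in which a solution of level \<open>A a\<close> rises from \<open>0\<close> to \<open>y\<close>.
\<close>
definition th :: "real \<Rightarrow> real \<Rightarrow> real" where
  "th a y = integral {0..y} (ig a) / mu"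

lemma th_0 [simp]: "th a 0 = 0"
  by (simp add: th_def)

lemma th_lev: "th (lev e) (lev e) = quarter e"
  by (simp add: th_def quarter_def I_def)

lemma th_cont: "ig a integrable_on {0..y} \<Longrightarrow> continuous_on {0..y} (th a)"
  unfolding th_def using mu_pos by (intro continuous_intros indefinite_integral_continuous_1) auto

lemma th_cont_adm: "adm a \<Longrightarrow> continuous_on {0..a} (th a)"
  by (rule th_cont[OF ig_integrable])

lemma th_deriv:
  assumes "0 < y" "y < a" "a \<le> zb"
  shows "(th a has_real_derivative ig a y / mu) (at y)"
proof -
  have "((\<lambda>y. integral {0..y} (ig a)) has_real_derivative ig a y) (at y within {0..(y + a) / 2})"
    by (rule integral_has_real_derivative) (use assms in \<open>auto intro: ig_cont\<close>)
  then have "((\<lambda>y. integral {0..y} (ig a)) has_real_derivative ig a y) (at y)"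
    using assms by (simp add: at_within_Icc_at)
  then show ?thesis unfolding th_def[abs_def] by (rule DERIV_cdivide)
qed

lemma th_strict_mono:
  assumes "adm a" "0 \<le> y" "y < z" "z \<le> a"
  shows "th a y < th a z"
proof (rule DERIV_pos_imp_increasing_open[OF assms(3)])
  have a: "a \<le> zb" using assms by (simp add: adm_def)
  show "\<exists>d. (th a has_real_derivative d) (at x) \<and> 0 < d" if "y < x" "x < z" for x
    using th_deriv[of x a] A_less[of x a] that assms a mu_pos
    by (intro exI[of _ "ig a x / mu"]) (auto simp: ig_def)
  show "continuous_on {y..z} (th a)"
    by (rule continuous_on_subset[OF th_cont_adm[OF assms(1)]]) (use assms in auto)
qed

lemma th_inj: "adm a \<Longrightarrow> y \<in> {0..a} \<Longrightarrow> z \<in> {0..a} \<Longrightarrow> th a y = th a z \<Longrightarrow> y = z"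
  using th_strict_mono[of a y z] th_strict_mono[of a z y] by (cases y z rule: linorder_cases) auto

text \<open>
  Separation of variables: while \<open>\<phi>\<close> rises, the energy identity gives \<open>D = \<mu> (A M - A(\<phi>))^(1/p)\<close>, so
  \<open>th M \<circ> \<phi>\<close> has derivative \<open>1\<close>.
\<close>
lemma rise_time:
  assumes ode: "ode p lam h a b \<phi> D" and c: "a < c" "c \<le> b" and M: "0 < M" "M \<le> zb" and "\<phi> a = 0"
    and pos: "\<And>x. a < x \<Longrightarrow> x < c \<Longrightarrow> 0 < \<phi> x \<and> \<phi> x < M \<and> 0 < D x"
    and en: "\<And>x. a < x \<Longrightarrow> x < c \<Longrightarrow> \<bar>D x\<bar> powr p = mu powr p * (A M - A (\<phi> x))"
    and x: "a \<le> x" "x < c"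
  shows "th M (\<phi> x) = x - a"
proof (cases "x = a")
  case True
  then show ?thesis using assms by simp
next
  case False
  then have ax: "a < x" using x by simp
  have mono: "\<phi> t \<le> \<phi> x" if "a \<le> t" "t \<le> x" for t
  proof (rule DERIV_nonneg_imp_increasing_open[OF that(2)])
    show "\<exists>y. (\<phi> has_real_derivative y) (at z) \<and> 0 \<le> y" if "t < z" "z < x" for z
      using odeD(3)[OF ode, of z] pos[of z] that \<open>a \<le> t\<close> x c by (intro exI[of _ "D z"]) auto
    show "continuous_on {t..x} \<phi>"
      by (rule continuous_on_subset[OF odeD(1)[OF ode]]) (use that x c in auto)
  qed
  have cont: "continuous_on {a..x} \<phi>"
    by (rule continuous_on_subset[OF odeD(1)[OF ode]]) (use x c in auto)
  have int: "ig M integrable_on {0..\<phi> x}"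
    using pos[of x] ax x M by (intro ig_integrable_sub) auto
  have "(\<lambda>t. th M (\<phi> t) - t) x = (\<lambda>t. th M (\<phi> t) - t) a"
  proof (rule DERIV_isconst2[OF ax])
    have "0 \<le> \<phi> t" if "t \<in> {a..x}" for t
      using pos[of t] that x assms(6) by (cases "t = a") auto
    then have "\<phi> ` {a..x} \<subseteq> {0..\<phi> x}" using mono by auto
    then show "continuous_on {a..x} (\<lambda>t. th M (\<phi> t) - t)"
      by (intro continuous_intros continuous_on_compose2[OF th_cont[OF int] cont])
    fix t assume t: "a < t" "t < x"
    then have tc: "a < t" "t < c" using x by auto
    have pt: "0 < \<phi> t" "\<phi> t < M" "0 < D t" using pos[OF tc] by auto
    have "((\<lambda>t. th M (\<phi> t)) has_real_derivative ig M (\<phi> t) / mu * D t) (at t)"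
      using tc c M by (intro DERIV_chain2[OF th_deriv[OF pt(1,2)] odeD(3)[OF ode]]) auto
    moreover have eq: "ig M (\<phi> t) / mu * D t = 1"
    proof -
      have gap: "0 < A M - A (\<phi> t)" using A_less[of "\<phi> t" M] pt M by simp
      have "D t = (D t powr p) powr (1 / p)" using pt p_gt1 by (simp add: powr_powr)
      also have "\<dots> = (mu powr p) powr (1 / p) * (A M - A (\<phi> t)) powr (1 / p)"
        using en[OF tc] pt by (simp add: powr_mult)
      also have "(mu powr p) powr (1 / p) = mu" using mu_pos p_gt1 by (simp add: powr_powr)
      finally have D: "D t = mu * (A M - A (\<phi> t)) powr (1 / p)" .
      have "ig M (\<phi> t) * (A M - A (\<phi> t)) powr (1 / p) = 1"
        unfolding ig_def using gap by (simp flip: powr_add)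
      then show ?thesis using D mu_pos by (simp add: mult.assoc mult.commute)
    qed
    ultimately have "((\<lambda>t. th M (\<phi> t)) has_real_derivative 1) (at t)" by (simp only: eq)
    then show "((\<lambda>t. th M (\<phi> t) - t) has_real_derivative 0) (at t)"
      by (auto intro!: derivative_eq_intros)
  qed (use ax in auto)
  then show ?thesis using assms(6) by simp
qed

text \<open>
  The shape of a solution between two zeros. Its derivative is nonincreasing because \<open>h\<close> is nonnegative on
  \<open>[0, zb]\<close>, so it vanishes exactly on an interval \<open>[\<alpha>, \<beta>]\<close>. On \<open>[a, \<alpha>]\<close> and, reversed, on \<open>[\<beta>, b]\<close>
  separation of variables applies, and each of them takes the time \<open>quarter e\<close>. On \<open>[\<alpha>, \<beta>]\<close> the solution
  rests at \<open>lev e\<close>, which the equation permits only if \<open>h (lev e) = 0\<close>. The three pieces are collected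
  in one formula for \<open>th (lev e) (\<phi> x)\<close>, which determines \<open>\<phi>\<close> on \<open>[a, b]\<close> as \<open>th (lev e)\<close> is injective.
\<close>
lemma bump:
  assumes ode: "ode p lam h a b \<phi> D" and ab: "a < b" and ends: "\<phi> a = 0" "\<phi> b = 0"
    and pos: "\<And>x. a < x \<Longrightarrow> x < b \<Longrightarrow> 0 < \<phi> x \<and> \<phi> x \<le> zb"
    and e: "0 < e" "\<bar>D a\<bar> powr p = mu powr p * e"
  shows "adml e" "2 * quarter e \<le> b - a" "e < A zb \<Longrightarrow> b - a = 2 * quarter e"
    "\<And>x. x \<in> {a..b} \<Longrightarrow> \<phi> x \<in> {0..lev e} \<and> th (lev e) (\<phi> x) = min (min (x - a) (b - x)) (quarter e)"
    "0 < D a" "D b = - D a"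
proof -
  have en: "\<bar>D x\<bar> powr p = mu powr p * (e - A (\<phi> x))" if "x \<in> {a..b}" for x
    using energy[OF p_gt1 ode A_deriv that] unfolding mu_powr[symmetric] ends A_0 e(2)
    by (simp add: right_diff_distrib)
  have nonneg: "0 \<le> \<phi> x" "\<phi> x \<le> zb" if "x \<in> {a..b}" for x
    using pos[of x] that ends zb_pos by (cases "x = a \<or> x = b"; force)+
  have spow_anti: "spow p (D y) \<le> spow p (D x)" if "a \<le> x" "x \<le> y" "y \<le> b" for x y
  proof (rule DERIV_nonpos_imp_decreasing_open[OF that(2)])
    show "\<exists>d. ((\<lambda>y. spow p (D y)) has_real_derivative d) (at z) \<and> d \<le> 0" if "x < z" "z < y" for z
      using odeD(4)[OF ode, of z] h_nonneg[of "\<phi> z"] nonneg[of z] that \<open>a \<le> x\<close> \<open>y \<le> b\<close> lam_pos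
      by (intro exI[of _ "- (lam * h (\<phi> z))"]) auto
    show "continuous_on {x..y} (\<lambda>y. spow p (D y))"
      using p_gt1 that by (intro continuous_intros continuous_on_subset[OF odeD(2)[OF ode]]) auto
  qed
  have anti: "D y \<le> D x" if "a \<le> x" "x \<le> y" "y \<le> b" for x y
    using spow_anti[OF that] spow_less_iff[OF p_gt1, of "D x" "D y"] by linarith
  obtain \<xi> where \<xi>: "a < \<xi>" "\<xi> < b" "D \<xi> = 0"
  proof -
    obtain \<xi> where "a < \<xi>" "\<xi> < b" "(\<phi> has_real_derivative 0) (at \<xi>)"
      using Rolle[OF ab _ odeD(1)[OF ode]] odeD(3)[OF ode] ends
      by (metis DERIV_unique real_differentiable_def)
    then show ?thesis using that odeD(3)[OF ode, of \<xi>] DERIV_unique by blast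
  qed
  have Db: "\<bar>D b\<bar> = \<bar>D a\<bar>"
  proof -
    have "\<bar>D b\<bar> powr p = \<bar>D a\<bar> powr p" using en[of b] ab ends A_0 e by simp
    then have "(\<bar>D b\<bar> powr p) powr (1/p) = (\<bar>D a\<bar> powr p) powr (1/p)" by simp
    then show ?thesis using p_gt1 by (simp add: powr_powr)
  qed
  have Da0: "D a \<noteq> 0" using e mu_pos p_gt1 by auto
  then show Da: "0 < D a" using anti[of a \<xi>] \<xi> by simp
  show Db': "D b = - D a" using Db Da anti[of \<xi> b] \<xi> by simp
  \<comment> \<open>The interval \<open>[\<alpha>, \<beta>]\<close> on which the solution rests, possibly a single point.\<close>
  define Zs where "Zs = {x \<in> {a..b}. D x = 0}"
  have "closed Zs"
    unfolding Zs_def using odeD(2)[OF ode] by (intro continuous_closed_preimage_constant) auto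
  moreover have "\<xi> \<in> Zs" using \<xi> by (simp add: Zs_def)
  then have "Zs \<noteq> {}" by blast
  moreover have "bdd_below Zs" "bdd_above Zs" by (auto simp: Zs_def)
  moreover define \<alpha> \<beta> where "\<alpha> = Inf Zs" and "\<beta> = Sup Zs"
  ultimately have ab_mem: "\<alpha> \<in> Zs" "\<beta> \<in> Zs" and ab_bd: "\<And>x. x \<in> Zs \<Longrightarrow> \<alpha> \<le> x \<and> x \<le> \<beta>"
    by (auto intro: closed_contains_Inf closed_contains_Sup cInf_lower cSup_upper)
  have \<alpha>: "a < \<alpha>" "D \<alpha> = 0" and \<beta>: "\<beta> < b" "D \<beta> = 0" and \<alpha>\<beta>: "\<alpha> \<le> \<beta>"
    using ab_mem ab_bd[OF ab_mem(1)] Da Db' by (auto simp: Zs_def order.order_iff_strict)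
  have D_pos: "0 < D x" if "a \<le> x" "x < \<alpha>" for x
  proof -
    have "x \<notin> Zs" using ab_bd[of x] that by auto
    then show ?thesis using anti[of x \<alpha>] that \<alpha> \<beta> \<alpha>\<beta> by (auto simp: Zs_def order.order_iff_strict)
  qed
  have D_neg: "D x < 0" if "\<beta> < x" "x \<le> b" for x
  proof -
    have "x \<notin> Zs" using ab_bd[of x] that by auto
    then show ?thesis using anti[of \<beta> x] that \<alpha> \<beta> \<alpha>\<beta> by (auto simp: Zs_def order.order_iff_strict)
  qed
  have D_zero: "D x = 0" if "\<alpha> \<le> x" "x \<le> \<beta>" for x
    using anti[of \<alpha> x] anti[of x \<beta>] that \<alpha> \<beta> by simp
  define M where "M = \<phi> \<alpha>"
  have M: "0 < M" "M \<le> zb" using pos[of \<alpha>] \<alpha> \<beta> \<alpha>\<beta> by (auto simp: M_def)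
  have AM: "A M = e" using en[of \<alpha>] \<alpha> \<beta> \<alpha>\<beta> mu_pos p_gt1 by (simp add: M_def)
  have levM: "lev e = M" using lev_A[of M] M AM by simp
  have e_le: "e \<le> A zb" using A_le[of M zb] M AM by simp
  have flat: "\<phi> x = M" if "\<alpha> \<le> x" "x \<le> \<beta>" for x
  proof -
    have "A (\<phi> x) = e" using en[of x] D_zero[OF that] that \<alpha> \<beta> mu_pos p_gt1 by simp
    then show ?thesis using lev_A[of "\<phi> x"] nonneg[of x] that \<alpha> \<beta> levM by simp
  qed
  have below: "\<phi> x < M" if "x \<in> {a..b}" "D x \<noteq> 0" for x
  proof -
    have "0 < \<bar>D x\<bar> powr p" using that by simp
    then have "A (\<phi> x) < A M" using en[OF that(1)] mu_pos AM by (simp add: zero_less_mult_iff)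
    then show ?thesis using A_le[of M "\<phi> x"] nonneg[OF that(1)] M by (intro not_le_imp_less) auto
  qed
  have rise: "th M (\<phi> x) = x - a" if "a \<le> x" "x < \<alpha>" for x
  proof (rule rise_time[OF ode, of \<alpha>])
    fix y assume y: "a < y" "y < \<alpha>"
    then have y': "y < b" "y \<in> {a..b}" using \<beta> \<alpha>\<beta> by auto
    show "0 < \<phi> y \<and> \<phi> y < M \<and> 0 < D y"
      using pos[of y] below[OF y'(2)] D_pos[of y] y y' by auto
    show "\<bar>D y\<bar> powr p = mu powr p * (A M - A (\<phi> y))" using en[OF y'(2)] AM by simp
  qed (use that \<alpha> \<beta> \<alpha>\<beta> M ends in auto)
  have fall: "th M (\<phi> x) = b - x" if "\<beta> < x" "x \<le> b" for x
  proof -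
    have "th M (\<phi> (a + b - (a + b - x))) = (a + b - x) - a"
    proof (rule rise_time[OF ode_reverse[OF ode], of "a + b - \<beta>"])
      fix y assume y: "a < y" "y < a + b - \<beta>"
      then have y': "\<beta> < a + b - y" "a + b - y < b" "a + b - y \<in> {a..b}" using \<alpha> \<alpha>\<beta> by auto
      show "0 < \<phi> (a + b - y) \<and> \<phi> (a + b - y) < M \<and> 0 < - D (a + b - y)"
        using pos[of "a + b - y"] below[OF y'(3)] D_neg[of "a + b - y"] y' \<alpha> \<alpha>\<beta> by auto
      show "\<bar>- D (a + b - y)\<bar> powr p = mu powr p * (A M - A (\<phi> (a + b - y)))"
        using en[OF y'(3)] AM by simp
    qed (use that \<alpha> \<beta> \<alpha>\<beta> M ends in auto)
    then show ?thesis by simp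
  qed
  \<comment> \<open>At the level \<open>A zb\<close> with \<open>p \<le> 2\<close> the climb up to \<open>\<alpha>\<close> would take longer than \<open>b - a\<close>.\<close>
  show adml: "adml e"
  proof (rule ccontr)
    assume "\<not> adml e"
    then have "p \<le> 2" "e = A zb" using e e_le by (auto simp: adml_def)
    then have Mz: "M = zb" using levM by simp
    obtain y where y: "0 < y" "y < zb" "(b - a) * mu < integral {0..y} (ig zb)"
      using ig_zb_unbounded[OF \<open>p \<le> 2\<close>] by blast
    obtain x where x: "a \<le> x" "x \<le> \<alpha>" "\<phi> x = y"
      using IVT'[of \<phi> a y \<alpha>] y ends Mz M_def \<alpha> \<beta> \<alpha>\<beta> continuous_on_subset[OF odeD(1)[OF ode], of "{a..\<alpha>}"]
      by auto
    then have "x < \<alpha>" using y Mz M_def by (cases "x = \<alpha>") auto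
    from rise[OF x(1) this] have "integral {0..y} (ig zb) = (x - a) * mu"
      using x Mz mu_pos by (simp add: th_def field_simps)
    also have "\<dots> \<le> (b - a) * mu"
      using \<open>x < \<alpha>\<close> \<alpha>\<beta> \<beta> mu_pos by (intro mult_right_mono) auto
    finally show False using y by simp
  qed
  have adm: "adm M" using adml_adm[OF adml] levM by simp
  have th_phi_cont: "continuous_on {u..v} (\<lambda>x. th M (\<phi> x))" if "a \<le> u" "v \<le> b" for u v
  proof (rule continuous_on_compose2[OF th_cont_adm[OF adm]])
    show "continuous_on {u..v} \<phi>"
      by (rule continuous_on_subset[OF odeD(1)[OF ode]]) (use that in auto)
    show "\<phi> ` {u..v} \<subseteq> {0..M}"
    proof (rule image_subsetI)
      fix x assume "x \<in> {u..v}"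
      then have x: "x \<in> {a..b}" using that by auto
      have "0 \<le> \<phi> x \<and> \<phi> x \<le> M"
        using below[OF x] flat[of x] nonneg[OF x] D_pos[of x] D_neg[of x] x
        by (cases "\<alpha> \<le> x \<and> x \<le> \<beta>") force+
      then show "\<phi> x \<in> {0..M}" by simp
    qed
  qed
  \<comment> \<open>The level is admissible, so \<open>th M\<close> is continuous up to \<open>M\<close> and the formula extends to \<open>\<alpha>\<close> and \<open>\<beta>\<close>.\<close>
  have q1: "quarter e = \<alpha> - a"
  proof -
    have "th M (\<phi> \<alpha>) - (\<alpha> - a) = 0"
    proof (rule continuous_constant_on_closure[where S = "{a..<\<alpha>}" and f = "\<lambda>x. th M (\<phi> x) - (x - a)"])
      show "continuous_on (closure {a..<\<alpha>}) (\<lambda>x. th M (\<phi> x) - (x - a))"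
        using \<alpha> \<beta> \<alpha>\<beta> by (auto intro!: continuous_intros th_phi_cont)
    qed (use \<alpha> rise in auto)
    then show ?thesis using th_lev[of e] levM M_def by simp
  qed
  have q2: "quarter e = b - \<beta>"
  proof -
    have "th M (\<phi> \<beta>) - (b - \<beta>) = 0"
    proof (rule continuous_constant_on_closure[where S = "{\<beta><..b}" and f = "\<lambda>x. th M (\<phi> x) - (b - x)"])
      show "continuous_on (closure {\<beta><..b}) (\<lambda>x. th M (\<phi> x) - (b - x))"
        using \<alpha> \<beta> \<alpha>\<beta> by (auto intro!: continuous_intros th_phi_cont)
    qed (use \<beta> fall in auto)
    then show ?thesis using th_lev[of e] levM flat[of \<beta>] \<alpha>\<beta> by simp
  qed
  show "2 * quarter e \<le> b - a" using q1 q2 \<alpha>\<beta> by simp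
  show "b - a = 2 * quarter e" if "e < A zb"
  proof -
    have "\<not> \<alpha> < \<beta>"
    proof
      assume lt: "\<alpha> < \<beta>"
      define m where "m = (\<alpha> + \<beta>) / 2"
      have m: "\<alpha> < m" "m < \<beta>" using lt by (auto simp: m_def)
      have "((\<lambda>y. spow p (D y)) has_real_derivative 0) (at m)"
        by (rule has_field_derivative_transform_within_open[of "\<lambda>_. 0" _ _ "{\<alpha><..<\<beta>}"])
           (use m D_zero in auto)
      moreover have "((\<lambda>y. spow p (D y)) has_real_derivative - (lam * h M)) (at m)"
        using odeD(4)[OF ode, of m] m \<alpha> \<beta> flat[of m] by simp
      ultimately have "lam * h M = 0" using DERIV_unique by fastforce
      moreover have "M < zb" using that AM M by (cases "M = zb") auto
      ultimately show False using h_pos[of M] M lam_pos by simp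
    qed
    then show ?thesis using q1 q2 \<alpha>\<beta> by simp
  qed
  fix x assume x: "x \<in> {a..b}"
  consider "x < \<alpha>" | "\<alpha> \<le> x" "x \<le> \<beta>" | "\<beta> < x" by linarith
  then show "\<phi> x \<in> {0..lev e} \<and> th (lev e) (\<phi> x) = min (min (x - a) (b - x)) (quarter e)"
  proof cases
    case 1
    then show ?thesis using rise[of x] below[OF x] D_pos[of x] nonneg[OF x] x levM q1 q2 \<alpha>\<beta> by auto
  next
    case 2
    then show ?thesis using flat[of x] M levM q1 q2 th_lev[of e] by auto
  next
    case 3
    then show ?thesis using fall[of x] below[OF x] D_neg[of x] nonneg[OF x] x levM q1 q2 \<alpha>\<beta> by auto
  qed
qed

end

section \<open>The nodal structure of a solution\<close>

lemma finite_set_enumeration: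
  fixes Z :: "real set"
  assumes "finite Z" "0 \<in> Z" "1 \<in> Z" "Z \<subseteq> {0..1}"
  obtains k X where "1 \<le> k" "card Z = k + 1" "strict_mono_on {..k} X" "X 0 = 0" "X k = 1" "X ` {..k} = Z"
proof -
  define l where "l = sorted_list_of_set Z"
  have l: "set l = Z" "sorted_wrt (<) l" "length l = card Z"
    using assms by (auto simp: l_def)
  have "2 \<le> card Z"
    using card_mono[of Z "{0, 1}"] assms by auto
  define k where "k = card Z - 1"
  have k: "1 \<le> k" "card Z = k + 1" using \<open>2 \<le> card Z\<close> by (auto simp: k_def)
  define X where "X = (!) l"
  have mono: "strict_mono_on {..k} X"
    unfolding X_def
  proof (rule strict_mono_onI)
    show "l ! r < l ! s" if "r \<in> {..k}" "s \<in> {..k}" "r < s" for r s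
      using sorted_wrt_nth_less[OF l(2), of r s] that l k by auto
  qed
  have img: "X ` {..k} = Z"
    using l k by (auto simp: X_def in_set_conv_nth image_iff less_Suc_eq_le simp flip: l(1))
  have le: "X i \<le> X j" if "i \<le> j" "j \<le> k" for i j
    using strict_mono_onD[OF mono, of i j] that by (cases "i = j") auto
  have X0: "X 0 = 0"
  proof -
    obtain i where "i \<le> k" "X i = 0" using img assms(2) by (metis atMost_iff imageE)
    moreover have "X 0 \<in> Z" using img by blast
    ultimately show ?thesis using le[of 0 i] assms(4) by force
  qed
  have "X k = 1"
  proof -
    obtain i where "i \<le> k" "X i = 1" using img assms(3) by (metis atMost_iff imageE)
    moreover have "X k \<in> Z" using img by blast
    ultimately show ?thesis using le[of i k] assms(4) by force
  qed
  then show thesis using that k mono img X0 by blast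
qed

lemma strict_mono_on_cover:
  fixes X :: "nat \<Rightarrow> real"
  assumes "1 \<le> k" "X 0 \<le> x" "x \<le> X k"
  shows "\<exists>i<k. X i \<le> x \<and> x \<le> X (Suc i)"
  using assms
proof (induction k)
  case (Suc k)
  show ?case
  proof (cases "X k \<le> x")
    case False
    then have "1 \<le> k" using Suc.prems by (cases k) auto
    then show ?thesis using Suc False by (metis less_SucI linorder_not_le order_less_imp_le)
  qed (use Suc in auto)
qed simp

lemma sign_constant:
  fixes \<phi> :: "real \<Rightarrow> real"
  assumes "continuous_on {a..b} \<phi>" "\<And>x. a < x \<Longrightarrow> x < b \<Longrightarrow> \<phi> x \<noteq> 0"
  shows "(\<forall>x. a < x \<and> x < b \<longrightarrow> 0 < \<phi> x) \<or> (\<forall>x. a < x \<and> x < b \<longrightarrow> \<phi> x < 0)"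
proof (rule ccontr)
  assume "\<not> ?thesis"
  then obtain x y where xy: "a < x" "x < b" "\<phi> x < 0" "a < y" "y < b" "0 < \<phi> y"
    using assms(2) by (meson linorder_neqE_linordered_idom)
  have c: "continuous_on {min x y..max x y} \<phi>"
    by (rule continuous_on_subset[OF assms(1)]) (use xy in auto)
  obtain z where "min x y \<le> z" "z \<le> max x y" "\<phi> z = 0"
  proof (cases "x \<le> y")
    case True
    then show ?thesis using IVT'[of \<phi> x 0 y] c xy that by (auto simp: min_def max_def)
  next
    case False
    then show ?thesis using IVT2'[of \<phi> x 0 y] c xy that by (auto simp: min_def max_def)
  qed
  then show False using assms(2)[of z] xy by auto
qed

text \<open>
  Both sides of the well. The locale is symmetric under exchanging the sides, and \<open>mu\<close> and \<open>I0\<close>, which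
  depend on \<open>p\<close> and \<open>lam\<close> only, are the same constants on both.
\<close>
locale well =
  pos: half_well p lam h A zp + neg: half_well p lam "\<lambda>s. - h (- s)" "\<lambda>s. A (- s)" "- zm"
  for p lam :: real and h A :: "real \<Rightarrow> real" and zp zm :: real
begin

definition estar :: real where
  "estar = min (A zp) (A zm)"

definition adml :: "real \<Rightarrow> bool" where
  "adml e \<longleftrightarrow> pos.adml e \<and> neg.adml e"

definition Q :: "real \<Rightarrow> nat \<Rightarrow> real" where
  "Q e i = (if even i then pos.quarter e else neg.quarter e)"

text \<open>
  The duration of \<open>k\<close> bumps without cores: each of them climbs and descends.
\<close>
definition T :: "nat \<Rightarrow> real \<Rightarrow> real" where
  "T k e = (\<Sum>i<k. 2 * Q e i)"

text \<open>
  The bumps are numbered from \<open>0\<close> and alternate in sign, beginning with a positive one. At the level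
  \<open>estar\<close> the \<open>i\<close>-th bump can have a core if its turning point is an end of the well.
\<close>
definition coreable :: "nat \<Rightarrow> bool" where
  "coreable i \<longleftrightarrow> (if even i then A zp else A zm) = estar"

definition bvp :: "(real \<Rightarrow> real) \<Rightarrow> (real \<Rightarrow> real) \<Rightarrow> bool" where
  "bvp \<phi> D \<longleftrightarrow> ode p lam h 0 1 \<phi> D \<and> \<phi> 0 = 0 \<and> \<phi> 1 = 0 \<and> (\<forall>x\<in>{0..1}. zm \<le> \<phi> x \<and> \<phi> x \<le> zp)"

definition nodal :: "nat \<Rightarrow> (nat \<Rightarrow> real) \<Rightarrow> (real \<Rightarrow> real) \<Rightarrow> bool" where
  "nodal k X \<phi> \<longleftrightarrow> strict_mono_on {..k} X \<and> X 0 = 0 \<and> X k = 1 \<and> (\<forall>x\<in>{0..1}. \<phi> x = 0 \<longleftrightarrow> x \<in> X ` {..k})"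

text \<open>
  The level of a solution that crosses zero with slope \<open>d\<close>.
\<close>
definition elev :: "real \<Rightarrow> real" where
  "elev d = (d / pos.mu) powr p"

lemma estar_pos: "0 < estar"
  using pos.A_pos[of zp] neg.A_pos[of "- zm"] pos.zb_pos neg.zb_pos by (simp add: estar_def)

lemma adml_iff: "adml e \<longleftrightarrow> 0 < e \<and> e \<le> estar \<and> (e < estar \<or> 2 < p)"
  unfolding adml_def pos.adml_def neg.adml_def estar_def by auto

lemma elev_pos: "0 < d \<Longrightarrow> 0 < elev d"
  using pos.mu_pos by (simp add: elev_def)

lemma elev_mu: "0 < d \<Longrightarrow> d powr p = pos.mu powr p * elev d"
  using pos.mu_pos by (simp add: elev_def powr_divide)

lemma Q_pos: "adml e \<Longrightarrow> 0 < Q e i"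
  unfolding Q_def adml_def using pos.quarter_pos neg.quarter_pos by auto

lemma bvp_slope_at_zero:
  assumes "bvp \<phi> D" "x \<in> {0..1}" "\<phi> x = 0"
  shows "\<bar>D x\<bar> = \<bar>D 0\<bar>"
proof -
  have "\<bar>D x\<bar> powr p = \<bar>D 0\<bar> powr p"
    using energy[OF pos.p_gt1 _ pos.A_deriv, where lam = lam and a = 0 and b = 1 and \<phi> = \<phi> and D = D and x = x] assms by (simp add: bvp_def)
  then have "(\<bar>D x\<bar> powr p) powr (1 / p) = (\<bar>D 0\<bar> powr p) powr (1 / p)" by simp
  then show ?thesis using pos.p_gt1 by (simp add: powr_powr)
qed

lemma bvp_zero_or_slope:
  assumes "bvp \<phi> D" "D 0 = 0" "x \<in> {0..1}"
  shows "\<phi> x = 0"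
proof -
  have b: "zm \<le> \<phi> x" "\<phi> x \<le> zp" using assms by (auto simp: bvp_def)
  have "\<bar>D x\<bar> powr p + lam * p / (p - 1) * A (\<phi> x) = 0"
    using energy[OF pos.p_gt1 _ pos.A_deriv, where lam = lam and a = 0 and b = 1 and \<phi> = \<phi> and D = D and x = x] assms pos.A_0 pos.p_gt1 by (simp add: bvp_def)
  moreover have "0 < lam * p / (p - 1)" using pos.lam_pos pos.p_gt1 by simp
  moreover have "0 \<le> \<bar>D x\<bar> powr p" by simp
  ultimately have "A (\<phi> x) \<le> 0" by (smt (verit) mult_pos_pos)
  then show ?thesis
    using pos.A_pos[of "\<phi> x"] neg.A_pos[of "- \<phi> x"] b by (cases "\<phi> x" "0::real" rule: linorder_cases) auto
qed

text \<open>
  At every zero the slope has the modulus \<open>\<bar>D 0\<bar>\<close>. Zeros accumulating at a point would by Rolle's theorem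
  force the slope to vanish there.
\<close>
lemma bvp_finite_zeros:
  assumes "bvp \<phi> D" "D 0 \<noteq> 0"
  shows "finite {x \<in> {0..1}. \<phi> x = 0}"
proof (rule ccontr)
  let ?Z = "{x \<in> {0..1}. \<phi> x = 0}"
  have ode: "ode p lam h 0 1 \<phi> D" using assms by (simp add: bvp_def)
  assume inf: "infinite ?Z"
  have "closed ?Z" using odeD(1)[OF ode] by (intro continuous_closed_preimage_constant) auto
  moreover have "bounded ?Z" by (rule bounded_subset[of "{0..1}"]) auto
  ultimately have "compact ?Z" by (simp add: compact_eq_bounded_closed)
  then obtain x where x: "x \<in> ?Z" "x islimpt ?Z"
    using Heine_Borel_imp_Bolzano_Weierstrass[OF _ inf order_refl] by blast
  have x01: "x \<in> {0..1}" using x by simp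
  have "D x \<noteq> 0" using bvp_slope_at_zero[OF assms(1) x01] x assms by auto
  then have "\<forall>\<^sub>F y in at x within {0..1}. D y \<noteq> 0"
    using odeD(2)[OF ode] x01 unfolding continuous_on_def by (intro tendsto_imp_eventually_ne) auto
  then obtain d where d: "d > 0" "\<And>y. y \<in> {0..1} \<Longrightarrow> y \<noteq> x \<Longrightarrow> dist y x < d \<Longrightarrow> D y \<noteq> 0"
    unfolding eventually_at by auto
  obtain y where y: "y \<in> ?Z" "y \<noteq> x" "dist y x < d"
    using x(2) d(1) unfolding islimpt_approachable by metis
  define u v where "u = min x y" and "v = max x y"
  have uv: "u < v" "0 \<le> u" "v \<le> 1" "\<phi> u = 0" "\<phi> v = 0" "{u, v} = {x, y}"
    using x y by (auto simp: u_def v_def min_def max_def)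
  have "\<exists>\<xi>. u < \<xi> \<and> \<xi> < v \<and> D \<xi> = 0"
  proof -
    have "\<exists>z. u < z \<and> z < v \<and> (\<phi> has_real_derivative 0) (at z)"
    proof (rule Rolle)
      show "continuous_on {u..v} \<phi>"
        by (rule continuous_on_subset[OF odeD(1)[OF ode]]) (use uv in auto)
      show "\<phi> differentiable at z" if "u < z" "z < v" for z
        using odeD(3)[OF ode, of z] that uv unfolding real_differentiable_def by auto
    qed (use uv in auto)
    then obtain z where "u < z" "z < v" "(\<phi> has_real_derivative 0) (at z)" by blast
    moreover from this have "(\<phi> has_real_derivative D z) (at z)" using odeD(3)[OF ode, of z] uv by auto
    ultimately show ?thesis using DERIV_unique by blast
  qed
  then obtain \<xi> where \<xi>: "u < \<xi>" "\<xi> < v" "D \<xi> = 0" by blast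
  then show False using d(2)[of \<xi>] y uv by (auto simp: u_def v_def dist_real_def min_def max_def split: if_splits)
qed

text \<open>
  The conclusions of the lemma \<open>bump\<close> for the \<open>i\<close>-th nodal interval \<open>[a, b]\<close>.
\<close>
definition arc :: "(real \<Rightarrow> real) \<Rightarrow> real \<Rightarrow> nat \<Rightarrow> real \<Rightarrow> real \<Rightarrow> bool" where
  "arc \<phi> e i a b \<longleftrightarrow>
     2 * Q e i \<le> b - a \<and>
     (if even i
      then pos.adml e \<and> (e < A zp \<longrightarrow> b - a = 2 * Q e i) \<and>
        (\<forall>x\<in>{a..b}. \<phi> x \<in> {0..pos.lev e} \<and> pos.th (pos.lev e) (\<phi> x) = min (min (x - a) (b - x)) (Q e i))
      else neg.adml e \<and> (e < A zm \<longrightarrow> b - a = 2 * Q e i) \<and>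
        (\<forall>x\<in>{a..b}. - \<phi> x \<in> {0..neg.lev e} \<and> neg.th (neg.lev e) (- \<phi> x) = min (min (x - a) (b - x)) (Q e i)))"

lemma arc_even:
  assumes "arc \<phi> e i a b" "even i" "x \<in> {a..b}"
  shows "pos.adml e" "\<phi> x \<in> {0..pos.lev e}" "pos.th (pos.lev e) (\<phi> x) = min (min (x - a) (b - x)) (Q e i)"
  using assms unfolding arc_def by simp_all

lemma arc_odd:
  assumes "arc \<phi> e i a b" "odd i" "x \<in> {a..b}"
  shows "neg.adml e" "- \<phi> x \<in> {0..neg.lev e}" "neg.th (neg.lev e) (- \<phi> x) = min (min (x - a) (b - x)) (Q e i)"
  using assms unfolding arc_def by simp_all

text \<open>
  The sign of the \<open>i\<close>-th bump is not assumed but read off: the lemma \<open>bump\<close> ties the sign of a bump to the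
  slope at its left end and reverses the slope at its right end, which is the left end of the next one.
\<close>
lemma bvp_arcs:
  assumes bvp: "bvp \<phi> D" and D0: "0 < D 0" and nodal: "nodal k X \<phi>"
  shows "i \<le> k \<Longrightarrow> D (X i) = (-1) ^ i * D 0 \<and> (i < k \<longrightarrow> arc \<phi> (elev (D 0)) i (X i) (X (Suc i)))"
proof (induction i)
  have ode: "ode p lam h 0 1 \<phi> D" using bvp by (simp add: bvp_def)
  let ?e = "elev (D 0)"
  have e: "0 < ?e" "D 0 powr p = pos.mu powr p * ?e" using elev_pos elev_mu D0 by auto
  have mono: "strict_mono_on {..k} X" and X: "X 0 = 0" "X k = 1"
    and Z: "\<And>x. x \<in> {0..1} \<Longrightarrow> \<phi> x = 0 \<longleftrightarrow> x \<in> X ` {..k}"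
    using nodal by (auto simp: nodal_def)
  have le: "X i \<le> X j" if "i \<le> j" "j \<le> k" for i j
    using strict_mono_onD[OF mono, of i j] that by (cases "i = j") auto
  have step: "D (X (Suc i)) = - D (X i) \<and> arc \<phi> ?e i (X i) (X (Suc i))"
    if i: "i < k" and D: "D (X i) = (-1) ^ i * D 0" for i
  proof -
    define a b where "a = X i" and "b = X (Suc i)"
    have ab: "a < b" "0 \<le> a" "b \<le> 1"
      using strict_mono_onD[OF mono, of i "Suc i"] le[of 0 i] le[of "Suc i" k] i X by (auto simp: a_def b_def)
    have ends: "\<phi> a = 0" "\<phi> b = 0" using Z[of a] Z[of b] i ab by (auto simp: a_def b_def)
    have ode': "ode p lam h a b \<phi> D" by (rule ode_subinterval[OF ode]) (use ab in auto)
    have Da: "\<bar>D a\<bar> powr p = pos.mu powr p * ?e" using D D0 e by (simp add: a_def abs_mult)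
    have nz: "\<phi> x \<noteq> 0" if x: "a < x" "x < b" for x
    proof
      assume "\<phi> x = 0"
      then obtain j where j: "j \<le> k" "x = X j" using Z[of x] x ab by auto
      then have "i < j" using le[of j i] x i by (cases "i < j") (auto simp: a_def)
      then show False using le[of "Suc i" j] x j by (auto simp: b_def)
    qed
    have bnd: "zm \<le> \<phi> x" "\<phi> x \<le> zp" if "a < x" "x < b" for x
      using bvp that ab by (auto simp: bvp_def)
    show ?thesis
      using sign_constant[OF odeD(1)[OF ode'] nz]
    proof
      assume "\<forall>x. a < x \<and> x < b \<longrightarrow> 0 < \<phi> x"
      then have pos: "0 < \<phi> x \<and> \<phi> x \<le> zp" if "a < x" "x < b" for x using bnd that by auto
      note B = pos.bump[OF ode' ab(1) ends pos e(1) Da]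
      have "even i" using B(5) D D0 by (cases "even i") (auto simp: a_def)
      then show ?thesis using B unfolding arc_def Q_def by (simp add: a_def b_def)
    next
      assume "\<forall>x. a < x \<and> x < b \<longrightarrow> \<phi> x < 0"
      then have pos: "0 < - \<phi> x \<and> - \<phi> x \<le> - zm" if "a < x" "x < b" for x using bnd that by auto
      have Da': "\<bar>- D a\<bar> powr p = pos.mu powr p * ?e" using Da by simp
      have ends': "- \<phi> a = 0" "- \<phi> b = 0" using ends by auto
      note B = neg.bump[OF ode_negate[OF ode'] ab(1) ends' pos e(1) Da']
      have "odd i" using B(5) D D0 by (cases "even i") (auto simp: a_def)
      then show ?thesis using B unfolding arc_def Q_def by (simp add: a_def b_def)
    qed
  qed
  {
    case 0
    then show ?case using step[of 0] X by auto
  next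
    case (Suc i)
    then have "D (X (Suc i)) = (-1) ^ Suc i * D 0" using step[of i] by auto
    then show ?case using step[of "Suc i"] Suc by auto
  }
qed

lemma arcs_unique:
  assumes "1 \<le> k" "X 0 = 0" "X k = 1"
    and "\<And>i. i < k \<Longrightarrow> arc \<phi> e i (X i) (X (Suc i))" "\<And>i. i < k \<Longrightarrow> arc \<psi> e i (X i) (X (Suc i))"
    and x: "x \<in> {0..1}"
  shows "\<phi> x = \<psi> x"
proof -
  obtain i where i: "i < k" "x \<in> {X i..X (Suc i)}"
    using strict_mono_on_cover[of k X x] assms by auto
  note \<phi> = assms(4)[OF i(1)] and \<psi> = assms(5)[OF i(1)]
  show ?thesis
  proof (cases "even i")
    case True
    note f = arc_even[OF \<phi> True i(2)] and g = arc_even[OF \<psi> True i(2)]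
    show ?thesis
      by (rule pos.th_inj[OF pos.adml_adm[OF f(1)] f(2) g(2)]) (simp only: f(3) g(3))
  next
    case False
    note f = arc_odd[OF \<phi> False i(2)] and g = arc_odd[OF \<psi> False i(2)]
    have "- \<phi> x = - \<psi> x"
      by (rule neg.th_inj[OF neg.adml_adm[OF f(1)] f(2) g(2)]) (simp only: f(3) g(3))
    then show ?thesis by simp
  qed
qed

text \<open>
  The hypothesis on \<open>k = 1\<close> is there because a single positive bump does not see the level \<open>A zm\<close>, so
  that its level could otherwise exceed \<open>estar\<close>.
\<close>
lemma arcs_level:
  assumes k: "1 \<le> k" "k = 1 \<longrightarrow> A zp \<le> A zm"
    and arcs: "\<And>i. i < k \<Longrightarrow> arc \<phi> e i (X i) (X (Suc i))"
  shows "adml e" and "\<And>i. i < k \<Longrightarrow> 0 \<le> X (Suc i) - X i - 2 * Q e i"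
    and "\<And>i. i < k \<Longrightarrow> \<not> (e = estar \<and> coreable i) \<Longrightarrow> X (Suc i) - X i - 2 * Q e i = 0"
    and "(\<Sum>i<k. X (Suc i) - X i - 2 * Q e i) = X k - X 0 - T k e"
proof -
  have pos: "pos.adml e" using arcs[of 0] k by (simp add: arc_def)
  \<comment> \<open>For \<open>k \<ge> 2\<close> the second bump is negative.\<close>
  have "neg.adml e"
  proof (cases "k = 1")
    case True
    then show ?thesis using pos k by (auto simp: pos.adml_def neg.adml_def)
  next
    case False
    then show ?thesis using arcs[of 1] k by (simp add: arc_def)
  qed
  then show adml: "adml e" using pos by (simp add: adml_def)
  show "0 \<le> X (Suc i) - X i - 2 * Q e i" if "i < k" for i using arcs[OF that] by (simp add: arc_def)
  show "X (Suc i) - X i - 2 * Q e i = 0" if "i < k" "\<not> (e = estar \<and> coreable i)" for i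
  proof -
    have "e < (if even i then A zp else A zm)"
      using that(2) adml unfolding adml_iff coreable_def by (auto simp: estar_def min_def split: if_splits)
    then show ?thesis using arcs[OF that(1)] by (auto simp: arc_def split: if_splits)
  qed
  show "(\<Sum>i<k. X (Suc i) - X i - 2 * Q e i) = X k - X 0 - T k e"
    using sum_lessThan_telescope[of X k] by (simp add: sum_subtractf T_def)
qed

section \<open>The total time as a function of the energy level\<close>

lemma Q_less: "0 < d \<Longrightarrow> d < e \<Longrightarrow> adml e \<Longrightarrow> Q d i < Q e i"
  unfolding Q_def adml_def using pos.quarter_less neg.quarter_less by auto

lemma T_less:
  assumes "1 \<le> k" "0 < d" "d < e" "adml e"
  shows "T k d < T k e"
  unfolding T_def using assms Q_less by (intro sum_strict_mono) (auto simp: lessThan_empty_iff)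

lemma T_gt:
  assumes "1 \<le> k" "adml e"
  shows "2 * real k * (pos.I0 / pos.mu) < T k e"
proof -
  have "(\<Sum>i<k. 2 * (pos.I0 / pos.mu)) < T k e"
    unfolding T_def Q_def using assms pos.quarter_gt[of e] neg.quarter_gt[of e]
    by (intro sum_strict_mono) (auto simp: adml_def lessThan_empty_iff)
  then show ?thesis by (simp add: mult_ac)
qed

lemma T_cont:
  assumes "adml e"
  shows "continuous_on {0<..e} (T k)"
proof -
  have "continuous_on {0<..e} (\<lambda>d. Q d i)" for i
    unfolding Q_def using assms pos.quarter_cont[of e] neg.quarter_cont[of e] by (cases "even i") (auto simp: adml_def)
  then show ?thesis unfolding T_def by (intro continuous_intros)
qed

lemma T_tendsto: "(T k \<longlongrightarrow> 2 * real k * (pos.I0 / pos.mu)) (at_right 0)"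
proof -
  have "((\<lambda>d. Q d i) \<longlongrightarrow> pos.I0 / pos.mu) (at_right 0)" for i
    unfolding Q_def using pos.quarter_tendsto neg.quarter_tendsto by (cases "even i") auto
  then have "(T k \<longlongrightarrow> (\<Sum>i<k. 2 * (pos.I0 / pos.mu))) (at_right 0)"
    unfolding T_def by (intro tendsto_intros)
  then show ?thesis by (simp add: mult_ac)
qed

lemma T_ge_Q: "adml e \<Longrightarrow> i < k \<Longrightarrow> 2 * Q e i \<le> T k e"
  unfolding T_def using Q_pos by (intro member_le_sum) (auto intro: less_imp_le)

text \<open>
  The side of the well on which \<open>A\<close> takes the value \<open>estar\<close> contributes a diverging time; if it is the
  negative side alone, the second hypothesis excludes \<open>k = 1\<close>, and there is a negative bump.
\<close>
lemma T_unbounded: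
  assumes "p \<le> 2" and k: "1 \<le> k" "k = 1 \<longrightarrow> A zp \<le> A zm"
  shows "\<exists>e. adml e \<and> 1 < T k e"
proof (cases "A zp \<le> A zm")
  case True
  then have "estar = A zp" by (simp add: estar_def)
  moreover obtain e where "0 < e" "e < A zp" "1 < pos.quarter e"
    using pos.quarter_unbounded[OF assms(1), of 0 1] estar_pos calculation by auto
  ultimately show ?thesis using T_ge_Q[of e 0 k] k by (intro exI[of _ e]) (auto simp: adml_iff Q_def)
next
  case False
  then have "estar = A zm" by (simp add: estar_def)
  moreover obtain e where "0 < e" "e < A zm" "1 < neg.quarter e"
    using neg.quarter_unbounded[OF assms(1), of 0 1] estar_pos calculation by auto
  moreover have "1 < k" using k False by auto
  ultimately show ?thesis using T_ge_Q[of e 1 k] k by (intro exI[of _ e]) (auto simp: adml_iff Q_def)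
qed

lemma T_level_exists:
  assumes k: "1 \<le> k" "k = 1 \<longrightarrow> A zp \<le> A zm" and small: "2 * real k * (pos.I0 / pos.mu) < 1"
    and large: "p \<le> 2 \<or> 1 \<le> T k estar"
  shows "\<exists>e. adml e \<and> T k e = 1"
proof -
  obtain e2 where e2: "adml e2" "1 \<le> T k e2"
  proof (cases "p \<le> 2")
    case True
    then show ?thesis using T_unbounded k that by (meson less_imp_le)
  next
    case False
    then show ?thesis using that[of estar] large estar_pos by (auto simp: adml_iff)
  qed
  have e2pos: "0 < e2" using e2 by (simp add: adml_iff)
  have "\<forall>\<^sub>F e in at_right 0. T k e < 1" using T_tendsto small by (rule order_tendstoD)
  then obtain b where b: "b > 0" "\<And>e. 0 < e \<Longrightarrow> e < b \<Longrightarrow> T k e < 1"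
    unfolding eventually_at_right_field by blast
  define e1 where "e1 = min b e2 / 2"
  have e1: "0 < e1" "e1 < b" "e1 \<le> e2" using b e2pos by (auto simp: e1_def)
  obtain e where e: "e1 \<le> e" "e \<le> e2" "T k e = 1"
    using IVT'[of "T k" e1 1 e2] b(2)[OF e1(1,2)] e2 e1 continuous_on_subset[OF T_cont[OF e2(1)], of "{e1..e2}" k]
    by force
  then have "adml e" using e1 e2 by (auto simp: adml_iff)
  then show ?thesis using e by blast
qed

end

section \<open>Construction of solutions\<close>

text \<open>
  A continuous function whose derivative agrees with a continuous function off a finite set is
  differentiable everywhere, by the fundamental theorem of calculus. This replaces all gluing of
  one-sided derivatives at the places where pieces of a solution are joined.
\<close>
lemma DERIV_off_finite_set:
  fixes F G :: "real \<Rightarrow> real"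
  assumes S: "finite S" and F: "continuous_on {a..b} F" and G: "continuous_on {a..b} G"
    and der: "\<And>x. a < x \<Longrightarrow> x < b \<Longrightarrow> x \<notin> S \<Longrightarrow> (F has_real_derivative G x) (at x)"
    and x: "x \<in> {a..b}"
  shows "(F has_real_derivative G x) (at x within {a..b})"
proof -
  have eq: "F a + integral {a..y} G = F y" if "y \<in> {a..b}" for y
  proof -
    have "(G has_integral (F y - F a)) {a..y}"
      by (rule fundamental_theorem_of_calculus_interior_strong[OF S])
         (use that der in \<open>auto simp: has_real_derivative_iff_has_vector_derivative[symmetric]
            intro: continuous_on_subset[OF F]\<close>)
    then show ?thesis by (simp add: integral_unique)
  qed
  have "((\<lambda>y. F a + integral {a..y} G) has_real_derivative 0 + G x) (at x within {a..b})"
    using integral_has_real_derivative[OF G x] by (intro DERIV_add DERIV_const)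
  then have "((\<lambda>y. F a + integral {a..y} G) has_real_derivative G x) (at x within {a..b})" by simp
  then show ?thesis
    by (rule has_field_derivative_transform_within[OF _ zero_less_one x]) (rule eq)
qed

text \<open>
  The derivative of the wave is the speed times the direction of travel; the direction jumps only at the
  extrema, where the speed is zero.
\<close>
lemma continuous_on_mult_sgn:
  fixes g b :: "real \<Rightarrow> real"
  assumes "continuous_on UNIV g" "continuous_on UNIV b" "\<And>x. b x = 0 \<Longrightarrow> g x = 0"
  shows "continuous_on S (\<lambda>x. g x * sgn (b x))"
proof -
  have "isCont (\<lambda>x. g x * sgn (b x)) x" for x
  proof (cases "b x = 0")
    case True
    have "isCont g x" using assms by (simp add: continuous_on_eq_continuous_at)
    then have "(g \<longlongrightarrow> 0) (at x)" using assms(3)[OF True] by (simp add: isCont_def)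
    then have "((\<lambda>x. \<bar>g x\<bar>) \<longlongrightarrow> 0) (at x)" using tendsto_rabs_zero by blast
    then have "((\<lambda>x. g x * sgn (b x)) \<longlongrightarrow> 0) (at x)"
      by (rule Lim_null_comparison[rotated]) (auto simp: abs_mult sgn_if)
    then show ?thesis using True by (simp add: isCont_def)
  next
    case False
    have "isCont g x" "isCont b x" using assms by (auto simp: continuous_on_eq_continuous_at)
    then show ?thesis using False unfolding isCont_def by (intro tendsto_intros) auto
  qed
  then show ?thesis by (simp add: continuous_at_imp_continuous_on)
qed

lemma cos_less_1_if_sin_nonzero:
  assumes "sin y \<noteq> (0::real)"
  shows "- 1 < cos y" "cos y < 1"
proof -
  have "cos y \<noteq> 1" "cos y \<noteq> - 1" using assms sin_squared_eq[of y] by auto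
  then show "- 1 < cos y" "cos y < 1" using cos_ge_minus_one[of y] cos_le_one[of y] by linarith+
qed

text \<open>
  The periodic solution of level \<open>e\<close> without cores. It is \<open>rise_inv \<circ> zeta\<close>, where \<open>rise_inv\<close> is a monotone
  solution from the lower to the upper turning point, defined on \<open>[- N, P]\<close>, and \<open>zeta\<close> is a sawtooth of
  slopes \<open>1\<close> and \<open>- 1\<close> that runs through \<open>[- N, P]\<close> back and forth.
\<close>
locale wave = well +
  fixes e :: real
  assumes adml_e: "adml e"
begin

abbreviation "P \<equiv> pos.quarter e"
abbreviation "N \<equiv> neg.quarter e"
abbreviation "top_val \<equiv> pos.lev e"
abbreviation "bot_val \<equiv> - neg.lev e"

lemma e_adm: "pos.adml e" "neg.adml e" "0 < e" "e \<le> A zp" "e \<le> A zm"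
  using adml_e by (auto simp: adml_def pos.adml_def neg.adml_def)

lemma P_pos: "0 < P" and N_pos: "0 < N"
  using e_adm pos.quarter_pos neg.quarter_pos by auto

lemma vals: "0 < top_val" "top_val \<le> zp" "A top_val = e" "bot_val < 0" "zm \<le> bot_val" "A bot_val = e"
  using pos.lev_mem[of e] pos.lev_pos[of e] neg.lev_mem[of e] neg.lev_pos[of e] e_adm by auto

text \<open>
  The time of a rising solution as a function of its value, with time \<open>0\<close> at the value \<open>0\<close>.
\<close>
definition rise :: "real \<Rightarrow> real" where
  "rise y = (if 0 \<le> y then pos.th top_val y else - neg.th (- bot_val) (- y))"

lemma rise_cont: "continuous_on {bot_val..top_val} rise"
proof -
  have adm: "pos.adm top_val" "neg.adm (- bot_val)"
    using pos.adml_adm neg.adml_adm e_adm by auto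
  have neg: "continuous_on {bot_val..0} (\<lambda>y. - neg.th (- bot_val) (- y))"
    using neg.th_cont_adm[OF adm(2)]
    by (intro continuous_intros continuous_on_compose2[of _ "neg.th (- bot_val)" _ uminus]) auto
  have "continuous_on ({0..top_val} \<union> {bot_val..0}) rise"
    unfolding rise_def
    by (rule continuous_on_If) (use pos.th_cont_adm[OF adm(1)] neg in auto)
  moreover have "{0..top_val} \<union> {bot_val..0} = {bot_val..top_val}" using vals by auto
  ultimately show ?thesis by simp
qed

lemma rise_deriv:
  assumes "bot_val < y" "y < top_val" "y \<noteq> 0"
  shows "(rise has_real_derivative (e - A y) powr (- 1 / p) / pos.mu) (at y)"
proof (cases "0 < y")
  case True
  have "(pos.th top_val has_real_derivative (e - A y) powr (- 1 / p) / pos.mu) (at y)"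
    using pos.th_deriv[of y top_val] True assms vals by (simp add: pos.ig_def)
  then show ?thesis
    by (rule has_field_derivative_transform_within_open[of _ _ _ "{0<..}"]) (use True in \<open>auto simp: rise_def\<close>)
next
  case False
  then have y: "y < 0" using assms by simp
  have "(neg.th (- bot_val) has_real_derivative (e - A y) powr (- 1 / p) / pos.mu) (at (- y))"
    using neg.th_deriv[of "- y" "- bot_val"] y assms vals by (simp add: neg.ig_def)
  then have "((\<lambda>y. neg.th (- bot_val) (- y)) has_real_derivative (e - A y) powr (- 1 / p) / pos.mu * - 1) (at y)"
    by (rule DERIV_chain2) (auto intro!: derivative_eq_intros)
  then have "((\<lambda>y. - neg.th (- bot_val) (- y)) has_real_derivative - ((e - A y) powr (- 1 / p) / pos.mu * - 1)) (at y)"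
    by (rule DERIV_minus)
  then have "((\<lambda>y. - neg.th (- bot_val) (- y)) has_real_derivative (e - A y) powr (- 1 / p) / pos.mu) (at y)"
    by simp
  then show ?thesis
    by (rule has_field_derivative_transform_within_open[of _ _ _ "{..<0}"]) (use y in \<open>auto simp: rise_def\<close>)
qed

lemma rise_vals: "rise 0 = 0" "rise top_val = P" "rise bot_val = - N"
  using vals pos.th_lev[of e] neg.th_lev[of e] by (auto simp: rise_def)

lemma gap_pos:
  assumes "bot_val < y" "y < top_val"
  shows "0 < e - A y"
proof (cases "0 \<le> y")
  case True
  then show ?thesis using pos.A_less[of y top_val] vals assms by simp
next
  case False
  then show ?thesis using neg.A_less[of "- y" "- bot_val"] vals assms by simp
qed

lemma rise_strict_mono:
  assumes "bot_val \<le> x" "x < y" "y \<le> top_val"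
  shows "rise x < rise y"
proof -
  have adm: "pos.adm top_val" "neg.adm (- bot_val)"
    using pos.adml_adm neg.adml_adm e_adm by auto
  consider "0 \<le> x" | "y \<le> 0" | "x < 0" "0 < y" by linarith
  then show ?thesis
  proof cases
    case 1
    then show ?thesis using pos.th_strict_mono[OF adm(1), of x y] assms by (simp add: rise_def)
  next
    case 2
    then show ?thesis using neg.th_strict_mono[OF adm(2), of "- y" "- x"] assms by (auto simp: rise_def)
  next
    case 3
    then show ?thesis
      using neg.th_strict_mono[OF adm(2), of 0 "- x"] pos.th_strict_mono[OF adm(1), of 0 y] assms
      by (auto simp: rise_def)
  qed
qed

lemma rise_inj: "inj_on rise {bot_val..top_val}"
  by (rule inj_onI) (metis atLeastAtMost_iff linorder_neqE_linordered_idom order_less_irrefl rise_strict_mono)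

lemma rise_image: "rise ` {bot_val..top_val} = {- N..P}"
proof (intro equalityI subsetI)
  fix t assume "t \<in> {- N..P}"
  then obtain y where "bot_val \<le> y" "y \<le> top_val" "rise y = t"
    using IVT'[of rise bot_val t top_val] rise_cont rise_vals vals by auto
  then show "t \<in> rise ` {bot_val..top_val}" by auto
next
  fix t assume "t \<in> rise ` {bot_val..top_val}"
  then obtain y where y: "bot_val \<le> y" "y \<le> top_val" "t = rise y" by auto
  have "rise bot_val \<le> rise y" "rise y \<le> rise top_val"
    using rise_strict_mono[of bot_val y] rise_strict_mono[of y top_val] y
    by (cases "y = bot_val"; force) (cases "y = top_val"; use rise_strict_mono[of y top_val] y in force)
  then show "t \<in> {- N..P}" using y rise_vals by simp
qed

definition rise_inv :: "real \<Rightarrow> real" where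
  "rise_inv = inv_into {bot_val..top_val} rise"

lemma rise_inv_rise: "bot_val \<le> y \<Longrightarrow> y \<le> top_val \<Longrightarrow> rise_inv (rise y) = y"
  unfolding rise_inv_def using rise_inj by (intro inv_into_f_f) auto

lemma rise_rise_inv: "- N \<le> t \<Longrightarrow> t \<le> P \<Longrightarrow> rise (rise_inv t) = t"
  unfolding rise_inv_def using rise_image by (intro f_inv_into_f) auto

lemma rise_inv_mem: "- N \<le> t \<Longrightarrow> t \<le> P \<Longrightarrow> bot_val \<le> rise_inv t \<and> rise_inv t \<le> top_val"
  unfolding rise_inv_def using inv_into_into[of t rise "{bot_val..top_val}"] rise_image by auto

lemma rise_inv_vals: "rise_inv 0 = 0" "rise_inv P = top_val" "rise_inv (- N) = bot_val"
  using rise_inv_rise[of 0] rise_inv_rise[of top_val] rise_inv_rise[of bot_val] rise_vals vals by auto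

lemma rise_inv_eq_0_iff: "- N \<le> t \<Longrightarrow> t \<le> P \<Longrightarrow> rise_inv t = 0 \<longleftrightarrow> t = 0"
  using rise_rise_inv[of t] rise_vals rise_inv_vals by auto

lemma rise_inv_cont: "continuous_on {- N..P} rise_inv"
proof -
  have "continuous_on (rise ` {bot_val..top_val}) rise_inv"
    by (rule continuous_on_inv[OF rise_cont]) (auto simp: rise_inv_rise)
  then show ?thesis by (simp add: rise_image)
qed

lemma rise_inv_open:
  assumes "- N < t" "t < P"
  shows "bot_val < rise_inv t" "rise_inv t < top_val"
  using rise_inv_mem[of t] rise_rise_inv[of t] rise_vals assms by (auto simp: order.order_iff_strict)

lemma rise_inv_deriv:
  assumes t: "- N < t" "t < P" "t \<noteq> 0"
  shows "(rise_inv has_real_derivative pos.mu * (e - A (rise_inv t)) powr (1 / p)) (at t)"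
proof -
  have w: "bot_val < rise_inv t" "rise_inv t < top_val" "rise_inv t \<noteq> 0"
    using rise_inv_open rise_inv_eq_0_iff t by auto
  have g: "0 < e - A (rise_inv t)" using gap_pos w by simp
  have "(rise_inv has_real_derivative inverse ((e - A (rise_inv t)) powr (- 1 / p) / pos.mu)) (at t)"
  proof (rule DERIV_inverse_function[where f = rise and a = "- N" and b = P])
    show "isCont rise_inv t"
      using rise_inv_cont t by (intro continuous_on_interior[of "{- N..P}"]) auto
    show "(e - A (rise_inv t)) powr (- 1 / p) / pos.mu \<noteq> 0" using g pos.mu_pos by simp
  qed (use t rise_deriv w rise_rise_inv in auto)
  moreover have "inverse ((e - A (rise_inv t)) powr (- 1 / p) / pos.mu) = pos.mu * (e - A (rise_inv t)) powr (1 / p)"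
    using g by (simp add: powr_minus divide_inverse)
  ultimately show ?thesis by simp
qed

abbreviation "w \<equiv> P + N"

definition angle :: "real \<Rightarrow> real" where
  "angle x = pi * (x - P) / w"

text \<open>
  The function \<open>arccos \<circ> cos\<close> is a sawtooth, continuous and periodic from the outset; it is rescaled so that
  \<open>zeta 0 = 0\<close> and the first maximum \<open>P\<close> is attained at \<open>x = P\<close>.
\<close>
definition zeta :: "real \<Rightarrow> real" where
  "zeta x = P - w / pi * arccos (cos (angle x))"

definition phi0 :: "real \<Rightarrow> real" where
  "phi0 x = rise_inv (zeta x)"

definition D0 :: "real \<Rightarrow> real" where
  "D0 x = pos.mu * (e - A (phi0 x)) powr (1 / p) * sgn (- sin (angle x))"

lemma zeta_mem: "- N \<le> zeta x" "zeta x \<le> P"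
proof -
  have a: "0 \<le> arccos (cos (angle x))" "arccos (cos (angle x)) \<le> pi"
    by (auto intro: arccos_lbound arccos_ubound)
  have w: "0 < w" using P_pos N_pos by simp
  have "w / pi * arccos (cos (angle x)) \<le> w / pi * pi" using a w by (intro mult_left_mono) auto
  then show "- N \<le> zeta x" by (simp add: zeta_def)
  show "zeta x \<le> P" using a w by (simp add: zeta_def)
qed

lemma zeta_cont: "continuous_on S zeta"
  unfolding zeta_def angle_def using P_pos N_pos by (intro continuous_intros) auto

lemma phi0_cont: "continuous_on S phi0"
  unfolding phi0_def using zeta_mem by (intro continuous_on_compose2[OF rise_inv_cont zeta_cont]) auto

lemma zeta_extreme:
  assumes "sin (angle x) = 0"
  shows "zeta x = P \<or> zeta x = - N"
proof -
  have "(cos (angle x))\<^sup>2 = 1" using assms sin_cos_squared_add[of "angle x"] by simp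
  then have "cos (angle x) = 1 \<or> cos (angle x) = - 1" by (simp add: power2_eq_1_iff)
  then show ?thesis unfolding zeta_def by auto
qed

lemma phi0_range: "bot_val \<le> phi0 x" "phi0 x \<le> top_val"
  unfolding phi0_def using rise_inv_mem zeta_mem by auto

lemma phi0_bounds: "zm \<le> phi0 x" "phi0 x \<le> zp"
  using phi0_range[of x] vals by auto

lemma gap_nonneg: "0 \<le> e - A (phi0 x)"
  using gap_pos[of "phi0 x"] phi0_range[of x] vals
  by (cases "phi0 x = bot_val \<or> phi0 x = top_val") (auto simp: less_le)

lemma D0_cont: "continuous_on S D0"
  unfolding D0_def
proof (rule continuous_on_mult_sgn)
  show "continuous_on UNIV (\<lambda>x. pos.mu * (e - A (phi0 x)) powr (1 / p))"
    using pos.p_gt1 gap_nonneg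
    by (intro continuous_intros continuous_on_powr' continuous_on_compose2[OF pos.A_cont phi0_cont]) auto
  show "continuous_on UNIV (\<lambda>x. - sin (angle x))"
    unfolding angle_def using P_pos N_pos by (intro continuous_intros) auto
  show "pos.mu * (e - A (phi0 x)) powr (1 / p) = 0" if "- sin (angle x) = 0" for x
    using zeta_extreme[of x] that rise_inv_vals vals by (auto simp: phi0_def)
qed

lemma zeta_deriv:
  assumes "sin (angle x) \<noteq> 0"
  shows "(zeta has_real_derivative sgn (- sin (angle x))) (at x)"
proof -
  have w: "0 < w" using P_pos N_pos by simp
  note c = cos_less_1_if_sin_nonzero[OF assms]
  have "(angle has_real_derivative pi / w) (at x)"
    unfolding angle_def[abs_def] using w by (auto intro!: derivative_eq_intros)
  then have "((\<lambda>x. cos (angle x)) has_real_derivative - sin (angle x) * (pi / w)) (at x)"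
    by (rule DERIV_chain2[OF DERIV_cos])
  then have "((\<lambda>x. arccos (cos (angle x))) has_real_derivative
      inverse (- sqrt (1 - (cos (angle x))\<^sup>2)) * (- sin (angle x) * (pi / w))) (at x)"
    by (rule DERIV_chain2[where f = arccos and g = "\<lambda>x. cos (angle x)", OF DERIV_arccos[OF c]])
  moreover have "sqrt (1 - (cos (angle x))\<^sup>2) = \<bar>sin (angle x)\<bar>"
    by (simp flip: sin_squared_eq)
  ultimately have "((\<lambda>x. arccos (cos (angle x))) has_real_derivative
      sin (angle x) / \<bar>sin (angle x)\<bar> * (pi / w)) (at x)"
    by (simp add: divide_inverse mult_ac)
  then have "(zeta has_real_derivative 0 - w / pi * (sin (angle x) / \<bar>sin (angle x)\<bar> * (pi / w))) (at x)"
    unfolding zeta_def[abs_def] by (intro DERIV_diff DERIV_const DERIV_cmult)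
  moreover have "0 - w / pi * (sin (angle x) / \<bar>sin (angle x)\<bar> * (pi / w)) = sgn (- sin (angle x))"
    using w assms by (auto simp: sgn_if)
  ultimately show ?thesis by simp
qed

lemma zeta_open:
  assumes "sin (angle x) \<noteq> 0"
  shows "- N < zeta x" "zeta x < P"
proof -
  have w: "0 < w" using P_pos N_pos by simp
  have ac: "0 < arccos (cos (angle x))" "arccos (cos (angle x)) < pi"
    using arccos_lt_bounded[OF cos_less_1_if_sin_nonzero[OF assms]] by blast+
  have wp: "0 < w / pi" using w by simp
  have "0 < w / pi * arccos (cos (angle x))" by (rule mult_pos_pos[OF wp ac(1)])
  moreover have "w / pi * arccos (cos (angle x)) < w / pi * pi" by (rule mult_strict_left_mono[OF ac(2) wp])
  moreover have "w / pi * pi = w" by simp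
  ultimately show "- N < zeta x" "zeta x < P" unfolding zeta_def by linarith+
qed

text \<open>
  Near such a point the direction of travel is constant and \<open>rise_inv\<close> is differentiable. The points with
  \<open>zeta x = 0\<close> are left out because \<open>rise\<close> is put together from two pieces there.
\<close>
lemma wave_derivs:
  assumes "sin (angle x) \<noteq> 0" "zeta x \<noteq> 0"
  shows "(phi0 has_real_derivative D0 x) (at x)"
    "((\<lambda>y. spow p (D0 y)) has_real_derivative - (lam * h (phi0 x))) (at x)"
proof -
  let ?s = "sgn (- sin (angle x))"
  have s2: "?s * ?s = 1" "\<bar>?s\<bar> = 1" "?s = 1 \<or> ?s = -1" using assms by (auto simp: sgn_if)
  have w: "bot_val < phi0 x" "phi0 x < top_val"
    unfolding phi0_def using rise_inv_open zeta_open assms by auto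
  have g: "0 < e - A (phi0 x)" using gap_pos w by simp
  have "(phi0 has_real_derivative pos.mu * (e - A (rise_inv (zeta x))) powr (1 / p) * ?s) (at x)"
    unfolding phi0_def[abs_def]
    by (rule DERIV_chain2[OF rise_inv_deriv zeta_deriv]) (use assms zeta_open in auto)
  then show d1: "(phi0 has_real_derivative D0 x) (at x)" by (simp add: D0_def phi0_def)
  define q where "q = (p - 1) / p"
  have mu: "0 < pos.mu" by (rule pos.mu_pos)
  define v where "v = (\<lambda>y. ?s * (pos.mu powr (p - 1) * (e - A (phi0 y)) powr q))"
  have "((\<lambda>y. e - A (phi0 y)) has_real_derivative - (h (phi0 x) * D0 x)) (at x)"
    using DERIV_chain2[OF pos.A_deriv d1] by (auto intro!: derivative_eq_intros)
  from DERIV_fun_powr[OF this g, of q]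
  have "((\<lambda>y. (e - A (phi0 y)) powr q) has_real_derivative
      q * (e - A (phi0 x)) powr (q - 1) * - (h (phi0 x) * D0 x)) (at x)"
    by (simp only: of_nat_1)
  then have "(v has_real_derivative
      ?s * (pos.mu powr (p - 1) * (q * (e - A (phi0 x)) powr (q - 1) * - (h (phi0 x) * D0 x)))) (at x)"
    unfolding v_def by (intro DERIV_cmult)
  moreover have "?s * (pos.mu powr (p - 1) * (q * (e - A (phi0 x)) powr (q - 1) * - (h (phi0 x) * D0 x)))
      = - (lam * h (phi0 x))"
  proof -
    have "(e - A (phi0 x)) powr (q - 1) * (e - A (phi0 x)) powr (1 / p) = 1"
      using g pos.p_gt1 by (simp add: q_def diff_divide_distrib flip: powr_add)
    moreover have "pos.mu powr (p - 1) * pos.mu = pos.mu powr p" using mu by (simp add: powr_diff)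
    moreover have "pos.mu powr p * q = lam" using pos.p_gt1 by (simp add: pos.mu_powr q_def)
    moreover have "?s * (pos.mu powr (p - 1) * (q * (e - A (phi0 x)) powr (q - 1) * - (h (phi0 x) * D0 x)))
      = - ((?s * ?s) * ((pos.mu powr (p - 1) * pos.mu) * q) *
           ((e - A (phi0 x)) powr (q - 1) * (e - A (phi0 x)) powr (1 / p)) * h (phi0 x))"
      by (simp only: D0_def mult_ac mult_minus_left mult_minus_right)
    ultimately show ?thesis using s2 by simp
  qed
  ultimately have v': "(v has_real_derivative - (lam * h (phi0 x))) (at x)" by (simp only:)
  define U where "U = {y. 0 < ?s * - sin (angle y)}"
  have oU: "open U" unfolding U_def angle_def by (intro open_Collect_less continuous_intros) (use P_pos N_pos in auto)
  have xU: "x \<in> U" using assms by (auto simp: U_def sgn_if)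
  have vU: "v y = spow p (D0 y)" if "y \<in> U" for y
  proof -
    have s: "sgn (- sin (angle y)) = ?s"
      using that s2(3) by (auto simp: U_def sgn_if split: if_splits)
    have "spow p (D0 y) = ?s * spow p (pos.mu * (e - A (phi0 y)) powr (1 / p))"
      using s2(3) unfolding D0_def s by auto
    also have "spow p (pos.mu * (e - A (phi0 y)) powr (1 / p)) = (pos.mu * (e - A (phi0 y)) powr (1 / p)) powr (p - 1)"
      using mu by (intro spow_nonneg_eq) auto
    also have "\<dots> = pos.mu powr (p - 1) * (e - A (phi0 y)) powr q"
      using mu by (simp add: powr_mult powr_powr q_def)
    finally show ?thesis by (simp add: v_def)
  qed
  show "((\<lambda>y. spow p (D0 y)) has_real_derivative - (lam * h (phi0 x))) (at x)"
    by (rule has_field_derivative_transform_within_open[OF v' oU xU vU])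
qed

subsection \<open>The zeros of the periodic wave\<close>

definition node :: "nat \<Rightarrow> real" where
  "node i = (\<Sum>j<i. 2 * Q e j)"

lemma node_Suc: "node (Suc i) = node i + 2 * Q e i"
  by (simp add: node_def)

lemma node_even: "node (2 * m) = 2 * real m * w"
proof (induction m)
  case (Suc m)
  have "node (2 * Suc m) = node (2 * m) + 2 * Q e (2 * m) + 2 * Q e (Suc (2 * m))"
    by (simp add: node_def)
  also have "\<dots> = 2 * real (Suc m) * w"
    unfolding Suc by (simp add: Q_def algebra_simps)
  finally show ?case .
qed (simp add: node_def)

lemma sin_nonzero_small:
  assumes "t \<noteq> 0" "\<bar>t\<bar> < w"
  shows "sin (pi * t / w) \<noteq> 0"
proof -
  have w: "0 < w" using P_pos N_pos by simp
  have pos: "0 < sin (pi * u / w)" if "0 < u" "u < w" for u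
    by (rule sin_gt_zero) (use that w in \<open>auto simp: pos_divide_less_eq\<close>)
  show ?thesis
  proof (cases "0 < t")
    case False
    then have "0 < sin (pi * (- t) / w)" using assms by (intro pos) auto
    then show ?thesis by simp
  qed (use pos[of t] assms in auto)
qed

lemma arccos_cos_small:
  assumes "\<bar>t\<bar> \<le> w"
  shows "arccos (cos (pi * t / w)) = pi * \<bar>t\<bar> / w"
proof -
  have w: "0 < w" using P_pos N_pos by simp
  have "cos (pi * t / w) = cos (pi * \<bar>t\<bar> / w)" by (cases "0 \<le> t") auto
  moreover have "arccos (cos (pi * \<bar>t\<bar> / w)) = pi * \<bar>t\<bar> / w"
    by (rule arccos_cos) (use assms w in \<open>auto simp: divide_le_eq\<close>)
  ultimately show ?thesis by simp
qed

text \<open>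
  The sawtooth on the \<open>i\<close>-th nodal interval. Going over to the remainder modulo the period \<open>2 * w\<close> leaves
  the first positive and the first negative tooth, where \<open>arccos (cos y)\<close> is explicit.
\<close>
lemma zeta_node:
  assumes "0 \<le> t" "t \<le> 2 * Q e i"
  shows "zeta (node i + t) = (-1) ^ i * (Q e i - \<bar>t - Q e i\<bar>)"
    and "0 < t \<Longrightarrow> t < 2 * Q e i \<Longrightarrow> t \<noteq> Q e i \<Longrightarrow> sin (angle (node i + t)) \<noteq> 0"
    and "sin (angle (node i + Q e i)) = 0"
proof -
  have w: "0 < w" using P_pos N_pos by simp
  define m where "m = i div 2"
  have per: "cos (2 * pi * real m + y) = cos y" "sin (2 * pi * real m + y) = sin y" for y
    using cos_int_2pin[of "int m"] sin_int_2pin[of "int m"] by (auto simp: cos_add sin_add mult_ac)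
  show "zeta (node i + t) = (-1) ^ i * (Q e i - \<bar>t - Q e i\<bar>)"
    "0 < t \<Longrightarrow> t < 2 * Q e i \<Longrightarrow> t \<noteq> Q e i \<Longrightarrow> sin (angle (node i + t)) \<noteq> 0"
    "sin (angle (node i + Q e i)) = 0"
  proof -
    have "even i \<or> odd i" by blast
    then have "(zeta (node i + t) = (-1) ^ i * (Q e i - \<bar>t - Q e i\<bar>)) \<and>
      (0 < t \<longrightarrow> t < 2 * Q e i \<longrightarrow> t \<noteq> Q e i \<longrightarrow> sin (angle (node i + t)) \<noteq> 0) \<and>
      sin (angle (node i + Q e i)) = 0"
    proof
      assume ev: "even i"
      then have i: "i = 2 * m" by (simp add: m_def)
      have Q: "Q e i = P" using ev by (simp add: Q_def)
      have ang: "angle (node i + u) = 2 * pi * real m + pi * (u - P) / w" for u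
        unfolding angle_def i node_even using w by (simp add: field_simps)
      have t: "\<bar>t - P\<bar> \<le> P" using assms Q by auto
      then have "\<bar>t - P\<bar> \<le> w" using N_pos by simp
      then have "zeta (node i + t) = P - \<bar>t - P\<bar>"
        unfolding zeta_def ang per arccos_cos_small[OF \<open>\<bar>t - P\<bar> \<le> w\<close>] using w by simp
      moreover have "sin (angle (node i + t)) \<noteq> 0" if "0 < t" "t < 2 * P" "t \<noteq> P"
        unfolding ang per by (rule sin_nonzero_small) (use that N_pos in auto)
      moreover have "sin (angle (node i + P)) = 0" unfolding ang per by simp
      ultimately show ?thesis using ev Q by simp
    next
      assume od: "odd i"
      then have i: "i = Suc (2 * m)" by (simp add: m_def)
      have Q: "Q e i = N" using od by (simp add: Q_def)
      have nd: "node i = 2 * real m * w + 2 * P"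
        unfolding i node_Suc node_even by (simp add: Q_def)
      have ang: "angle (node i + u) = 2 * pi * real m + (pi + pi * (u - N) / w)" for u
        unfolding angle_def nd using w by (simp add: field_simps)
      have t: "\<bar>t - N\<bar> \<le> w" using assms Q P_pos by auto
      have "cos (pi + y) = cos (pi - y)" for y by simp
      then have "arccos (cos (pi + pi * (t - N) / w)) = arccos (- cos (pi * (t - N) / w))" by simp
      also have "\<dots> = pi - pi * \<bar>t - N\<bar> / w"
        using arccos_minus[of "cos (pi * (t - N) / w)"] arccos_cos_small[OF t] by simp
      finally have "zeta (node i + t) = - (N - \<bar>t - N\<bar>)"
        unfolding zeta_def ang per using w by (simp add: right_diff_distrib)
      moreover have "sin (angle (node i + t)) \<noteq> 0" if "0 < t" "t < 2 * N" "t \<noteq> N"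
        using sin_nonzero_small[of "t - N"] that P_pos unfolding ang per by auto
      moreover have "sin (angle (node i + N)) = 0" unfolding ang per by simp
      ultimately show ?thesis using od Q by simp
    qed
    then show "zeta (node i + t) = (-1) ^ i * (Q e i - \<bar>t - Q e i\<bar>)"
      "0 < t \<Longrightarrow> t < 2 * Q e i \<Longrightarrow> t \<noteq> Q e i \<Longrightarrow> sin (angle (node i + t)) \<noteq> 0"
      "sin (angle (node i + Q e i)) = 0" by blast+
  qed
qed

subsection \<open>Stretching the wave by stationary cores\<close>

definition shift :: "(nat \<Rightarrow> real) \<Rightarrow> nat \<Rightarrow> real" where
  "shift c i = (\<Sum>j<i. c j)"

definition stretched_node :: "(nat \<Rightarrow> real) \<Rightarrow> nat \<Rightarrow> real" where
  "stretched_node c i = node i + shift c i"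

text \<open>
  The clock: \<open>tau k c x\<close> is \<open>x\<close> minus the time that has been spent in cores up to \<open>x\<close>. The \<open>i\<close>-th core begins
  a quarter period after the \<open>i\<close>-th zero and lasts for \<open>c i\<close>.
\<close>
definition tau :: "nat \<Rightarrow> (nat \<Rightarrow> real) \<Rightarrow> real \<Rightarrow> real" where
  "tau k c x = x - (\<Sum>i<k. min (c i) (max 0 (x - stretched_node c i - Q e i)))"

definition cores :: "nat \<Rightarrow> (nat \<Rightarrow> real) set" where
  "cores k = {c. (\<forall>i. 0 \<le> c i) \<and> (\<forall>i. c i \<noteq> 0 \<longrightarrow> i < k \<and> e = estar \<and> coreable i) \<and> (\<Sum>i<k. c i) = 1 - T k e}"

definition phi :: "nat \<Rightarrow> (nat \<Rightarrow> real) \<Rightarrow> real \<Rightarrow> real" where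
  "phi k c x = phi0 (tau k c x)"

definition Dphi :: "nat \<Rightarrow> (nat \<Rightarrow> real) \<Rightarrow> real \<Rightarrow> real" where
  "Dphi k c x = D0 (tau k c x)"

lemma Q_e_pos: "0 < Q e i"
  by (rule Q_pos[OF adml_e])

lemma stretched_node_0 [simp]: "stretched_node c 0 = 0"
  by (simp add: stretched_node_def node_def shift_def)

lemma stretched_node_Suc: "stretched_node c (Suc i) = stretched_node c i + 2 * Q e i + c i"
  by (simp add: stretched_node_def node_def shift_def)

lemma stretched_node_end: "c \<in> cores k \<Longrightarrow> stretched_node c k = 1"
  by (simp add: cores_def stretched_node_def node_def shift_def T_def)

lemma tau_cont: "continuous_on S (tau k c)"
  unfolding tau_def by (intro continuous_intros)

context
  fixes k :: nat and c :: "nat \<Rightarrow> real"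
  assumes c: "c \<in> cores k" and k: "1 \<le> k"
begin

lemma c_nonneg: "0 \<le> c i"
  using c by (simp add: cores_def)

lemma stretched_node_strict_mono: "strict_mono (stretched_node c)"
  unfolding strict_mono_Suc_iff stretched_node_Suc using Q_e_pos c_nonneg by (simp add: add_pos_nonneg)

text \<open>
  On the \<open>i\<close>-th nodal interval the earlier cores are over and the later ones have not begun.
\<close>
lemma tau_local:
  assumes i: "i < k" and x: "stretched_node c i \<le> x" "x \<le> stretched_node c (Suc i)"
  shows "tau k c x = x - shift c i - min (c i) (max 0 (x - stretched_node c i - Q e i))"
proof -
  let ?f = "\<lambda>j. min (c j) (max 0 (x - stretched_node c j - Q e j))"
  have mono: "stretched_node c i \<le> stretched_node c j" if "i \<le> j" for i j
    using stretched_node_strict_mono that by (simp add: strict_mono_less_eq)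
  have "?f j = c j" if "j < i" for j
    using mono[of "Suc j" i] that x stretched_node_Suc[of c j] Q_e_pos[of j] c_nonneg[of j] by auto
  then have before: "(\<Sum>j<i. ?f j) = shift c i" by (simp add: shift_def)
  have "?f j = 0" if "i < j" for j
    using mono[of "Suc i" j] that x Q_e_pos[of j] c_nonneg[of j] by auto
  then have "(\<Sum>j<k. ?f j) = (\<Sum>j<Suc i. ?f j)"
    using i by (intro sum.mono_neutral_right) auto
  also have "\<dots> = shift c i + ?f i" using before by simp
  finally show ?thesis by (simp add: tau_def)
qed

lemma tau_between:
  assumes i: "i < k" and x: "stretched_node c i \<le> x" "x \<le> stretched_node c (Suc i)"
  defines "u \<equiv> x - stretched_node c i"
  shows "tau k c x = node i + (u - min (c i) (max 0 (u - Q e i)))"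
  using tau_local[OF i x] by (simp add: u_def stretched_node_def)

lemma phi_zero_iff:
  assumes i: "i < k" and x: "stretched_node c i \<le> x" "x \<le> stretched_node c (Suc i)"
  shows "phi k c x = 0 \<longleftrightarrow> x = stretched_node c i \<or> x = stretched_node c (Suc i)"
proof -
  define u t where "u = x - stretched_node c i" and "t = u - min (c i) (max 0 (u - Q e i))"
  have u: "0 \<le> u" "u \<le> 2 * Q e i + c i" using x stretched_node_Suc[of c i] by (auto simp: u_def)
  have t: "0 \<le> t" "t \<le> 2 * Q e i" using u c_nonneg[of i] Q_e_pos[of i] by (auto simp: t_def)
  have "phi k c x = 0 \<longleftrightarrow> zeta (node i + t) = 0"
    unfolding phi_def phi0_def tau_between[OF i x] u_def[symmetric] t_def[symmetric]
    using rise_inv_eq_0_iff zeta_mem by auto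
  also have "\<dots> \<longleftrightarrow> t = 0 \<or> t = 2 * Q e i"
    unfolding zeta_node(1)[OF t] using t by auto
  also have "\<dots> \<longleftrightarrow> u = 0 \<or> u = 2 * Q e i + c i"
    using u c_nonneg[of i] Q_e_pos[of i] by (auto simp: t_def min_def max_def split: if_splits)
  finally show ?thesis by (auto simp: u_def stretched_node_Suc)
qed

lemma covered:
  assumes "x \<in> {0..1}"
  obtains i where "i < k" "stretched_node c i \<le> x" "x \<le> stretched_node c (Suc i)"
  using strict_mono_on_cover[OF k, of "stretched_node c" x] assms stretched_node_end[OF c] by auto

lemma phi_nodal: "nodal k (stretched_node c) (phi k c)"
  unfolding nodal_def
proof (intro conjI ballI)
  show "strict_mono_on {..k} (stretched_node c)"
    using stretched_node_strict_mono by (auto intro!: strict_mono_onI simp: strict_monoD)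
  show "stretched_node c k = 1" by (rule stretched_node_end[OF c])
  fix x :: real assume "x \<in> {0..1}"
  then obtain i where i: "i < k" "stretched_node c i \<le> x" "x \<le> stretched_node c (Suc i)" by (rule covered)
  show "phi k c x = 0 \<longleftrightarrow> x \<in> stretched_node c ` {..k}"
  proof
    assume "phi k c x = 0"
    then have "x = stretched_node c i \<or> x = stretched_node c (Suc i)" using phi_zero_iff[OF i] by simp
    then show "x \<in> stretched_node c ` {..k}" using i(1) by auto
  next
    assume "x \<in> stretched_node c ` {..k}"
    then obtain j where j: "x = stretched_node c j" by auto
    then have "i \<le> j" "j \<le> Suc i"
      using i stretched_node_strict_mono by (auto simp: strict_mono_less_eq)
    then have "j = i \<or> j = Suc i" by auto
    then show "phi k c x = 0" using phi_zero_iff[OF i] j by auto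
  qed
qed simp

text \<open>
  A core lies at an end of the well, where a constant solves the equation.
\<close>
lemma core_stationary:
  assumes "c i \<noteq> 0"
  shows "h (phi0 (node i + Q e i)) = 0"
proof -
  have e: "e = estar" "coreable i" using assms c by (auto simp: cores_def)
  have z: "zeta (node i + Q e i) = (-1) ^ i * Q e i"
    using zeta_node(1)[of "Q e i" i] Q_e_pos[of i] by simp
  show ?thesis
  proof (cases "even i")
    case True
    then have "phi0 (node i + Q e i) = pos.lev e" using z rise_inv_vals by (simp add: phi0_def Q_def)
    moreover have "e = A zp" using e True by (simp add: coreable_def)
    ultimately show ?thesis using pos.h_zb by simp
  next
    case False
    then have "phi0 (node i + Q e i) = - neg.lev e" using z rise_inv_vals by (simp add: phi0_def Q_def)
    moreover have "e = A zm" using e False by (simp add: coreable_def)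
    ultimately show ?thesis using neg.h_zb neg.lev_zb by simp
  qed
qed

text \<open>
  Off the zeros and the ends of the cores, \<open>phi\<close> is locally a translate of the wave or locally constant.
  In the latter case \<open>Dphi\<close> vanishes as well, since a core is entered at an extremum of the wave.
\<close>
lemma phi_derivs_off_exceptions:
  assumes x: "0 < x" "x < 1"
    and off: "x \<notin> (\<Union>i\<in>{..k}. {stretched_node c i, stretched_node c i + Q e i, stretched_node c i + Q e i + c i})"
  shows "(phi k c has_real_derivative Dphi k c x) (at x) \<and>
    ((\<lambda>y. spow p (Dphi k c y)) has_real_derivative - (lam * h (phi k c x))) (at x)"
proof -
  obtain i where i: "i < k" "stretched_node c i \<le> x" "x \<le> stretched_node c (Suc i)"
    using covered[of x] x by auto
  define a where "a = stretched_node c i"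
  have b: "stretched_node c (Suc i) = a + 2 * Q e i + c i" by (simp add: a_def stretched_node_Suc)
  have "x \<noteq> stretched_node c i" "x \<noteq> stretched_node c (Suc i)" "x \<noteq> a + Q e i" "x \<noteq> a + Q e i + c i"
    using off i(1) by (auto simp: a_def)
  then have x': "a < x" "x < a + 2 * Q e i + c i" "x \<noteq> a + Q e i" "x \<noteq> a + Q e i + c i"
    using i b by (auto simp: a_def)
  have tau: "tau k c y = node i + ((y - a) - min (c i) (max 0 ((y - a) - Q e i)))"
    if "a \<le> y" "y \<le> a + 2 * Q e i + c i" for y
    using tau_between[OF i(1), of y] that b by (simp add: a_def)
  have shifted: ?thesis
    if d: "\<And>y. l < y \<Longrightarrow> y < r \<Longrightarrow> tau k c y = y - d" and lr: "l < x" "x < r"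
      and t: "0 < x - d - node i" "x - d - node i < 2 * Q e i" "x - d - node i \<noteq> Q e i" for d l r
  proof -
    let ?t = "x - d - node i"
    have eq: "node i + ?t = x - d" by simp
    have "sin (angle (x - d)) \<noteq> 0" using zeta_node(2)[of ?t i] t by (simp add: eq)
    moreover have "zeta (x - d) \<noteq> 0" using zeta_node(1)[of ?t i] t by (auto simp: eq abs_if split: if_splits)
    ultimately have w: "(phi0 has_real_derivative D0 (x - d)) (at (x - d))"
      "((\<lambda>y. spow p (D0 y)) has_real_derivative - (lam * h (phi0 (x - d)))) (at (x - d))"
      using wave_derivs by auto
    have sh: "((\<lambda>y. y - d) has_real_derivative 1) (at x)" by (auto intro!: derivative_eq_intros)
    have "((\<lambda>y. phi0 (y - d)) has_real_derivative D0 (x - d) * 1) (at x)"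
      by (rule DERIV_chain2[OF w(1) sh])
    then have "(phi k c has_real_derivative D0 (x - d) * 1) (at x)"
      by (rule has_field_derivative_transform_within_open[of _ _ _ "{l<..<r}"]) (use d lr in \<open>auto simp: phi_def\<close>)
    moreover have "((\<lambda>y. spow p (D0 (y - d))) has_real_derivative - (lam * h (phi0 (x - d))) * 1) (at x)"
      by (rule DERIV_chain2[OF w(2) sh])
    then have "((\<lambda>y. spow p (Dphi k c y)) has_real_derivative - (lam * h (phi0 (x - d))) * 1) (at x)"
      by (rule has_field_derivative_transform_within_open[of _ _ _ "{l<..<r}"]) (use d lr in \<open>auto simp: Dphi_def\<close>)
    ultimately show ?thesis using d[OF lr] by (simp add: phi_def Dphi_def)
  qed
  have c0: "0 \<le> c i" and Q0: "0 < Q e i" using c_nonneg Q_e_pos by auto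
  consider "x < a + Q e i" | "a + Q e i < x" "x < a + Q e i + c i" | "a + Q e i + c i < x"
    using x' by linarith
  then show ?thesis
  proof cases
    case 1
    show ?thesis
      by (rule shifted[of a "a + Q e i" "a - node i"]) (use 1 x' tau c0 Q0 in auto)
  next
    case 2
    let ?s = "node i + Q e i"
    have s: "tau k c y = ?s" if "a + Q e i < y" "y < a + Q e i + c i" for y
      using tau[of y] that Q0 by auto
    have D: "D0 ?s = 0" using zeta_node(3)[of 0 i] Q0 by (simp add: D0_def)
    have H: "h (phi0 ?s) = 0" using 2 by (intro core_stationary) auto
    have "(phi k c has_real_derivative 0) (at x)"
      by (rule has_field_derivative_transform_within_open[of "\<lambda>_. phi0 ?s" _ _ "{a + Q e i<..<a + Q e i + c i}"])
         (use 2 s in \<open>auto simp: phi_def\<close>)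
    moreover have "((\<lambda>y. spow p (Dphi k c y)) has_real_derivative 0) (at x)"
      by (rule has_field_derivative_transform_within_open[of "\<lambda>_. spow p (D0 ?s)" _ _ "{a + Q e i<..<a + Q e i + c i}"])
         (use 2 s in \<open>auto simp: Dphi_def\<close>)
    ultimately show ?thesis using s[OF 2] D H by (simp add: phi_def Dphi_def)
  next
    case 3
    show ?thesis
      by (rule shifted[of "a + Q e i + c i" "a + 2 * Q e i + c i" "a + c i - node i"]) (use 3 x' tau c0 Q0 in auto)
  qed
qed

lemma phi_cont: "continuous_on S (phi k c)" and Dphi_cont: "continuous_on S (Dphi k c)"
  unfolding phi_def Dphi_def
  by (intro continuous_on_compose2[OF phi0_cont[of UNIV] tau_cont] continuous_on_compose2[OF D0_cont[of UNIV] tau_cont]; simp)+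

lemma phi_derivs:
  assumes "x \<in> {0..1}"
  shows "(phi k c has_real_derivative Dphi k c x) (at x within {0..1})"
    "((\<lambda>y. spow p (Dphi k c y)) has_real_derivative - (lam * h (phi k c x))) (at x within {0..1})"
proof -
  let ?S = "(\<Union>i\<in>{..k}. {stretched_node c i, stretched_node c i + Q e i, stretched_node c i + Q e i + c i})"
  have fin: "finite ?S" by auto
  show "(phi k c has_real_derivative Dphi k c x) (at x within {0..1})"
    by (rule DERIV_off_finite_set[OF fin phi_cont Dphi_cont _ assms]) (use phi_derivs_off_exceptions in blast)
  have 1: "continuous_on {0..1} (\<lambda>y. spow p (Dphi k c y))"
    using pos.p_gt1 Dphi_cont by (intro continuous_intros) auto
  have 2: "continuous_on {0..1} (\<lambda>y. - (lam * h (phi k c y)))"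
    using continuous_on_compose2[OF pos.h_cont phi_cont] by (intro continuous_intros) auto
  show "((\<lambda>y. spow p (Dphi k c y)) has_real_derivative - (lam * h (phi k c x))) (at x within {0..1})"
    by (rule DERIV_off_finite_set[OF fin 1 2 _ assms]) (use phi_derivs_off_exceptions in blast)
qed

lemma phi_bvp: "bvp (phi k c) (Dphi k c)"
  unfolding bvp_def
proof (intro conjI ballI)
  show "ode p lam h 0 1 (phi k c) (Dphi k c)"
    unfolding ode_def
  proof (intro conjI allI impI phi_cont Dphi_cont)
    fix x :: real assume x: "0 < x \<and> x < 1"
    then show "(phi k c has_real_derivative Dphi k c x) (at x)"
      "((\<lambda>y. spow p (Dphi k c y)) has_real_derivative - (lam * h (phi k c x))) (at x)"
      using phi_derivs[of x] by (simp_all add: at_within_Icc_at)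
  qed
  have "stretched_node c i \<in> stretched_node c ` {..k}" if "i \<le> k" for i using that by simp
  from this[of 0] this[of k] show "phi k c 0 = 0" "phi k c 1 = 0"
    using phi_nodal stretched_node_end[OF c] unfolding nodal_def by auto
qed (use phi0_bounds in \<open>auto simp: phi_def\<close>)

lemma Dphi_0: "Dphi k c 0 = pos.mu * e powr (1 / p)"
proof -
  have "tau k c 0 = 0"
    using tau_between[of 0 0] k Q_e_pos[of 0] c_nonneg[of 0] stretched_node_Suc[of c 0]
    by (simp add: node_def)
  moreover have "phi0 0 = 0"
    using zeta_node(1)[of 0 0] Q_e_pos[of 0] rise_inv_vals by (simp add: node_def phi0_def)
  moreover have "0 < sin (pi * P / w)"
    using P_pos N_pos by (intro sin_gt_zero) (auto simp: pos_divide_less_eq)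
  ultimately show ?thesis
    using pos.A_0 by (simp add: Dphi_def D0_def angle_def sgn_if)
qed

lemma elev_Dphi_0: "0 < Dphi k c 0" "elev (Dphi k c 0) = e"
  unfolding Dphi_0 elev_def using pos.mu_pos e_adm pos.p_gt1 by (auto simp: powr_powr)

end

end

section \<open>Simplices are cubes\<close>

definition mass_simplex :: "nat set \<Rightarrow> real \<Rightarrow> (nat \<Rightarrow> real) set" where
  "mass_simplex K s = {c. (\<forall>i. 0 \<le> c i) \<and> (\<forall>i. i \<notin> K \<longrightarrow> c i = 0) \<and> (\<Sum>i\<in>K. c i) = s}"

definition max_coord :: "nat \<Rightarrow> (nat \<Rightarrow> real) \<Rightarrow> real" where
  "max_coord m y = Max (insert 0 (y ` {..<m}))"

definition coord_sum :: "nat \<Rightarrow> (nat \<Rightarrow> real) \<Rightarrow> real" where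
  "coord_sum m y = (\<Sum>j<m. y j)"

text \<open>
  The map that takes the cube, where \<open>max_coord \<le> 1\<close>, onto the part of the positive orthant with
  \<open>coord_sum \<le> 1\<close>: every ray is kept, and the image of \<open>y\<close> has the coordinate sum \<open>max_coord m y\<close>. At the
  origin the quotient is \<open>0 / 0 = 0\<close>.
\<close>
definition radial :: "nat \<Rightarrow> (nat \<Rightarrow> real) \<Rightarrow> nat \<Rightarrow> real" where
  "radial m y j = y j * (max_coord m y / coord_sum m y)"

lemma topspace_cube: "topspace (cube m) = PiE {..<m} (\<lambda>_. {0..1})"
  by (simp add: cube_def)

lemma compact_cube: "compact_space (cube m)"
  unfolding cube_def by (simp add: compact_space_product_topology compact_space_subtopology)

lemma cube_nonneg: "y \<in> topspace (cube m) \<Longrightarrow> j < m \<Longrightarrow> 0 \<le> y j"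
  and cube_le_1: "y \<in> topspace (cube m) \<Longrightarrow> j < m \<Longrightarrow> y j \<le> 1"
  by (auto simp: topspace_cube PiE_iff)

lemma max_coord_ge: "j < m \<Longrightarrow> y j \<le> max_coord m y"
  unfolding max_coord_def by (intro Max_ge) auto

lemma max_coord_nonneg: "0 \<le> max_coord m y"
  unfolding max_coord_def by (intro Max_ge) auto

lemma max_coord_eqI: "0 \<le> M \<Longrightarrow> (\<And>j. j < m \<Longrightarrow> y j \<le> M) \<Longrightarrow> M = 0 \<or> (\<exists>j<m. y j = M) \<Longrightarrow> max_coord m y = M"
  unfolding max_coord_def by (rule Max_eqI) auto

lemma max_coord_attained: "max_coord m y = 0 \<or> (\<exists>j<m. y j = max_coord m y)"
  using Max_in[of "insert 0 (y ` {..<m})"] by (force simp: max_coord_def)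

lemma max_coord_le_sum:
  assumes "\<And>j. j < m \<Longrightarrow> 0 \<le> y j"
  shows "max_coord m y \<le> coord_sum m y"
proof -
  have "y j \<le> coord_sum m y" if "j < m" for j
    unfolding coord_sum_def using assms that by (intro member_le_sum) auto
  moreover have "0 \<le> coord_sum m y" unfolding coord_sum_def using assms by (intro sum_nonneg) auto
  ultimately show ?thesis using max_coord_attained[of m y] by metis
qed

lemma sum_zero_iff_max_zero:
  assumes "\<And>j. j < m \<Longrightarrow> 0 \<le> y j"
  shows "coord_sum m y = 0 \<longleftrightarrow> max_coord m y = 0"
proof
  assume "max_coord m y = 0"
  then have "y j = 0" if "j < m" for j using max_coord_ge[OF that, of y] assms[OF that] by simp
  then show "coord_sum m y = 0" by (simp add: coord_sum_def)
next
  assume "coord_sum m y = 0"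
  then show "max_coord m y = 0" using max_coord_le_sum[of m y] assms max_coord_nonneg[of m y] by simp
qed

lemma radial_sum:
  assumes "y \<in> topspace (cube m)"
  shows "(\<Sum>j<m. radial m y j) = max_coord m y"
proof -
  have "(\<Sum>j<m. radial m y j) = coord_sum m y * (max_coord m y / coord_sum m y)"
    by (simp only: radial_def coord_sum_def sum_distrib_right)
  then show ?thesis using sum_zero_iff_max_zero[of m y] cube_nonneg[OF assms] by auto
qed

lemma radial_nonneg:
  assumes "y \<in> topspace (cube m)" "j < m"
  shows "0 \<le> radial m y j"
proof -
  have "0 \<le> coord_sum m y"
    unfolding coord_sum_def using cube_nonneg[OF assms(1)] by (intro sum_nonneg) auto
  then show ?thesis using cube_nonneg[OF assms] max_coord_nonneg[of m y] by (simp add: radial_def)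
qed

lemma max_coord_le_1: "y \<in> topspace (cube m) \<Longrightarrow> max_coord m y \<le> 1"
  using max_coord_attained[of m y] cube_le_1 by force

text \<open>
  The image determines \<open>max_coord y\<close>, which is its coordinate sum. It also determines the ray, and on a
  ray the value of \<open>max_coord\<close> fixes the point.
\<close>
lemma radial_inj:
  assumes y: "y \<in> topspace (cube m)" and z: "z \<in> topspace (cube m)"
    and eq: "\<And>j. j < m \<Longrightarrow> radial m y j = radial m z j"
  shows "y = z"
proof -
  have M: "max_coord m y = max_coord m z"
    using radial_sum[OF y] radial_sum[OF z] eq by simp
  have "y j = z j" if j: "j < m" for j
  proof (cases "max_coord m y = 0")
    case True
    then show ?thesis using max_coord_ge[OF j, of y] max_coord_ge[OF j, of z] cube_nonneg[OF y j] cube_nonneg[OF z j] M by simp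
  next
    case False
    have Mpos: "0 < max_coord m y" using False max_coord_nonneg[of m y] by simp
    have le: "coord_sum m b \<le> coord_sum m a"
      if a: "a \<in> topspace (cube m)" and b: "b \<in> topspace (cube m)"
        and eq: "\<And>j. j < m \<Longrightarrow> radial m a j = radial m b j"
        and M: "max_coord m a = max_coord m y" "max_coord m b = max_coord m y" for a b
    proof -
      have sa: "0 < coord_sum m a" and sb: "0 < coord_sum m b"
        using max_coord_le_sum[of m a] max_coord_le_sum[of m b] cube_nonneg[OF a] cube_nonneg[OF b] M Mpos
        by auto
      obtain j0 where j0: "j0 < m" "a j0 = max_coord m y"
        using max_coord_attained[of m a] M False by auto
      have "max_coord m y * (max_coord m y / coord_sum m a) = b j0 * (max_coord m y / coord_sum m b)"
        using eq[OF j0(1)] j0 M by (simp add: radial_def)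
      also have "\<dots> \<le> max_coord m y * (max_coord m y / coord_sum m b)"
        using max_coord_ge[OF j0(1), of b] M Mpos sb by (intro mult_right_mono) auto
      finally show ?thesis using Mpos sa sb by (simp add: field_simps)
    qed
    have "coord_sum m z \<le> coord_sum m y" by (rule le[OF y z]) (simp_all add: eq M)
    moreover have "coord_sum m y \<le> coord_sum m z" by (rule le[OF z y]) (simp_all add: eq M)
    ultimately have "coord_sum m y = coord_sum m z" by simp
    moreover have "0 < coord_sum m y"
      using max_coord_le_sum[of m y] cube_nonneg[OF y] Mpos by auto
    ultimately show ?thesis using eq[OF j] M False by (simp add: radial_def)
  qed
  then show ?thesis
    using y z unfolding topspace_cube by (intro PiE_ext) auto
qed

text \<open>
  The preimage of \<open>v\<close> is \<open>v\<close> rescaled so that its largest coordinate becomes the coordinate sum of \<open>v\<close>.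
\<close>
lemma radial_surj:
  assumes v: "\<And>j. j < m \<Longrightarrow> 0 \<le> v j" and s: "coord_sum m v \<le> 1"
  shows "\<exists>y\<in>topspace (cube m). \<forall>j<m. radial m y j = v j"
proof (cases "coord_sum m v = 0")
  case True
  then have "max_coord m v = 0" using sum_zero_iff_max_zero[of m v] v by simp
  then have "v j = 0" if "j < m" for j using max_coord_ge[OF that, of v] v[OF that] by simp
  then show ?thesis
    by (intro bexI[of _ "restrict (\<lambda>_. 0) {..<m}"]) (auto simp: radial_def topspace_cube)
next
  case False
  define S M where "S = coord_sum m v" and "M = max_coord m v"
  have M: "0 < M" using False sum_zero_iff_max_zero[of m v] v max_coord_nonneg[of m v] by (auto simp: M_def)
  have S: "0 < S" "S \<le> 1" using max_coord_le_sum[of m v] v M s by (auto simp: M_def S_def)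
  define y where "y = restrict (\<lambda>j. v j * (S / M)) {..<m}"
  have yj: "y j = v j * (S / M)" if "j < m" for j using that by (simp add: y_def)
  have le: "y j \<le> S" if "j < m" for j
    using max_coord_ge[OF that, of v] M S unfolding yj[OF that] by (simp add: field_simps flip: M_def)
  have mx: "max_coord m y = S"
  proof (rule max_coord_eqI)
    obtain j where "j < m" "v j = M" using max_coord_attained[of m v] M by (auto simp: M_def)
    then show "S = 0 \<or> (\<exists>j<m. y j = S)" using yj[of j] M by auto
  qed (use S le in auto)
  have sm: "coord_sum m y = S * (S / M)"
    unfolding coord_sum_def S_def sum_distrib_right by (rule sum.cong) (auto simp: yj S_def coord_sum_def)
  have "0 \<le> y j" if "j < m" for j
    using S v[OF that] M by (simp add: yj[OF that])
  moreover have "y j \<le> 1" if "j < m" for j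
    using le[OF that] S by linarith
  moreover have "y \<in> extensional {..<m}" by (simp add: y_def)
  ultimately have "y \<in> topspace (cube m)" by (simp add: topspace_cube PiE_iff)
  moreover have "radial m y j = v j" if "j < m" for j
    unfolding radial_def yj[OF that] mx sm using S M by simp
  ultimately show ?thesis by blast
qed

lemma cube_coord_cont: "j < m \<Longrightarrow> continuous_map (cube m) euclideanreal (\<lambda>y. y j)"
  unfolding cube_def
  using continuous_map_product_projection[of j "{..<m}" "\<lambda>_. top_of_set {0..1::real}"]
  by (auto simp: continuous_map_in_subtopology)

lemma max_coord_cont: "n \<le> m \<Longrightarrow> continuous_map (cube m) euclideanreal (max_coord n)"
proof (induction n)
  case 0
  then show ?case by (simp add: max_coord_def[abs_def])
next
  case (Suc n)
  have "max_coord (Suc n) y = max (max_coord n y) (y n)" for y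
  proof -
    have "insert 0 (y ` {..<Suc n}) = insert (y n) (insert 0 (y ` {..<n}))" by (auto simp: lessThan_Suc)
    then show ?thesis unfolding max_coord_def by (simp add: max.commute)
  qed
  then have "max_coord (Suc n) = (\<lambda>y. max (max_coord n y) (y n))" by auto
  then show ?case using Suc by (simp add: continuous_map_real_max cube_coord_cont)
qed

text \<open>
  Where the coordinate sum vanishes, the estimate \<open>radial m z j \<le> max_coord m z\<close> gives the limit.
\<close>
lemma radial_cont:
  assumes j: "j < m"
  shows "continuous_map (cube m) euclideanreal (\<lambda>y. radial m y j)"
proof -
  have lim: "((\<lambda>y. f y) \<longlongrightarrow> f y) (atin (cube m) y)"
    if "continuous_map (cube m) euclideanreal f" "y \<in> topspace (cube m)" for f :: "_ \<Rightarrow> real" and y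
    using that by (simp add: continuous_map_atin)
  have sumc: "continuous_map (cube m) euclideanreal (coord_sum m)"
    unfolding coord_sum_def[abs_def] by (intro continuous_map_sum) (auto intro: cube_coord_cont)
  have "((\<lambda>y. radial m y j) \<longlongrightarrow> radial m y j) (atin (cube m) y)" if y: "y \<in> topspace (cube m)" for y
  proof (cases "coord_sum m y = 0")
    case False
    then show ?thesis
      unfolding radial_def
      by (intro tendsto_mult tendsto_divide lim cube_coord_cont max_coord_cont sumc y j) auto
  next
    case True
    then have M0: "max_coord m y = 0" using sum_zero_iff_max_zero[of m y] cube_nonneg[OF y] by simp
    have "((\<lambda>z. radial m z j) \<longlongrightarrow> 0) (atin (cube m) y)"
    proof (rule Lim_null_comparison)
      show "(max_coord m \<longlongrightarrow> 0) (atin (cube m) y)"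
        using lim[OF max_coord_cont[OF order_refl] y] M0 by simp
      have "norm (radial m z j) \<le> max_coord m z" if z: "z \<in> topspace (cube m)" for z
        using radial_sum[OF z] radial_nonneg[OF z] j member_le_sum[of j "{..<m}" "radial m z"] by auto
      then show "\<forall>\<^sub>F z in atin (cube m) y. norm (radial m z j) \<le> max_coord m z"
        by (auto simp: eventually_atin)
    qed
    then show ?thesis using True by (simp add: radial_def)
  qed
  then show ?thesis by (simp add: continuous_map_atin)
qed

text \<open>
  The radial map gives all coordinates of a point of the simplex but one, and the last coordinate is what
  they leave of the total mass.
\<close>
lemma simplex_cube_parametrization:
  assumes K: "finite K" "card K = Suc m" and s: "0 < s"
  shows "\<exists>g. bij_betw g (topspace (cube m)) (mass_simplex K s) \<and> (\<forall>i. continuous_map (cube m) euclideanreal (\<lambda>y. g y i))"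
proof -
  obtain \<kappa> where \<kappa>: "bij_betw \<kappa> {..<Suc m} K"
    using ex_bij_betw_nat_finite[OF K(1)] K(2) by (auto simp: atLeast0LessThan)
  define idx where "idx = the_inv_into {..<Suc m} \<kappa>"
  have idx: "idx (\<kappa> j) = j" if "j < Suc m" for j
    unfolding idx_def using \<kappa> that by (intro the_inv_into_f_f) (auto simp: bij_betw_def)
  have \<kappa>': "inj_on \<kappa> {..<Suc m}" "\<kappa> ` {..<Suc m} = K" using \<kappa> by (auto simp: bij_betw_def)
  have idxK: "idx i < Suc m" "\<kappa> (idx i) = i" if "i \<in> K" for i
    using the_inv_into_into[OF \<kappa>'(1), of i "{..<Suc m}"] f_the_inv_into_f[OF \<kappa>'(1), of i] that \<kappa>'(2)
    unfolding idx_def by blast+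
  have \<kappa>K: "\<kappa> j \<in> K" if "j < Suc m" for j using \<kappa> that by (auto simp: bij_betw_def)
  define w where "w y j = (if j < m then radial m y j else 1 - max_coord m y)" for y j
  define g where "g y i = (if i \<in> K then s * w y (idx i) else 0)" for y i
  have sum_K: "(\<Sum>i\<in>K. f i) = (\<Sum>j<m. f (\<kappa> j)) + f (\<kappa> m)" for f :: "nat \<Rightarrow> real"
    using sum.reindex_bij_betw[OF \<kappa>, of f] by simp
  have w_nonneg: "0 \<le> w y j" if "y \<in> topspace (cube m)" "j < Suc m" for y j
    using that radial_nonneg[of y m j] max_coord_le_1[of y m] by (auto simp: w_def)
  have gK: "g y (\<kappa> j) = s * w y j" if "j < Suc m" for y j
    using that by (simp add: g_def idx \<kappa>K)
  have into: "g y \<in> mass_simplex K s" if y: "y \<in> topspace (cube m)" for y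
  proof -
    have "(\<Sum>i\<in>K. g y i) = s * (\<Sum>j<m. radial m y j) + s * (1 - max_coord m y)"
      unfolding sum_K by (simp add: gK w_def sum_distrib_left)
    also have "\<dots> = s" unfolding radial_sum[OF y] by (simp add: algebra_simps)
    finally show ?thesis using w_nonneg[OF y] idxK(1) s by (auto simp: mass_simplex_def g_def)
  qed
  have inj: "inj_on g (topspace (cube m))"
  proof (rule inj_onI)
    fix y z assume yz: "y \<in> topspace (cube m)" "z \<in> topspace (cube m)" "g y = g z"
    show "y = z"
    proof (rule radial_inj[OF yz(1,2)])
      fix j assume "j < m"
      then show "radial m y j = radial m z j"
        using gK[of j y] gK[of j z] yz(3) s by (simp add: w_def)
    qed
  qed
  have surj: "c \<in> g ` topspace (cube m)" if c: "c \<in> mass_simplex K s" for c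
  proof -
    define v where "v j = c (\<kappa> j) / s" for j
    have v: "0 \<le> v j" for j using c s by (simp add: v_def mass_simplex_def)
    have sum_v: "coord_sum m v + v m = 1"
      using c s sum_K[of c] by (simp add: mass_simplex_def coord_sum_def v_def add_divide_distrib[symmetric] flip: sum_divide_distrib)
    then obtain y where y: "y \<in> topspace (cube m)" "\<And>j. j < m \<Longrightarrow> radial m y j = v j"
      using radial_surj[of m v] v v[of m] by auto
    have "max_coord m y = coord_sum m v" using radial_sum[OF y(1)] y(2) by (simp add: coord_sum_def)
    then have wv: "w y j = v j" if "j < Suc m" for j
      using y(2) that sum_v by (cases "j = m") (auto simp: w_def)
    have "g y i = c i" for i
    proof (cases "i \<in> K")
      case True
      then show ?thesis using wv[OF idxK(1)[OF True]] idxK(2)[OF True] s by (simp add: g_def v_def)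
    next
      case False
      then show ?thesis using c by (simp add: g_def mass_simplex_def)
    qed
    then have "c = g y" by auto
    then show ?thesis using y by blast
  qed
  have "continuous_map (cube m) euclideanreal (\<lambda>y. g y i)" for i
  proof (cases "i \<in> K")
    case True
    have "continuous_map (cube m) euclideanreal (\<lambda>y. w y (idx i))"
      unfolding w_def using radial_cont[of "idx i" m] max_coord_cont[of m m]
      by (cases "idx i < m") (auto intro!: continuous_map_diff)
    then show ?thesis using True by (simp add: g_def continuous_map_real_mult_left)
  qed (simp add: g_def)
  then show ?thesis using into inj surj unfolding bij_betw_def by (intro exI[of _ g]) auto
qed

section \<open>Elements of \<open>C\<^sup>1([0,1])\<close>\<close>

lemma D01_eqI:
  assumes "x \<in> {0..1}" "(\<phi> has_real_derivative d) (at x within {0..1})"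
  shows "D01 \<phi> x = d"
  unfolding D01_def using assms
  by (intro vector_derivative_within_closed_interval) (auto simp: has_real_derivative_iff_has_vector_derivative)

lemma D01_works:
  assumes "\<phi> differentiable (at x within {0..1})" "x \<in> {0..1}"
  shows "(\<phi> has_real_derivative D01 \<phi> x) (at x within {0..1})"
proof -
  obtain d where "(\<phi> has_real_derivative d) (at x within {0..1})"
    using assms(1) by (auto simp: real_differentiable_def)
  then show ?thesis using D01_eqI[OF assms(2)] by simp
qed

lemma is_C1I:
  assumes "\<And>x. x \<in> {0..1} \<Longrightarrow> (\<phi> has_real_derivative D x) (at x within {0..1})" "continuous_on {0..1} D"
  shows "is_C1 \<phi>"
proof -
  have "continuous_on {0..1} (D01 \<phi>) \<longleftrightarrow> continuous_on {0..1} D"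
    by (rule continuous_on_cong[OF refl D01_eqI[OF _ assms(1)]])
  then show ?thesis using assms unfolding is_C1_def real_differentiable_def by blast
qed

lemma restrict_C1:
  assumes "\<And>x. x \<in> {0..1} \<Longrightarrow> (\<phi> has_real_derivative D x) (at x within {0..1})" "continuous_on {0..1} D"
  shows "restrict \<phi> {0..1} \<in> C1" "\<And>x. x \<in> {0..1} \<Longrightarrow> D01 (restrict \<phi> {0..1}) x = D x"
proof -
  have d: "(restrict \<phi> {0..1} has_real_derivative D x) (at x within {0..1})" if "x \<in> {0..1}" for x
    by (rule has_field_derivative_transform_within[OF assms(1)[OF that] zero_less_one that]) simp
  show "restrict \<phi> {0..1} \<in> C1" using is_C1I[OF d assms(2)] by (simp add: C1_def)
  show "D01 (restrict \<phi> {0..1}) x = D x" if "x \<in> {0..1}" for x by (rule D01_eqI[OF that d[OF that]])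
qed

lemma C1_dist_le:
  assumes "\<phi> \<in> C1" "\<psi> \<in> C1" "\<And>x. x \<in> {0..1} \<Longrightarrow> \<bar>\<phi> x - \<psi> x\<bar> \<le> a" "\<And>x. x \<in> {0..1} \<Longrightarrow> \<bar>D01 \<phi> x - D01 \<psi> x\<bar> \<le> b"
  shows "C1_dist \<phi> \<psi> \<le> a + b"
  using assms unfolding C1_dist_def by (auto intro!: add_mono cSUP_least)

lemma ode_derivs_closed:
  assumes p: "1 < p" and ode: "ode p lam h 0 1 \<phi> D" and h: "continuous_on UNIV h" and x: "x \<in> {0..1}"
  shows "(\<phi> has_real_derivative D x) (at x within {0..1})"
    "((\<lambda>y. spow p (D y)) has_real_derivative - (lam * h (\<phi> x))) (at x within {0..1})"
proof -
  show "(\<phi> has_real_derivative D x) (at x within {0..1})"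
    by (rule DERIV_off_finite_set[OF finite.emptyI odeD(1,2)[OF ode] _ x]) (use odeD(3)[OF ode] in auto)
  have 1: "continuous_on {0..1} (\<lambda>y. spow p (D y))"
    using p odeD(2)[OF ode] by (intro continuous_intros) auto
  have 2: "continuous_on {0..1} (\<lambda>y. - (lam * h (\<phi> y)))"
    using continuous_on_compose2[OF h odeD(1)[OF ode]] by (intro continuous_intros) auto
  show "((\<lambda>y. spow p (D y)) has_real_derivative - (lam * h (\<phi> x))) (at x within {0..1})"
    by (rule DERIV_off_finite_set[OF finite.emptyI 1 2 _ x]) (use odeD(4)[OF ode] in auto)
qed

section \<open>Continuous dependence on the cores\<close>

lemma abs_min_max_diff:
  fixes a b s t d :: real
  assumes "\<bar>a - b\<bar> \<le> d" "\<bar>s - t\<bar> \<le> d"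
  shows "\<bar>min a (max 0 s) - min b (max 0 t)\<bar> \<le> d"
  using assms by (auto simp: min_def max_def)

context wave
begin

text \<open>
  Changing the lengths of the cores moves their beginnings too; both effects are bounded by the sum of
  the changes.
\<close>
lemma tau_lipschitz: "\<bar>tau k c x - tau k d x\<bar> \<le> real k * (\<Sum>j<k. \<bar>c j - d j\<bar>)"
proof -
  let ?S = "\<Sum>j<k. \<bar>c j - d j\<bar>"
  let ?f = "\<lambda>c i. min (c i) (max 0 (x - stretched_node c i - Q e i))"
  have summand: "\<bar>?f c i - ?f d i\<bar> \<le> ?S" if "i < k" for i
  proof (rule abs_min_max_diff)
    show "\<bar>c i - d i\<bar> \<le> ?S"
      using that member_le_sum[of i "{..<k}" "\<lambda>j. \<bar>c j - d j\<bar>"] by simp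
    have "\<bar>shift c i - shift d i\<bar> \<le> (\<Sum>j<i. \<bar>c j - d j\<bar>)"
      unfolding shift_def sum_subtractf[symmetric] by (rule sum_abs)
    also have "\<dots> \<le> ?S" using that by (intro sum_mono2) auto
    finally show "\<bar>(x - stretched_node c i - Q e i) - (x - stretched_node d i - Q e i)\<bar> \<le> ?S"
      by (simp add: stretched_node_def abs_minus_commute)
  qed
  have eq: "tau k c x - tau k d x = - (\<Sum>i<k. ?f c i - ?f d i)"
    by (simp add: tau_def sum_subtractf)
  have "\<bar>tau k c x - tau k d x\<bar> \<le> (\<Sum>i<k. \<bar>?f c i - ?f d i\<bar>)"
    unfolding eq abs_minus_cancel by (rule sum_abs)
  also have "\<dots> \<le> real (card {..<k}) * ?S"
    by (rule sum_bounded_above) (rule summand, simp)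
  finally show ?thesis by simp
qed

lemma tau_range:
  assumes "c \<in> cores k" "x \<in> {0..1}"
  shows "tau k c x \<in> {-1..1}"
proof -
  let ?f = "\<lambda>i. min (c i) (max 0 (x - stretched_node c i - Q e i))"
  have c: "0 \<le> c i" for i using assms by (simp add: cores_def)
  have "0 \<le> (\<Sum>i<k. ?f i)" by (intro sum_nonneg) (use c in auto)
  moreover have "(\<Sum>i<k. ?f i) \<le> (\<Sum>i<k. c i)" by (rule sum_mono) auto
  moreover have "(\<Sum>i<k. c i) = 1 - T k e" using assms by (simp add: cores_def)
  moreover have "0 \<le> T k e" unfolding T_def using Q_e_pos by (intro sum_nonneg) (auto intro: less_imp_le)
  ultimately show ?thesis using assms by (simp add: tau_def)
qed

lemma phi_dependence:
  assumes "0 < \<epsilon>"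
  shows "\<exists>\<delta>>0. \<forall>c\<in>cores k. \<forall>d\<in>cores k. (\<Sum>j<k. \<bar>c j - d j\<bar>) < \<delta> \<longrightarrow>
     (\<forall>x\<in>{0..1}. \<bar>phi k c x - phi k d x\<bar> < \<epsilon> \<and> \<bar>Dphi k c x - Dphi k d x\<bar> < \<epsilon>)"
proof -
  have uc1: "uniformly_continuous_on {-1..1} phi0" and uc2: "uniformly_continuous_on {-1..1} D0"
    by (auto intro!: compact_uniformly_continuous phi0_cont D0_cont)
  obtain \<eta>1 where \<eta>1: "\<eta>1 > 0"
    "\<forall>s\<in>{-1..1}. \<forall>t\<in>{-1..1}. dist t s < \<eta>1 \<longrightarrow> dist (phi0 t) (phi0 s) < \<epsilon>"
    using uc1 assms unfolding uniformly_continuous_on_def by blast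
  obtain \<eta>2 where \<eta>2: "\<eta>2 > 0"
    "\<forall>s\<in>{-1..1}. \<forall>t\<in>{-1..1}. dist t s < \<eta>2 \<longrightarrow> dist (D0 t) (D0 s) < \<epsilon>"
    using uc2 assms unfolding uniformly_continuous_on_def by blast
  \<comment> \<open>The clocks differ by at most \<open>k * \<delta>\<close>; \<open>k + 1\<close> makes the inequality strict.\<close>
  define \<delta> where "\<delta> = min \<eta>1 \<eta>2 / (real k + 1)"
  have \<delta>: "0 < \<delta>" using \<eta>1 \<eta>2 by (simp add: \<delta>_def)
  have "\<bar>phi k c x - phi k d x\<bar> < \<epsilon> \<and> \<bar>Dphi k c x - Dphi k d x\<bar> < \<epsilon>"
    if c: "c \<in> cores k" and d: "d \<in> cores k" and s: "(\<Sum>j<k. \<bar>c j - d j\<bar>) < \<delta>" and x: "x \<in> {0..1}" for c d x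
  proof -
    have "\<bar>tau k c x - tau k d x\<bar> \<le> real k * (\<Sum>j<k. \<bar>c j - d j\<bar>)" by (rule tau_lipschitz)
    also have "\<dots> \<le> real k * \<delta>" using s by (intro mult_left_mono) auto
    also have "\<dots> < (real k + 1) * \<delta>" using \<delta> by simp
    also have "\<dots> = min \<eta>1 \<eta>2" by (simp add: \<delta>_def)
    finally show ?thesis
      using \<eta>1(2)[rule_format, OF tau_range[OF d x] tau_range[OF c x]]
        \<eta>2(2)[rule_format, OF tau_range[OF d x] tau_range[OF c x]] by (simp add: phi_def Dphi_def dist_real_def)
  qed
  then show ?thesis using \<delta> by blast
qed

definition profile :: "nat \<Rightarrow> (nat \<Rightarrow> real) \<Rightarrow> real \<Rightarrow> real" where
  "profile k c = restrict (phi k c) {0..1}"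

lemma profile_C1:
  assumes "c \<in> cores k" "1 \<le> k"
  shows "profile k c \<in> C1" "\<And>x. x \<in> {0..1} \<Longrightarrow> D01 (profile k c) x = Dphi k c x"
  unfolding profile_def using restrict_C1[OF phi_derivs(1)[OF assms] Dphi_cont] assms by blast+

lemma strict_mono_on_same_image:
  fixes X Y :: "nat \<Rightarrow> real"
  assumes "strict_mono_on {..k} X" "strict_mono_on {..k} Y" "X ` {..k} = Y ` {..k}" "i \<le> k"
  shows "X i = Y i"
proof -
  have sorted: "sorted_wrt (<) (map X [0..<Suc k])" if "strict_mono_on {..k} X" for X :: "nat \<Rightarrow> real"
    unfolding sorted_wrt_map
    by (rule sorted_wrt_mono_rel[OF _ sorted_wrt_upt]) (auto intro: strict_mono_onD[OF that])
  have set: "set (map X [0..<Suc k]) = X ` {..k}" for X :: "nat \<Rightarrow> real"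
    by (simp only: set_map set_upt atLeast0LessThan lessThan_Suc_atMost)
  have "map X [0..<Suc k] = map Y [0..<Suc k]"
    by (rule strict_sorted_equal[OF sorted[OF assms(2)] sorted[OF assms(1)]]) (simp only: set assms(3))
  then show ?thesis using assms(4) by (metis atLeastLessThan_iff le0 le_imp_less_Suc map_eq_conv set_upt)
qed

text \<open>
  A profile determines its zeros, and the gaps between the zeros determine the cores.
\<close>
lemma profile_inj:
  assumes "1 \<le> k"
  shows "inj_on (profile k) (cores k)"
proof (rule inj_onI)
  fix c d assume c: "c \<in> cores k" and d: "d \<in> cores k" and eq: "profile k c = profile k d"
  have zeros: "phi k c x = 0 \<longleftrightarrow> x \<in> stretched_node c ` {..k}" if "c \<in> cores k" "x \<in> {0..1}" for c x
    using phi_nodal[OF that(1) assms] that(2) unfolding nodal_def by blast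
  have "x \<in> stretched_node c ` {..k} \<longleftrightarrow> x \<in> stretched_node d ` {..k}" if "x \<in> {0..1}" for x
    using fun_cong[OF eq, of x] zeros[OF c that] zeros[OF d that] that by (simp add: profile_def)
  then have "stretched_node c ` {..k} \<inter> {0..1} = stretched_node d ` {..k} \<inter> {0..1}"
    by (intro set_eqI) (simp only: Int_iff conj_commute cong: conj_cong)
  moreover have "stretched_node c ` {..k} \<subseteq> {0..1}" if "c \<in> cores k" for c
  proof (rule image_subsetI)
    fix i assume "i \<in> {..k}"
    then show "stretched_node c i \<in> {0..1}"
      using strict_mono_less_eq[OF stretched_node_strict_mono[OF that assms], of 0 i]
        strict_mono_less_eq[OF stretched_node_strict_mono[OF that assms], of i k] stretched_node_end[OF that]
      by simp
  qed
  ultimately have img: "stretched_node c ` {..k} = stretched_node d ` {..k}"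
    using c d by (simp add: Int_absorb2)
  have nodes: "stretched_node c i = stretched_node d i" if "i \<le> k" for i
    using phi_nodal[OF c assms] phi_nodal[OF d assms] img that
    unfolding nodal_def by (intro strict_mono_on_same_image[of k]) auto
  show "c = d"
  proof
    fix i
    show "c i = d i"
    proof (cases "i < k")
      case True
      then show ?thesis using nodes[of i] nodes[of "Suc i"] by (simp add: stretched_node_Suc)
    next
      case False
      then have "c i = 0" "d i = 0" using c d unfolding cores_def by blast+
      then show ?thesis by simp
    qed
  qed
qed

lemma profile_cont:
  assumes k: "1 \<le> k" and g: "\<And>y. y \<in> topspace X \<Longrightarrow> g y \<in> cores k"
    and cont: "\<And>i. continuous_map X euclideanreal (\<lambda>y. g y i)"
  shows "continuous_map X C1_topology (\<lambda>y. profile k (g y))"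
proof -
  interpret M: Metric_space C1 C1_dist by (rule Metric_space_C1)
  have "limitin C1_topology (\<lambda>y. profile k (g y)) (profile k (g y0)) (atin X y0)" if y0: "y0 \<in> topspace X" for y0
    unfolding C1_topology_def M.limitin_metric
  proof (intro conjI allI impI)
    show "profile k (g y0) \<in> C1" by (rule profile_C1[OF g[OF y0] k])
    fix \<epsilon> :: real assume \<epsilon>: "0 < \<epsilon>"
    obtain \<delta> where \<delta>: "\<delta> > 0"
      "\<And>c d x. c \<in> cores k \<Longrightarrow> d \<in> cores k \<Longrightarrow> (\<Sum>j<k. \<bar>c j - d j\<bar>) < \<delta> \<Longrightarrow> x \<in> {0..1} \<Longrightarrow>
        \<bar>phi k c x - phi k d x\<bar> < \<epsilon> / 3 \<and> \<bar>Dphi k c x - Dphi k d x\<bar> < \<epsilon> / 3"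
      using phi_dependence[of "\<epsilon> / 3" k] \<epsilon> by force
    have "((\<lambda>y. \<Sum>j<k. \<bar>g y j - g y0 j\<bar>) \<longlongrightarrow> (\<Sum>j<k. \<bar>g y0 j - g y0 j\<bar>)) (atin X y0)"
      using cont y0 by (intro tendsto_intros) (simp add: continuous_map_atin)
    then have "\<forall>\<^sub>F y in atin X y0. (\<Sum>j<k. \<bar>g y j - g y0 j\<bar>) < \<delta>"
      using \<delta>(1) by (intro order_tendstoD(2)) auto
    moreover have "\<forall>\<^sub>F y in atin X y0. y \<in> topspace X" by (auto simp: eventually_atin)
    ultimately show "\<forall>\<^sub>F y in atin X y0. profile k (g y) \<in> C1 \<and> C1_dist (profile k (g y)) (profile k (g y0)) < \<epsilon>"
    proof eventually_elim
      case (elim y)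
      note cs = g[OF elim(2)] g[OF y0]
      have "C1_dist (profile k (g y)) (profile k (g y0)) \<le> \<epsilon> / 3 + \<epsilon> / 3"
      proof (rule C1_dist_le)
        fix x :: real assume x: "x \<in> {0..1}"
        show "\<bar>profile k (g y) x - profile k (g y0) x\<bar> \<le> \<epsilon> / 3"
          using \<delta>(2)[OF cs elim(1) x] x by (simp add: profile_def)
        show "\<bar>D01 (profile k (g y)) x - D01 (profile k (g y0)) x\<bar> \<le> \<epsilon> / 3"
          using \<delta>(2)[OF cs elim(1) x] profile_C1(2)[OF cs(1) k x] profile_C1(2)[OF cs(2) k x] by simp
      qed (use profile_C1 cs k in auto)
      then show ?case using \<epsilon> profile_C1(1)[OF cs(1) k] by simp
    qed
  qed
  then show ?thesis by (simp add: continuous_map_atin)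
qed

lemma profiles_homeomorphic_cube:
  assumes k: "1 \<le> k" and e: "e = estar" and T: "T k e < 1" and m: "card {i. i < k \<and> coreable i} = Suc m"
  shows "subtopology C1_topology (profile k ` cores k) homeomorphic_space cube m"
proof -
  interpret M: Metric_space C1 C1_dist by (rule Metric_space_C1)
  let ?K = "{i. i < k \<and> coreable i}"
  have cores: "cores k = mass_simplex ?K (1 - T k e)"
  proof -
    have sums: "(\<Sum>i<k. c i) = (\<Sum>i\<in>?K. c i)" if "\<forall>i. i \<notin> ?K \<longrightarrow> c i = 0" for c :: "nat \<Rightarrow> real"
      using that by (intro sum.mono_neutral_right) auto
    have supp: "(\<forall>i. c i \<noteq> 0 \<longrightarrow> i < k \<and> e = estar \<and> coreable i) \<longleftrightarrow> (\<forall>i. i \<notin> ?K \<longrightarrow> c i = 0)"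
      for c :: "nat \<Rightarrow> real" using e by blast
    have "c \<in> cores k \<longleftrightarrow> c \<in> mass_simplex ?K (1 - T k e)" for c
    proof (cases "\<forall>i. i \<notin> ?K \<longrightarrow> c i = 0")
      case True
      show ?thesis by (simp only: cores_def mass_simplex_def mem_Collect_eq supp sums[OF True])
    next
      case False
      then show ?thesis by (simp only: cores_def mass_simplex_def mem_Collect_eq supp simp_thms)
    qed
    then show ?thesis by blast
  qed
  obtain g where g: "bij_betw g (topspace (cube m)) (cores k)"
    "\<And>i. continuous_map (cube m) euclideanreal (\<lambda>y. g y i)"
    using simplex_cube_parametrization[of ?K m "1 - T k e"] m T unfolding cores by auto
  let ?F = "\<lambda>y. profile k (g y)" and ?Y = "subtopology C1_topology (profile k ` cores k)"
  have img: "?F ` topspace (cube m) = profile k ` cores k"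
    using g(1) by (simp add: bij_betw_def image_image[of "profile k" g, symmetric])
  have sub: "profile k ` cores k \<subseteq> C1" using profile_C1(1) k by auto
  have top: "topspace ?Y = profile k ` cores k"
    using sub by (auto simp: C1_topology_def)
  have "homeomorphic_map (cube m) ?Y ?F"
  proof (rule continuous_imp_homeomorphic_map[OF _ compact_cube])
    have gc: "g y \<in> cores k" if "y \<in> topspace (cube m)" for y using g(1) that by (auto simp: bij_betw_def)
    have "continuous_map (cube m) C1_topology ?F"
      by (rule profile_cont[OF k _ g(2)]) (rule gc)
    then show "continuous_map (cube m) ?Y ?F" using img by (auto simp: continuous_map_in_subtopology)
    show "Hausdorff_space ?Y"
      unfolding C1_topology_def by (intro Hausdorff_space_subtopology M.Hausdorff_space_mtopology)
    show "?F ` topspace (cube m) = topspace ?Y" using img top by simp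
    show "inj_on ?F (topspace (cube m))"
      using comp_inj_on[of g _ "profile k"] g(1) profile_inj[OF k] by (auto simp: bij_betw_def comp_def)
  qed
  then show ?thesis
    using homeomorphic_map_imp_homeomorphic_space homeomorphic_space_sym by blast
qed

end

section \<open>Solutions with a prescribed number of nodal intervals\<close>

context well
begin

text \<open>
  The solutions with \<open>k\<close> nodal intervals of which the first is positive.
\<close>
definition up_solutions :: "nat \<Rightarrow> (real \<Rightarrow> real) set" where
  "up_solutions k = {\<phi> \<in> C1. bvp \<phi> (D01 \<phi>) \<and> 0 < D01 \<phi> 0 \<and> (\<exists>X. nodal k X \<phi>)}"

lemma bvp_nodal_exists:
  assumes "bvp \<phi> D" "D 0 \<noteq> 0"
  shows "\<exists>k\<ge>1. \<exists>X. nodal k X \<phi> \<and> card {x \<in> {0..1}. \<phi> x = 0} = k + 1"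
proof -
  let ?Z = "{x \<in> {0..1}. \<phi> x = 0}"
  have Z: "finite ?Z" "0 \<in> ?Z" "1 \<in> ?Z" "?Z \<subseteq> {0..1}"
    using bvp_finite_zeros[OF assms] assms(1) by (auto simp: bvp_def)
  obtain k X where X: "1 \<le> k" "card ?Z = k + 1" "strict_mono_on {..k} X" "X 0 = 0" "X k = 1" "X ` {..k} = ?Z"
    by (rule finite_set_enumeration[OF Z])
  then have "nodal k X \<phi>" unfolding nodal_def by auto
  then show ?thesis using X by blast
qed

lemma nodal_card:
  assumes "nodal k X \<phi>"
  shows "finite {x \<in> {0..1}. \<phi> x = 0}" "card {x \<in> {0..1}. \<phi> x = 0} = k + 1"
proof -
  have m: "strict_mono_on {..k} X" and X: "X 0 = 0" "X k = 1"
    and z: "\<forall>x\<in>{0..1}. \<phi> x = 0 \<longleftrightarrow> x \<in> X ` {..k}"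
    using assms by (auto simp: nodal_def)
  have "X i \<le> X j" if "i \<le> j" "j \<le> k" for i j
    using strict_mono_onD[OF m, of i j] that by (cases "i = j") auto
  from this[of 0] this[of _ k] have "X ` {..k} \<subseteq> {0..1}" using X by auto
  then have eq: "{x \<in> {0..1}. \<phi> x = 0} = X ` {..k}" using z by blast
  show "finite {x \<in> {0..1}. \<phi> x = 0}" unfolding eq by simp
  show "card {x \<in> {0..1}. \<phi> x = 0} = k + 1"
    unfolding eq using strict_mono_on_imp_inj_on[OF m] by (simp add: card_image)
qed

lemma nodal_iff_simple_zeros:
  assumes b: "bvp \<phi> (D01 \<phi>)" and D: "D01 \<phi> 0 \<noteq> 0" and k: "1 \<le> k"
  shows "(\<exists>X. nodal k X \<phi>) \<longleftrightarrow> simple_zeros (k - 1) \<phi>"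
proof -
  let ?Z = "{x \<in> {0..1}. \<phi> x = 0}" and ?Z' = "{x \<in> {0<..<1}. \<phi> x = 0}"
  have fin: "finite ?Z" by (rule bvp_finite_zeros[OF b D])
  have Z: "?Z = insert 0 (insert 1 ?Z')" using b by (auto simp: bvp_def)
  have fin': "finite ?Z'" by (rule finite_subset[OF _ fin]) auto
  have card: "card ?Z = card ?Z' + 2" unfolding Z using fin' by (subst card_insert_disjoint; simp)
  have simple: "D01 \<phi> x \<noteq> 0" if "x \<in> {0<..<1}" "\<phi> x = 0" for x
    using bvp_slope_at_zero[OF b, of x] that D by auto
  obtain l X where l: "1 \<le> l" "nodal l X \<phi>" "card ?Z = l + 1" using bvp_nodal_exists[OF b D] by blast
  show ?thesis
  proof
    assume "\<exists>X. nodal k X \<phi>"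
    then have "card ?Z = k + 1" using nodal_card by blast
    then show "simple_zeros (k - 1) \<phi>" using fin' card simple k by (simp add: simple_zeros_def)
  next
    assume "simple_zeros (k - 1) \<phi>"
    then have "l = k" using l card k by (simp add: simple_zeros_def)
    then show "\<exists>X. nodal k X \<phi>" using l by blast
  qed
qed

text \<open>
  The solution and the profile with the same level and with the cores read off from the gaps between
  the zeros have the same nodal intervals, and \<open>arcs_unique\<close> identifies them.
\<close>
lemma up_solutions_is_profile:
  assumes k: "1 \<le> k" "k = 1 \<longrightarrow> A zp \<le> A zm" and \<phi>: "\<phi> \<in> up_solutions k"
  shows "\<exists>e c. adml e \<and> c \<in> wave.cores p lam A zp zm e k \<and> \<phi> = wave.profile p lam A zp zm e k c"
proof -
  obtain X where C1: "\<phi> \<in> C1" and b: "bvp \<phi> (D01 \<phi>)" and D: "0 < D01 \<phi> 0" and X: "nodal k X \<phi>"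
    using \<phi> by (auto simp: up_solutions_def)
  define e where "e = elev (D01 \<phi> 0)"
  have arcs: "arc \<phi> e i (X i) (X (Suc i))" if "i < k" for i
    using bvp_arcs[OF b D X, of i] that by (simp add: e_def)
  note lev = arcs_level[OF k, of \<phi> e X, OF arcs]
  interpret w: wave p lam h A zp zm e by unfold_locales (rule lev(1))
  define c where "c i = (if i < k then X (Suc i) - X i - 2 * Q e i else 0)" for i
  have X0: "X 0 = 0" "X k = 1" using X by (auto simp: nodal_def)
  have "(\<Sum>i<k. c i) = (\<Sum>i<k. X (Suc i) - X i - 2 * Q e i)" by (rule sum.cong) (auto simp: c_def)
  then have c: "c \<in> w.cores k"
    using lev(2-4) X0 unfolding w.cores_def by (auto simp: c_def)
  have nodes: "i \<le> k \<Longrightarrow> w.stretched_node c i = X i" for i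
    by (induction i) (simp_all add: X0 w.stretched_node_Suc c_def)
  have arcs': "arc (w.phi k c) e i (X i) (X (Suc i))" if "i < k" for i
    using bvp_arcs[OF w.phi_bvp[OF c k(1)] w.elev_Dphi_0(1)[OF c k(1)] w.phi_nodal[OF c k(1)], of i]
      w.elev_Dphi_0(2)[OF c k(1)] nodes[of i] nodes[of "Suc i"] that by simp
  have "\<phi> x = w.phi k c x" if "x \<in> {0..1}" for x
    by (rule arcs_unique[OF k(1) X0 arcs arcs' that])
  moreover have "\<phi> x = undefined" if "x \<notin> {0..1}" for x
    using C1 that by (auto simp: C1_def extensional_def)
  ultimately have "\<phi> = w.profile k c" unfolding w.profile_def by (auto simp: restrict_def)
  then show ?thesis using lev(1) c by blast
qed

lemma profile_in_up_solutions:
  assumes k: "1 \<le> k" and e: "adml e" and c: "c \<in> wave.cores p lam A zp zm e k"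
  shows "wave.profile p lam A zp zm e k c \<in> up_solutions k"
proof -
  interpret w: wave p lam h A zp zm e by unfold_locales (rule e)
  let ?f = "w.profile k c"
  have eq: "?f x = w.phi k c x" "D01 ?f x = w.Dphi k c x" if "x \<in> {0..1}" for x
    using w.profile_C1(2)[OF c k that] that by (auto simp: w.profile_def)
  have "bvp ?f (D01 ?f)"
  proof -
    have der: "(?f has_real_derivative D01 ?f x) (at x)"
      "((\<lambda>y. spow p (D01 ?f y)) has_real_derivative - (lam * h (?f x))) (at x)" if x: "0 < x" "x < 1" for x
    proof -
      have x01: "x \<in> {0..1}" using x by simp
      note o = odeD(3,4)[OF w.phi_bvp[OF c k, unfolded bvp_def, THEN conjunct1] x]
      show "(?f has_real_derivative D01 ?f x) (at x)"
        unfolding eq[OF x01]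
        by (rule has_field_derivative_transform_within_open[OF o(1), of "{0<..<1}"]) (use x eq in auto)
      show "((\<lambda>y. spow p (D01 ?f y)) has_real_derivative - (lam * h (?f x))) (at x)"
        unfolding eq[OF x01]
        by (rule has_field_derivative_transform_within_open[OF o(2), of "{0<..<1}"]) (use x eq in auto)
    qed
    have "ode p lam h 0 1 ?f (D01 ?f)"
      unfolding ode_def using der continuous_on_C1[OF w.profile_C1(1)[OF c k]] by blast
    moreover have "?f 0 = 0" "?f 1 = 0" "\<forall>x\<in>{0..1}. zm \<le> ?f x \<and> ?f x \<le> zp"
      using w.phi_bvp[OF c k] eq by (auto simp: bvp_def)
    ultimately show ?thesis by (simp add: bvp_def)
  qed
  moreover have "nodal k (w.stretched_node c) ?f"
    using w.phi_nodal[OF c k] eq unfolding nodal_def by auto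
  moreover have "0 < D01 ?f 0" using w.elev_Dphi_0(1)[OF c k] eq(2)[of 0] by simp
  ultimately show ?thesis unfolding up_solutions_def using w.profile_C1(1)[OF c k] by blast
qed

text \<open>
  Below \<open>estar\<close> there are no cores, so the bumps alone fill the unit interval.
\<close>
lemma cores_level:
  assumes e: "adml e" and c: "c \<in> wave.cores p lam A zp zm e k"
  shows "T k e \<le> 1" "e \<noteq> estar \<Longrightarrow> T k e = 1" "T k e = 1 \<Longrightarrow> c = (\<lambda>_. 0)"
proof -
  interpret w: wave p lam h A zp zm e by unfold_locales (rule e)
  have nn: "0 \<le> c i" and supp: "c i \<noteq> 0 \<Longrightarrow> i < k \<and> e = estar" and sum: "(\<Sum>i<k. c i) = 1 - T k e" for i
    using c by (auto simp: w.cores_def)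
  show "T k e \<le> 1" using sum sum_nonneg[of "{..<k}" c] nn by simp
  show "T k e = 1" if "e \<noteq> estar"
  proof -
    have "c i = 0" for i using supp that by blast
    then show ?thesis using sum by simp
  qed
  show "c = (\<lambda>_. 0)" if "T k e = 1"
  proof
    fix i
    have "\<forall>j\<in>{..<k}. c j = 0" using sum that nn by (subst (asm) eq_commute) (simp add: sum_nonneg_eq_0_iff)
    then show "c i = 0" using supp[of i] by auto
  qed
qed

lemma up_solutions_empty:
  assumes k: "1 \<le> k" "k = 1 \<longrightarrow> A zp \<le> A zm" and "1 \<le> 2 * real k * (pos.I0 / pos.mu)"
  shows "up_solutions k = {}"
proof (rule ccontr)
  assume "up_solutions k \<noteq> {}"
  then obtain e c where "adml e" "c \<in> wave.cores p lam A zp zm e k" using up_solutions_is_profile[OF k] by blast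
  then have "T k e \<le> 1" "2 * real k * (pos.I0 / pos.mu) < T k e" using cores_level(1) T_gt[OF k(1)] by auto
  then show False using assms by simp
qed

text \<open>
  If \<open>T k estar \<ge> 1\<close>, there is no time for cores at the level \<open>estar\<close> and none are possible below it, so
  \<open>T k e = 1\<close>; by strict monotonicity this has one solution \<open>e\<close>.
\<close>
lemma up_solutions_singleton:
  assumes k: "1 \<le> k" "k = 1 \<longrightarrow> A zp \<le> A zm" and small: "2 * real k * (pos.I0 / pos.mu) < 1"
    and large: "p \<le> 2 \<or> 1 \<le> T k estar"
  shows "\<exists>\<phi>. up_solutions k = {\<phi>}"
proof -
  obtain e0 where e0: "adml e0" "T k e0 = 1" using T_level_exists[OF k small large] by blast
  interpret w: wave p lam h A zp zm e0 by unfold_locales (rule e0)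
  have c0: "(\<lambda>_. 0) \<in> w.cores k" using e0 by (simp add: w.cores_def)
  have "\<phi> = w.profile k (\<lambda>_. 0)" if mem: "\<phi> \<in> up_solutions k" for \<phi>
  proof -
    obtain e c where e: "adml e" and c: "c \<in> wave.cores p lam A zp zm e k"
      and \<phi>: "\<phi> = wave.profile p lam A zp zm e k c"
      using up_solutions_is_profile[OF k mem] by blast
    have T1: "T k e = 1"
    proof (cases "e = estar")
      case True
      then have "1 \<le> T k e" using large e by (auto simp: adml_iff)
      then show ?thesis using cores_level(1)[OF e c] by simp
    next
      case False
      then show ?thesis by (rule cores_level(2)[OF e c])
    qed
    have "e = e0"
      using T_less[OF k(1), of e e0] T_less[OF k(1), of e0 e] e e0 T1
      by (cases e e0 rule: linorder_cases) (auto simp: adml_iff)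
    then show ?thesis using \<phi> cores_level(3)[OF e c T1] by simp
  qed
  then have "up_solutions k = {w.profile k (\<lambda>_. 0)}" using profile_in_up_solutions[OF k(1) e0(1) c0] by blast
  then show ?thesis by blast
qed

text \<open>
  A level below \<open>estar\<close> would have \<open>T k e = 1 > T k estar\<close>, against monotonicity.
\<close>
lemma up_solutions_homeomorphic_cube:
  assumes k: "1 \<le> k" "k = 1 \<longrightarrow> A zp \<le> A zm" and p: "2 < p" and T: "T k estar < 1"
    and m: "card {i. i < k \<and> coreable i} = Suc m"
  shows "subtopology C1_topology (up_solutions k) homeomorphic_space cube m"
proof -
  have es: "adml estar" using p estar_pos by (simp add: adml_iff)
  interpret w: wave p lam h A zp zm estar by unfold_locales (rule es)
  have "up_solutions k = w.profile k ` w.cores k"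
  proof (intro equalityI subsetI)
    fix \<phi> assume "\<phi> \<in> up_solutions k"
    then obtain e c where e: "adml e" and c: "c \<in> wave.cores p lam A zp zm e k"
      and \<phi>: "\<phi> = wave.profile p lam A zp zm e k c"
      using up_solutions_is_profile[OF k] by blast
    have "e = estar"
    proof (rule ccontr)
      assume ne: "e \<noteq> estar"
      then have "T k e < T k estar" using e es by (intro T_less[OF k(1)]) (auto simp: adml_iff)
      then show False using cores_level(2)[OF e c ne] T by simp
    qed
    then show "\<phi> \<in> w.profile k ` w.cores k" using \<phi> c by blast
  qed (use profile_in_up_solutions[OF k(1) es] in blast)
  then show ?thesis using w.profiles_homeomorphic_cube[OF k(1) refl T m] by simp
qed

lemma coreable_card:
  assumes "1 \<le> k"
  shows "card {i. i < k \<and> coreable i} =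
    (if A zp = A zm then k else if A zp < A zm then (k + 1) div 2 else k div 2)"
proof -
  have ev: "card {i. i < k \<and> even i} = (k + 1) div 2"
  proof (induction k)
    case (Suc k)
    have "{i. i < Suc k \<and> even i} = (if even k then insert k {i. i < k \<and> even i} else {i. i < k \<and> even i})"
      by (auto simp: less_Suc_eq)
    then show ?case using Suc by (auto elim!: evenE oddE)
  qed simp
  have od: "card {i. i < k \<and> odd i} = k div 2"
  proof (induction k)
    case (Suc k)
    have "{i. i < Suc k \<and> odd i} = (if odd k then insert k {i. i < k \<and> odd i} else {i. i < k \<and> odd i})"
      by (auto simp: less_Suc_eq)
    then show ?case using Suc by (auto elim!: evenE oddE)
  qed simp
  consider "A zp = A zm" | "A zp < A zm" | "A zm < A zp" by linarith
  then show ?thesis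
  proof cases
    case 1
    then have "{i. i < k \<and> coreable i} = {..<k}" by (auto simp: coreable_def estar_def)
    then show ?thesis using 1 by simp
  next
    case 2
    then have "{i. i < k \<and> coreable i} = {i. i < k \<and> even i}" by (auto simp: coreable_def estar_def)
    then show ?thesis using 2 ev by simp
  next
    case 3
    then have "{i. i < k \<and> coreable i} = {i. i < k \<and> odd i}" by (auto simp: coreable_def estar_def)
    then show ?thesis using 3 od by simp
  qed
qed

lemma T_eq: "T k e = 2 * real ((k + 1) div 2) * pos.quarter e + 2 * real (k div 2) * neg.quarter e"
proof (induction k)
  case (Suc k)
  have "T (Suc k) e = T k e + 2 * Q e k" by (simp add: T_def)
  then show ?case using Suc by (cases "even k") (auto simp: Q_def algebra_simps elim!: evenE oddE)
qed (simp add: T_def)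

end

section \<open>The standing hypotheses give a potential well\<close>

lemma Fprim_deriv:
  assumes "continuous_on UNIV f"
  shows "(Fprim f has_real_derivative f s) (at s)"
proof -
  define a b where "a = min 0 s - 1" and "b = max 0 s + 1"
  have ab: "a < 0" "a < s" "0 < b" "s < b" by (auto simp: a_def b_def)
  have "((\<lambda>u. LBINT y=ereal 0..ereal u. f y) has_vector_derivative f s) (at s within {a..b})"
    by (rule interval_integral_FTC2) (use ab in \<open>auto intro: continuous_on_subset[OF assms]\<close>)
  then have "(Fprim f has_vector_derivative f s) (at s)"
    using ab by (simp add: Fprim_def[abs_def] at_within_Icc_at)
  then show ?thesis by (simp add: has_real_derivative_iff_has_vector_derivative)
qed

lemma Apot_deriv:
  assumes "1 < p" "continuous_on UNIV f"
  shows "(Apot p f has_real_derivative spow p s - f s) (at s)"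
proof -
  have "((\<lambda>s. \<bar>s\<bar> powr p / p - Fprim f s) has_real_derivative p * spow p s / p - f s) (at s)"
    by (intro DERIV_diff DERIV_cdivide DERIV_abs_powr Fprim_deriv assms)
  then show ?thesis using assms by (simp add: Apot_def[abs_def])
qed

lemma Apot_0: "Apot p f 0 = 0"
  by (simp add: Apot_def Fprim_def zero_ereal_def[symmetric])

text \<open>
  Positivity of \<open>h\<close> on \<open>(0, zp)\<close> holds because \<open>h s / s^(p-1)\<close> decreases strictly to its value \<open>0\<close> at
  \<open>zp\<close>. The two-sided linear bound near \<open>zp\<close> combines the limit \<open>L\<close>, which compares \<open>h s\<close> with
  \<open>spow p zp - spow p s\<close>, and the mean value theorem, which compares the latter with \<open>zp - s\<close>.
\<close>
lemma standing_half_well: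
  assumes st: "standing p p f zm zp" and lam: "0 < lam"
  shows "half_well p lam (\<lambda>s. spow p s - f s) (Apot p f) zp"
proof
  let ?h = "\<lambda>s. spow p s - f s"
  have p: "1 < p" and f: "continuous_on UNIV f" and zp: "0 < zp" and hzp: "spow p zp - f zp = 0"
    and mono: "strict_mono_on {0<..<zp} (\<lambda>s. f s / spow p s)"
    and lim0: "((\<lambda>s. f s / spow p s) \<longlongrightarrow> 0) (at 0)"
    using st by (auto simp: standing_def)
  show "1 < p" "0 < lam" "0 < zp" "spow p zp - f zp = 0" by fact+
  show "(Apot p f has_real_derivative spow p s - f s) (at s)" for s by (rule Apot_deriv[OF p f])
  show cont: "continuous_on UNIV ?h" by (intro continuous_intros p f)
  show "Apot p f 0 = 0" by (rule Apot_0)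
  have quot: "?h s / s powr (p - 1) = 1 - f s / spow p s" if "0 < s" for s
    using that by (simp add: spow_nonneg_eq diff_divide_distrib)
  show anti: "?h t / t powr (p - 1) < ?h s / s powr (p - 1)" if "0 < s" "s < t" "t < zp" for s t
    using strict_mono_onD[OF mono, of s t] that by (simp add: quot)
  have "((\<lambda>s. 1 - f s / spow p s) \<longlongrightarrow> 1 - 0) (at_right 0)"
    using lim0 by (intro tendsto_intros) (auto simp: filterlim_at_split)
  then show "((\<lambda>s. ?h s / s powr (p - 1)) \<longlongrightarrow> 1) (at_right 0)"
    by (rule tendsto_cong[THEN iffD1, rotated, OF tendsto_eq_rhs]) (auto simp: eventually_at_filter quot)
  show "0 < ?h s" if s: "0 < s" "s < zp" for s
  proof -
    have "isCont ?h zp" using cont by (simp add: continuous_on_eq_continuous_at)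
    then have "(?h \<longlongrightarrow> ?h zp) (at_left zp)" by (simp add: isCont_def filterlim_at_split)
    then have "((\<lambda>t. ?h t / t powr (p - 1)) \<longlongrightarrow> ?h zp / zp powr (p - 1)) (at_left zp)"
      by (intro tendsto_divide[of ?h] tendsto_powr tendsto_ident_at tendsto_const) (use zp in auto)
    moreover have "\<forall>\<^sub>F t in at_left zp. ?h t / t powr (p - 1) \<le> ?h ((s + zp) / 2) / ((s + zp) / 2) powr (p - 1)"
      unfolding eventually_at_left_field
      by (rule exI[of _ "(s + zp) / 2"]) (use s in \<open>auto intro!: less_imp_le[OF anti]\<close>)
    ultimately have "?h zp / zp powr (p - 1) \<le> ?h ((s + zp) / 2) / ((s + zp) / 2) powr (p - 1)"
      by (rule tendsto_upperbound) simp
    also have "\<dots> < ?h s / s powr (p - 1)" by (rule anti) (use s in auto)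
    finally show ?thesis using hzp s by (simp add: zero_less_divide_iff)
  qed
  obtain L where L: "L < 0"
    "((\<lambda>s. (spow p s - f s - spow p zp + f zp) / (spow p s - spow p zp)) \<longlongrightarrow> L) (at_left zp)"
    using st by (auto simp: standing_def)
  have "\<forall>\<^sub>F s in at_left zp. 2 * L < ?h s / (spow p s - spow p zp) \<and> ?h s / (spow p s - spow p zp) < L / 2"
    using order_tendstoD[OF L(2), of "2 * L"] order_tendstoD[OF L(2), of "L / 2"] L(1) hzp
    by (auto simp: eventually_conj_iff algebra_simps elim: eventually_mono)
  then obtain b where b: "b < zp" "\<And>s. b < s \<Longrightarrow> s < zp \<Longrightarrow>
      2 * L < ?h s / (spow p s - spow p zp) \<and> ?h s / (spow p s - spow p zp) < L / 2"
    unfolding eventually_at_left_field by blast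
  \<comment> \<open>Bounds for \<open>\<xi> powr (p - 2)\<close> on \<open>[zp / 2, zp]\<close>, whatever the sign of \<open>p - 2\<close>.\<close>
  define m M where "m = min ((zp / 2) powr (p - 2)) (zp powr (p - 2))" and "M = max ((zp / 2) powr (p - 2)) (zp powr (p - 2))"
  have m: "0 < m" "0 < M" using zp by (auto simp: m_def M_def min_def max_def)
  have slope: "(p - 1) * m * (zp - s) \<le> spow p zp - spow p s \<and> spow p zp - spow p s \<le> (p - 1) * M * (zp - s)"
    if s: "zp / 2 \<le> s" "s < zp" for s
  proof -
    have "\<exists>\<xi>. s < \<xi> \<and> \<xi> < zp \<and> zp powr (p - 1) - s powr (p - 1) = (zp - s) * ((p - 1) * \<xi> powr (p - 2))"
      by (rule MVT2[OF s(2)]) (use s zp p in \<open>auto intro!: derivative_eq_intros\<close>)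
    then obtain \<xi> where \<xi>: "s < \<xi>" "\<xi> < zp" "zp powr (p - 1) - s powr (p - 1) = (zp - s) * ((p - 1) * \<xi> powr (p - 2))"
      by blast
    have "m \<le> \<xi> powr (p - 2) \<and> \<xi> powr (p - 2) \<le> M"
    proof (cases "2 \<le> p")
      case True
      then show ?thesis using \<xi> s zp powr_mono2[of "p - 2" "zp/2" \<xi>] powr_mono2[of "p - 2" \<xi> zp]
        by (auto simp: m_def M_def)
    next
      case False
      then show ?thesis using \<xi> s zp powr_mono2'[of "p - 2" "zp/2" \<xi>] powr_mono2'[of "p - 2" \<xi> zp]
        by (auto simp: m_def M_def)
    qed
    then have "(zp - s) * ((p - 1) * m) \<le> (zp - s) * ((p - 1) * \<xi> powr (p - 2)) \<and>
      (zp - s) * ((p - 1) * \<xi> powr (p - 2)) \<le> (zp - s) * ((p - 1) * M)"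
      using s p by (auto intro!: mult_left_mono)
    then show ?thesis using \<xi>(3) s zp by (simp add: spow_nonneg_eq mult_ac)
  qed
  define \<delta> where "\<delta> = min (zp / 2) ((zp - b) / 2)"
  have \<delta>: "0 < \<delta>" using b zp by (simp add: \<delta>_def)
  have "- L / 2 * ((p - 1) * m) * (zp - s) \<le> ?h s \<and> ?h s \<le> - 2 * L * ((p - 1) * M) * (zp - s)"
    if s: "zp - \<delta> \<le> s" "s \<le> zp" for s
  proof (cases "s = zp")
    case False
    have "\<delta> \<le> zp / 2" "\<delta> \<le> (zp - b) / 2" unfolding \<delta>_def by (rule min.cobounded1, rule min.cobounded2)
    then have "zp / 2 \<le> s" "(zp + b) / 2 \<le> s" using s by (simp_all add: field_simps)
    moreover have "b < (zp + b) / 2" using b(1) by simp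
    ultimately have s': "s < zp" "zp / 2 \<le> s" "b < s" using False s by simp_all
    define d where "d = spow p zp - spow p s"
    have d: "0 < d" using spow_strict_mono[OF p s'(1)] by (simp add: d_def)
    have "2 * L < - (?h s / d)" "- (?h s / d) < L / 2"
      using b(2)[OF s'(3,1)] unfolding d_def by (auto simp: divide_minus_right[symmetric] simp del: divide_minus_right)
    then have q: "- L / 2 * d \<le> ?h s" "?h s \<le> - 2 * L * d" using d by (auto simp: field_simps)
    have "- L / 2 * ((p - 1) * m * (zp - s)) \<le> - L / 2 * d" "- 2 * L * d \<le> - 2 * L * ((p - 1) * M * (zp - s))"
      using slope[OF s'(2,1)] L(1) unfolding d_def by (auto intro!: mult_left_mono mult_left_mono_neg)
    then show ?thesis using q by (simp only: mult.assoc) linarith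
  qed (use hzp in simp)
  moreover have "0 < - L / 2 * ((p - 1) * m)" "0 < - 2 * L * ((p - 1) * M)" 
    using L m p by (auto intro!: mult_pos_pos simp: mult_neg_pos)
  ultimately show "\<exists>\<kappa>1>0. \<exists>\<kappa>2>0. \<exists>\<delta>>0. \<forall>s. zp - \<delta> \<le> s \<and> s \<le> zp \<longrightarrow>
      \<kappa>1 * (zp - s) \<le> ?h s \<and> ?h s \<le> \<kappa>2 * (zp - s)"
    using \<delta> by (intro exI[of _ "- L / 2 * ((p - 1) * m)"] exI[of _ "- 2 * L * ((p - 1) * M)"] exI[of _ \<delta>] conjI) auto
qed

section \<open>Reflection\<close>

definition reflected :: "(real \<Rightarrow> real) \<Rightarrow> real \<Rightarrow> real" where
  "reflected f s = - f (- s)"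

lemma reflected_reflected [simp]: "reflected (reflected f) = f"
  by (auto simp: reflected_def)

lemma continuous_on_reflected:
  assumes "continuous_on UNIV f"
  shows "continuous_on UNIV (reflected f)"
proof -
  have "continuous_on UNIV (\<lambda>s. f (- s))"
    by (rule continuous_on_compose2[OF assms]) (auto intro: continuous_intros)
  then show ?thesis unfolding reflected_def[abs_def] by (rule continuous_on_minus)
qed

lemma standing_reflected:
  assumes st: "standing p p f zm zp"
  shows "standing p p (reflected f) (- zp) (- zm)"
proof -
  have nz: "\<forall>s\<in>{zm<..<0}. spow p s - f s \<noteq> 0" "\<forall>s\<in>{0<..<zp}. spow p s - f s \<noteq> 0"
    using st unfolding standing_def by blast+
  have quot: "reflected f s / spow p s = f (- s) / spow p (- s)" for s by (simp add: reflected_def)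
  have f: "continuous_on UNIV (reflected f)"
    using st by (intro continuous_on_reflected) (simp add: standing_def)
  have 0: "((\<lambda>s. reflected f s / spow p s) \<longlongrightarrow> 0) (at 0)"
  proof -
    have "((\<lambda>s. f s / spow p s) \<longlongrightarrow> 0) (filtermap uminus (at 0))"
      using st by (simp add: standing_def filtermap_at_minus)
    then show ?thesis unfolding quot by (simp add: filterlim_filtermap)
  qed
  obtain L1 where L1: "L1 < 0"
    "((\<lambda>s. (spow p s - f s - spow p zp + f zp) / (spow p s - spow p zp)) \<longlongrightarrow> L1) (at_left zp)"
    using st by (auto simp: standing_def)
  obtain L2 where L2: "L2 < 0"
    "((\<lambda>s. (spow p s - f s - spow p zm + f zm) / (spow p s - spow p zm)) \<longlongrightarrow> L2) (at_right zm)"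
    using st by (auto simp: standing_def)
  have q2: "(spow p s - reflected f s - spow p (- z) + reflected f (- z)) / (spow p s - spow p (- z)) =
      (spow p (- s) - f (- s) - spow p z + f z) / (spow p (- s) - spow p z)" for s z
  proof -
    have n: "spow p s - reflected f s - spow p (- z) + reflected f (- z) = - (spow p (- s) - f (- s) - spow p z + f z)"
      by (simp add: reflected_def)
    have d: "spow p s - spow p (- z) = - (spow p (- s) - spow p z)" by simp
    show ?thesis unfolding n d by (rule minus_divide_divide)
  qed
  have "((\<lambda>s. (spow p s - reflected f s - spow p (- zm) + reflected f (- zm)) / (spow p s - spow p (- zm))) \<longlongrightarrow> L2) (at_left (- zm))"
    unfolding q2 using L2(2) by (simp add: at_left_minus filterlim_filtermap)
  moreover have "((\<lambda>s. (spow p s - reflected f s - spow p (- zp) + reflected f (- zp)) / (spow p s - spow p (- zp))) \<longlongrightarrow> L1) (at_right (- zp))"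
    unfolding q2 using L1(2) by (simp add: at_right_minus filterlim_filtermap)
  moreover have "strict_antimono_on {- zp<..<0} (\<lambda>s. reflected f s / spow p s)"
    unfolding quot
  proof (rule monotone_onI)
    have m: "strict_mono_on {0<..<zp} (\<lambda>s. f s / spow p s)" using st by (simp add: standing_def)
    show "f (- y) / spow p (- y) < f (- x) / spow p (- x)"
      if "x \<in> {- zp<..<0}" "y \<in> {- zp<..<0}" "x < y" for x y
      by (rule strict_mono_onD[OF m]) (use that in auto)
  qed
  moreover have "strict_mono_on {0<..<- zm} (\<lambda>s. reflected f s / spow p s)"
    unfolding quot
  proof (rule strict_mono_onI)
    have m: "strict_antimono_on {zm<..<0} (\<lambda>s. f s / spow p s)" using st by (simp add: standing_def)
    show "f (- x) / spow p (- x) < f (- y) / spow p (- y)"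
      if "x \<in> {0<..<- zm}" "y \<in> {0<..<- zm}" "x < y" for x y
      using monotone_onD[OF m, of "- y" "- x"] that by auto
  qed
  moreover have eq: "spow p s - reflected f s = - (spow p (- s) - f (- s))" for s by (simp add: reflected_def)
  moreover have "\<forall>s\<in>{0<..<- zm}. spow p s - reflected f s \<noteq> 0"
  proof
    fix s assume "s \<in> {0<..<- zm}"
    then have "- s \<in> {zm<..<0}" by auto
    with nz(1) have "spow p (- s) - f (- s) \<noteq> 0" by (rule bspec)
    then show "spow p s - reflected f s \<noteq> 0" unfolding eq by simp
  qed
  moreover have "\<forall>s\<in>{- zp<..<0}. spow p s - reflected f s \<noteq> 0"
  proof
    fix s assume "s \<in> {- zp<..<0}"
    then have "- s \<in> {0<..<zp}" by auto
    with nz(2) have "spow p (- s) - f (- s) \<noteq> 0" by (rule bspec)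
    then show "spow p s - reflected f s \<noteq> 0" unfolding eq by simp
  qed
  moreover have "1 < p" "spow p 0 - reflected f 0 = 0" "spow p (- zp) - reflected f (- zp) = 0"
    "spow p (- zm) - reflected f (- zm) = 0" "- zp < 0" "0 < - zm"
    using st by (simp_all add: standing_def reflected_def)
  ultimately show ?thesis
    using f 0 L1(1) L2(1) unfolding standing_def by blast
qed

lemma Fprim_reflected:
  assumes "continuous_on UNIV f"
  shows "Fprim (reflected f) s = Fprim f (- s)"
proof -
  have r: "continuous_on UNIV (reflected f)"
    by (rule continuous_on_reflected[OF assms])
  have "((\<lambda>s. Fprim (reflected f) s - Fprim f (- s)) has_real_derivative 0) (at x)" for x
  proof -
    have "((\<lambda>s. Fprim f (- s)) has_real_derivative f (- x) * - 1) (at x)"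
      by (rule DERIV_chain2[OF Fprim_deriv[OF assms]]) (auto intro!: derivative_eq_intros)
    from DERIV_diff[OF Fprim_deriv[OF r, of x] this] show ?thesis by (simp add: reflected_def)
  qed
  then have "Fprim (reflected f) s - Fprim f (- s) = Fprim (reflected f) 0 - Fprim f (- 0)"
    by (intro DERIV_isconst_all) auto
  then show ?thesis by (simp add: Fprim_def zero_ereal_def[symmetric])
qed

lemma Apot_reflected: "continuous_on UNIV f \<Longrightarrow> Apot p (reflected f) s = Apot p f (- s)"
  by (simp add: Apot_def Fprim_reflected)

lemma standing_cont: "standing p q f zm zp \<Longrightarrow> continuous_on UNIV f"
  by (simp add: standing_def)

lemma standing_well:
  assumes st: "standing p p f zm zp" and lam: "0 < lam"
  shows "well p lam (\<lambda>s. spow p s - f s) (Apot p f) zp zm"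
proof -
  have "half_well p lam (\<lambda>s. spow p s - reflected f s) (Apot p (reflected f)) (- zm)"
    by (rule standing_half_well[OF standing_reflected[OF st] lam])
  moreover have "(\<lambda>s. spow p s - reflected f s) = (\<lambda>s. - (spow p (- s) - f (- s)))" by (simp add: reflected_def add.commute)
  moreover have "Apot p (reflected f) = (\<lambda>s. Apot p f (- s))"
    using Apot_reflected[OF standing_cont[OF st]] by blast
  ultimately show ?thesis
    using standing_half_well[OF st lam] unfolding well_def by simp
qed

text \<open>
  A solution with values in \<open>[0, zb]\<close> does not depend on \<open>h\<close> at negative arguments. Extending \<open>h\<close> as an odd
  function makes the well symmetric.
\<close>
lemma half_well_odd_extension:
  assumes "half_well p lam h A zb"
  defines "g \<equiv> \<lambda>s. if 0 \<le> s then h s else - h (- s)"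
  shows "well p lam g (\<lambda>s. A \<bar>s\<bar>) zb (- zb)"
proof -
  interpret hw: half_well p lam h A zb by fact
  have g: "continuous_on UNIV g"
  proof -
    have "continuous_on ({0..} \<union> {..0}) g"
      unfolding g_def
      by (rule continuous_on_If) (use hw.h_zero in \<open>auto intro!: continuous_intros continuous_on_compose2[OF hw.h_cont]
            intro: continuous_on_subset[OF hw.h_cont]\<close>)
    moreover have "{0..} \<union> {..0} = (UNIV :: real set)" by auto
    ultimately show ?thesis by simp
  qed
  have der: "((\<lambda>s. A \<bar>s\<bar>) has_real_derivative g s) (at s)" for s
  proof -
    define a b where "a = s - 1" and "b = s + 1"
    have "((\<lambda>s. A \<bar>s\<bar>) has_real_derivative g s) (at s within {a..b})"
    proof (rule DERIV_off_finite_set[of "{0}"])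
      show "continuous_on {a..b} (\<lambda>s. A \<bar>s\<bar>)"
        by (intro continuous_on_compose2[OF hw.A_cont[of UNIV]] continuous_intros) auto
      show "continuous_on {a..b} g" by (rule continuous_on_subset[OF g]) simp
      fix x assume "x \<notin> {0::real}"
      then consider "0 < x" | "x < 0" by force
      then show "((\<lambda>s. A \<bar>s\<bar>) has_real_derivative g x) (at x)"
      proof cases
        case 1
        have "(A has_real_derivative g x) (at x)" using hw.A_deriv[of x] 1 by (simp add: g_def)
        then show ?thesis
          by (rule has_field_derivative_transform_within_open[of _ _ _ "{0<..}"]) (use 1 in auto)
      next
        case 2
        have "((\<lambda>s. A (- s)) has_real_derivative h (- x) * - 1) (at x)"
          by (rule DERIV_chain2[OF hw.A_deriv]) (auto intro!: derivative_eq_intros)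
        then have "((\<lambda>s. A (- s)) has_real_derivative g x) (at x)" using 2 by (simp add: g_def)
        then show ?thesis
          by (rule has_field_derivative_transform_within_open[of _ _ _ "{..<0}"]) (use 2 in auto)
      qed
    qed (auto simp: a_def b_def)
    then show ?thesis by (simp add: at_within_Icc_at a_def b_def)
  qed
  have half: "half_well p lam g (\<lambda>s. A \<bar>s\<bar>) zb"
  proof
    show "((\<lambda>s. g s / s powr (p - 1)) \<longlongrightarrow> 1) (at_right 0)"
      by (rule tendsto_cong[THEN iffD1, OF _ hw.ratio_lim]) (auto simp: eventually_at_filter g_def)
    obtain \<kappa>1 \<kappa>2 \<delta> where k: "\<kappa>1 > 0" "\<kappa>2 > 0" "\<delta> > 0"
      "\<forall>s. zb - \<delta> \<le> s \<and> s \<le> zb \<longrightarrow> \<kappa>1 * (zb - s) \<le> h s \<and> h s \<le> \<kappa>2 * (zb - s)"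
      using hw.h_linear by blast
    then show "\<exists>\<kappa>1>0. \<exists>\<kappa>2>0. \<exists>\<delta>>0. \<forall>s. zb - \<delta> \<le> s \<and> s \<le> zb \<longrightarrow>
                      \<kappa>1 * (zb - s) \<le> g s \<and> g s \<le> \<kappa>2 * (zb - s)"
      using hw.zb_pos
      by (intro exI[of _ \<kappa>1] exI[of _ \<kappa>2] exI[of _ "min \<delta> zb"] conjI) (auto simp: g_def)
  qed (use hw.p_gt1 hw.lam_pos hw.zb_pos hw.A_0 hw.h_pos hw.h_zb hw.ratio_anti g der in \<open>auto simp: g_def\<close>)
  moreover have "(\<lambda>s. - g (- s)) = g" using hw.h_zero by (auto simp: g_def)
  ultimately show ?thesis unfolding well_def by simp
qed

section \<open>Solutions with values in the well\<close>

lemma solution_ode: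
  assumes C: "\<phi> \<in> C1" and v: "is_C1 (\<lambda>x. spow p (D01 \<phi> x))"
    and eq: "\<And>x. x \<in> {0<..<1} \<Longrightarrow> - D01 (\<lambda>y. spow p (D01 \<phi> y)) x = lam * h (\<phi> x)"
  shows "ode p lam h 0 1 \<phi> (D01 \<phi>)"
  unfolding ode_def
proof (intro conjI allI impI continuous_on_C1[OF C])
  fix x :: real assume x: "0 < x \<and> x < 1"
  have "(\<phi> has_real_derivative D01 \<phi> x) (at x within {0..1})"
    using C x by (intro D01_works) (auto simp: C1_def is_C1_def)
  then show "(\<phi> has_real_derivative D01 \<phi> x) (at x)" using x by (simp add: at_within_Icc_at)
  have "((\<lambda>y. spow p (D01 \<phi> y)) has_real_derivative D01 (\<lambda>y. spow p (D01 \<phi> y)) x) (at x within {0..1})"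
    using v x by (intro D01_works) (auto simp: is_C1_def)
  moreover have "D01 (\<lambda>y. spow p (D01 \<phi> y)) x = - (lam * h (\<phi> x))" using eq[of x] x by simp
  ultimately show "((\<lambda>y. spow p (D01 \<phi> y)) has_real_derivative - (lam * h (\<phi> x))) (at x)"
    using x by (simp add: at_within_Icc_at)
qed

lemma E_set_iff_bvp:
  assumes st: "standing p p f zm zp" and lam: "0 < lam"
  shows "\<phi> \<in> E_set p p f zm zp lam \<longleftrightarrow>
    \<phi> \<in> C1 \<and> well.bvp p lam (\<lambda>s. spow p s - f s) zp zm \<phi> (D01 \<phi>)"
proof -
  let ?h = "\<lambda>s. spow p s - f s"
  interpret W: well p lam ?h "Apot p f" zp zm by (rule standing_well[OF st lam])
  show ?thesis
  proof
    assume "\<phi> \<in> E_set p p f zm zp lam"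
    then have C: "\<phi> \<in> C1" and v: "is_C1 (\<lambda>x. spow p (D01 \<phi> x))"
      and eq: "\<And>x. x \<in> {0<..<1} \<Longrightarrow> - D01 (\<lambda>y. spow p (D01 \<phi> y)) x = lam * ?h (\<phi> x)"
      and bc: "\<phi> 0 = 0" "\<phi> 1 = 0" and rng: "\<phi> ` {0..1} \<subseteq> {zm..zp}"
      by (auto simp: E_set_def solutions_def)
    have "ode p lam ?h 0 1 \<phi> (D01 \<phi>)" by (rule solution_ode[OF C v eq])
    then show "\<phi> \<in> C1 \<and> W.bvp \<phi> (D01 \<phi>)" using C bc rng by (auto simp: W.bvp_def)
  next
    assume "\<phi> \<in> C1 \<and> W.bvp \<phi> (D01 \<phi>)"
    then have C: "\<phi> \<in> C1" and ode: "ode p lam ?h 0 1 \<phi> (D01 \<phi>)"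
      and bc: "\<phi> 0 = 0" "\<phi> 1 = 0" and rng: "\<forall>x\<in>{0..1}. zm \<le> \<phi> x \<and> \<phi> x \<le> zp"
      by (auto simp: W.bvp_def)
    note der = ode_derivs_closed(2)[OF W.pos.p_gt1 ode W.pos.h_cont]
    have "is_C1 (\<lambda>x. spow p (D01 \<phi> x))"
      by (rule is_C1I[OF der])
         (auto intro!: continuous_intros continuous_on_compose2[OF W.pos.h_cont continuous_on_C1(1)[OF C]])
    moreover have "D01 (\<lambda>y. spow p (D01 \<phi> y)) x = - (lam * ?h (\<phi> x))" if "x \<in> {0<..<1}" for x
      by (rule D01_eqI[OF _ der]) (use that in auto)
    ultimately show "\<phi> \<in> E_set p p f zm zp lam"
      using C bc rng by (auto simp: E_set_def solutions_def)
  qed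
qed

text \<open>
  Suppose the maximum, attained at \<open>m\<close>, exceeds \<open>z\<close>, and let \<open>a\<close> be the last point before \<open>m\<close> with a value
  at most \<open>z\<close>. The derivative is nondecreasing on \<open>[a, m]\<close> by the sign of \<open>h\<close> and zero at \<open>m\<close>, so the
  solution decreases from \<open>\<phi> a \<le> z\<close> to its maximum, a contradiction.
\<close>
lemma ode_upper_bound:
  assumes p: "1 < p" and lam: "0 < lam" and ode: "ode p lam h 0 1 \<phi> D" and bc: "\<phi> 0 = 0" "\<phi> 1 = 0"
    and z: "0 < z" and sign: "\<And>s. z < s \<Longrightarrow> h s \<le> 0" and x: "x \<in> {0..1}"
  shows "\<phi> x \<le> z"
proof (rule ccontr)
  assume "\<not> \<phi> x \<le> z"
  then have xz: "z < \<phi> x" by simp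
  obtain m where m: "m \<in> {0..1}" "\<And>y. y \<in> {0..1} \<Longrightarrow> \<phi> y \<le> \<phi> m"
    using continuous_attains_sup[of "{0..1::real}" \<phi>] odeD(1)[OF ode] by auto
  have mz: "z < \<phi> m" using m(2)[OF x] xz by simp
  have m01: "0 < m" "m < 1" using mz bc z m(1) by (auto simp: less_le)
  have Dm: "D m = 0"
  proof (rule DERIV_local_max[OF odeD(3)[OF ode m01], of "min m (1 - m)"])
    show "\<forall>y. \<bar>m - y\<bar> < min m (1 - m) \<longrightarrow> \<phi> y \<le> \<phi> m" using m(2) by (auto simp: abs_if split: if_splits)
  qed (use m01 in auto)
  define S where "S = {y \<in> {0..m}. \<phi> y \<le> z}"
  have cm: "continuous_on {0..m} \<phi>" by (rule continuous_on_subset[OF odeD(1)[OF ode]]) (use m01 in auto)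
  have "S = {0..m} \<inter> \<phi> -` {..z}" by (auto simp: S_def)
  then have "closed S" using continuous_closed_preimage[OF cm closed_atLeastAtMost closed_atMost] by simp
  moreover have S0: "0 \<in> S" using m01 bc z by (auto simp: S_def)
  moreover have bdd: "bdd_above S" by (auto simp: S_def)
  moreover define a where "a = Sup S"
  ultimately have aS: "a \<in> S" using closed_contains_Sup[of S] by auto
  have am: "0 \<le> a" "a < m" "\<phi> a \<le> z" using aS mz by (auto simp: S_def less_le)
  have above: "z < \<phi> y" if "a < y" "y \<le> m" for y
  proof (rule ccontr)
    assume "\<not> z < \<phi> y"
    then have "y \<in> S" using that am by (auto simp: S_def)
    then show False using cSup_upper[OF _ bdd, of y] that by (simp add: a_def)
  qed
  have D_le: "D y \<le> 0" if y: "a < y" "y < m" for y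
  proof -
    have "spow p (D y) \<le> spow p (D m)"
    proof (rule DERIV_nonneg_imp_increasing_open[of y m "\<lambda>y. spow p (D y)"])
      show "\<exists>d. ((\<lambda>y. spow p (D y)) has_real_derivative d) (at t) \<and> 0 \<le> d" if "y < t" "t < m" for t
        using odeD(4)[OF ode, of t] sign[OF above[of t]] that y m01 am lam
        by (intro exI[of _ "- (lam * h (\<phi> t))"]) (auto simp: mult_nonneg_nonpos)
      show "continuous_on {y..m} (\<lambda>y. spow p (D y))"
        using p y m01 am by (intro continuous_intros continuous_on_subset[OF odeD(2)[OF ode]]) auto
    qed (use y in simp)
    then have "\<not> spow p 0 < spow p (D y)" using Dm by simp
    then show ?thesis using spow_less_iff[OF p, of 0 "D y"] by simp
  qed
  have "\<phi> m \<le> \<phi> a"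
  proof (rule DERIV_nonpos_imp_decreasing_open[of a m \<phi>])
    show "\<exists>d. (\<phi> has_real_derivative d) (at t) \<and> d \<le> 0" if "a < t" "t < m" for t
      using odeD(3)[OF ode, of t] D_le[of t] that am m01 by auto
    show "continuous_on {a..m} \<phi>" by (rule continuous_on_subset[OF cm]) (use am in auto)
  qed (use am in simp)
  then show False using am mz by simp
qed

section \<open>Time maps and thresholds in terms of the well\<close>

lemma timeI_eq:
  fixes lam a :: real
  assumes st: "standing p p f zm zp" and lam: "0 < lam" and a: "0 \<le> a"
  shows "timeI p p f a = half_well.I p (Apot p f) a"
proof -
  interpret W: well p lam "\<lambda>s. spow p s - f s" "Apot p f" zp zm by (rule standing_well[OF st lam])
  show ?thesis
    unfolding timeI_def W.pos.I_def W.pos.ig_def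
    by (rule integral_cong) (use a in \<open>simp add: Apot_def diff_divide_distrib algebra_simps\<close>)
qed

lemma timeJ_eq:
  fixes lam a :: real
  assumes st: "standing p p f zm zp" and lam: "0 < lam" and a: "0 \<le> a"
  shows "timeJ p p f (- a) = half_well.I p (\<lambda>s. Apot p f (- s)) a"
proof -
  interpret W: well p lam "\<lambda>s. spow p s - f s" "Apot p f" zp zm by (rule standing_well[OF st lam])
  let ?g = "\<lambda>t. (Fprim f t - Fprim f (- a) + (\<bar>- a\<bar> powr p - \<bar>t\<bar> powr p) / p) powr (- 1 / p)"
  have "timeJ p p f (- a) = integral {- a..- 0} ?g" by (simp add: timeJ_def)
  also have "\<dots> = integral {0..a} (\<lambda>t. ?g (- t))"
    using Henstock_Kurzweil_Integration.integral_reflect_real[of a 0 "\<lambda>t. ?g (- t)"] by simp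
  also have "\<dots> = W.neg.I a"
    unfolding W.neg.I_def W.neg.ig_def
    by (rule integral_cong) (simp add: Apot_def diff_divide_distrib algebra_simps)
  finally show ?thesis .
qed

text \<open>
  The points selected by \<open>zpt\<close> and \<open>Spt\<close> at \<open>rstar\<close> are the two turning points of the level \<open>estar\<close>: the
  factor \<open>\<lambda> p / (p - 1)\<close> cancels.
\<close>
lemma star_values:
  assumes st: "standing p p f zm zp" and lam: "0 < lam"
  defines "e \<equiv> min (Apot p f zp) (Apot p f zm)"
  shows "Istar p p f zm zp lam = half_well.I p (Apot p f) (half_well.lev (Apot p f) zp e)"
    and "Jstar p p f zm zp lam = half_well.I p (\<lambda>s. Apot p f (- s)) (half_well.lev (\<lambda>s. Apot p f (- s)) (- zm) e)"
proof -
  interpret W: well p lam "\<lambda>s. spow p s - f s" "Apot p f" zp zm by (rule standing_well[OF st lam])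
  let ?A = "Apot p f" and ?c = "lam * p / (p - 1)"
  have p: "1 < p" and c: "0 < ?c" using W.pos.p_gt1 lam by auto
  have e: "0 < e" "e \<le> ?A zp" "e \<le> ?A zm" using W.estar_pos by (auto simp: e_def W.estar_def)
  have r: "rstar p p f zm zp lam powr p = ?c * e"
  proof -
    have root: "(x powr (1 / p)) powr p = x" if "0 < x" for x
      using p that by (simp add: powr_powr)
    have "rmax p p f lam z powr p = ?c * ?A z" if "0 < ?A z" for z
      unfolding rmax_def by (rule root[OF mult_pos_pos[OF c that]])
    then have "rmax p p f lam zp powr p = ?c * ?A zp" "rmax p p f lam zm powr p = ?c * ?A zm"
      using e by auto
    moreover have "min (rmax p p f lam zp) (rmax p p f lam zm) powr p =
        min (rmax p p f lam zp powr p) (rmax p p f lam zm powr p)"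
      using p powr_mono2[of p "rmax p p f lam zp" "rmax p p f lam zm"] powr_mono2[of p "rmax p p f lam zm" "rmax p p f lam zp"]
      by (auto simp: min_def rmax_def)
    moreover have "min (?c * ?A zp) (?c * ?A zm) = ?c * e"
      unfolding e_def min_mult_distrib_left by (simp only: less_imp_le[OF c] if_True)
    ultimately show ?thesis by (simp add: rstar_def)
  qed
  have z: "zpt p p f zp lam (rstar p p f zm zp lam) = W.pos.lev e"
    unfolding zpt_def r
  proof (rule the_equality)
    show "W.pos.lev e \<in> {0<..zp} \<and> ?c * e = ?c * ?A (W.pos.lev e)"
      using W.pos.lev_mem[of e] W.pos.lev_pos[of e] e by auto
    show "z = W.pos.lev e" if "z \<in> {0<..zp} \<and> ?c * e = ?c * ?A z" for z
    proof -
      have "?A z = e" using that c by auto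
      then show ?thesis using W.pos.lev_A[of z] that by auto
    qed
  qed
  show "Istar p p f zm zp lam = W.pos.I (W.pos.lev e)"
    unfolding Istar_def z using W.pos.lev_mem[of e] e by (intro timeI_eq[OF st lam]) auto
  have s: "Spt p p f zm lam (rstar p p f zm zp lam) = - W.neg.lev e"
    unfolding Spt_def r
  proof (rule the_equality)
    show "- W.neg.lev e \<in> {zm..<0} \<and> ?c * e = ?c * ?A (- W.neg.lev e)"
      using W.neg.lev_mem[of e] W.neg.lev_pos[of e] e by auto
    show "z = - W.neg.lev e" if "z \<in> {zm..<0} \<and> ?c * e = ?c * ?A z" for z
    proof -
      have "?A z = e" using that c by auto
      then show ?thesis using W.neg.lev_A[of "- z"] that by auto
    qed
  qed
  show "Jstar p p f zm zp lam = W.neg.I (W.neg.lev e)"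
    unfolding Jstar_def s using W.neg.lev_mem[of e] e by (intro timeJ_eq[OF st lam]) auto
qed

context well
begin

text \<open>
  The \<open>p\<close>-th power of \<open>2 k I0 / mu\<close> is \<open>lambda_eig p k / lam\<close>; the factor \<open>p\<close> in \<open>R0\<close> and the factor \<open>p\<close> in
  \<open>mu powr p\<close> cancel.
\<close>
lemma lambda_eig_less_iff: "lambda_eig p k < lam \<longleftrightarrow> 2 * real k * (pos.I0 / pos.mu) < 1"
proof -
  define J where "J = integral {0..1} (\<lambda>t. (1 - t powr p) powr (- 1 / p))"
  have p: "1 < p" by (rule pos.p_gt1)
  have "pos.I0 = integral {0..1} (\<lambda>t. p powr (1 / p) * (1 - t powr p) powr (- 1 / p))"
    unfolding pos.I0_def
  proof (rule integral_cong)
    fix t :: real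
    have "pos.R0 t powr (- 1 / p) = (1 - t powr p) powr (- 1 / p) / p powr (- 1 / p)"
      unfolding pos.R0_def by (rule powr_divide)
    then show "pos.R0 t powr (- 1 / p) = p powr (1 / p) * (1 - t powr p) powr (- 1 / p)"
      by (simp add: powr_minus_divide)
  qed
  also have "\<dots> = p powr (1 / p) * J" by (simp add: J_def)
  finally have I0: "pos.I0 = p powr (1 / p) * J" .
  have J: "0 < J" using pos.I0_pos I0 p by (simp add: zero_less_mult_iff)
  let ?X = "2 * real k * (pos.I0 / pos.mu)"
  have X: "0 \<le> ?X" using pos.I0_pos pos.mu_pos by simp
  have "?X powr p = real k powr p * (2 * J) powr p * (p powr (1 / p)) powr p / pos.mu powr p"
    unfolding I0 using J pos.mu_pos p by (simp add: powr_mult powr_divide mult_ac)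
  also have "\<dots> = lambda_eig p k / lam"
    using p pos.lam_pos by (simp add: lambda_eig_def pos.mu_powr powr_powr J_def field_simps)
  finally have eq: "?X powr p = lambda_eig p k / lam" .
  have "?X < 1 \<longleftrightarrow> ?X powr p < 1"
    using X p powr_less_mono2[of p ?X 1] powr_mono2[of p 1 ?X] by (cases "?X < 1") auto
  also have "\<dots> \<longleftrightarrow> lambda_eig p k < lam" unfolding eq using pos.lam_pos by simp
  finally show ?thesis by simp
qed

text \<open>
  The thresholds have the form \<open>(p - 1) / p * Y powr p\<close> with \<open>Y / mu\<close> the total time of the bumps, and
  \<open>mu powr p = lam * p / (p - 1)\<close>.
\<close>
lemma T_threshold:
  assumes "0 \<le> Y" "T k e = Y / pos.mu"
  shows "(p - 1) / p * Y powr p < lam \<longleftrightarrow> T k e < 1"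
proof -
  have p: "1 < p" by (rule pos.p_gt1)
  have X: "0 \<le> T k e" using assms pos.mu_pos by simp
  have "Y powr p = T k e powr p * (lam * p / (p - 1))"
    using assms pos.mu_pos by (simp add: powr_divide pos.mu_powr[symmetric])
  then have eq: "(p - 1) / p * Y powr p = lam * T k e powr p" using p by simp
  have "T k e < 1 \<longleftrightarrow> T k e powr p < 1"
    using X p powr_less_mono2[of p "T k e" 1] powr_mono2[of p 1 "T k e"] by (cases "T k e < 1") auto
  then show ?thesis unfolding eq using pos.lam_pos by simp
qed

lemma up_solutions_one_nonneg:
  assumes "\<phi> \<in> up_solutions 1" "x \<in> {0..1}"
  shows "0 \<le> \<phi> x"
proof -
  obtain X where X: "nodal 1 X \<phi>" and b: "bvp \<phi> (D01 \<phi>)" "0 < D01 \<phi> 0"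
    using assms by (auto simp: up_solutions_def)
  have "arc \<phi> (elev (D01 \<phi> 0)) 0 (X 0) (X 1)" using bvp_arcs[OF b X, of 0] by simp
  moreover have "x \<in> {X 0..X 1}" using X assms by (simp add: nodal_def)
  ultimately show ?thesis using arc_even(2)[of \<phi> _ 0 "X 0" "X 1" x] by simp
qed

text \<open>
  The three cases in terms of \<open>Y = mu * T k estar\<close>. For \<open>p \<le> 2\<close> the bumps of level \<open>estar\<close> take infinite
  time, which corresponds to the threshold \<open>\<infinity>\<close>.
\<close>
lemma up_solutions_trichotomy:
  assumes k: "1 \<le> k" "k = 1 \<longrightarrow> A zp \<le> A zm"
    and Y: "2 < p \<Longrightarrow> 0 \<le> Y \<and> T k estar = Y / pos.mu"
    and m: "card {i. i < k \<and> coreable i} = Suc m"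
  shows "lam \<le> lambda_eig p k \<Longrightarrow> up_solutions k = {}"
    and "lambda_eig p k < lam \<Longrightarrow> p \<le> 2 \<or> lam \<le> (p - 1) / p * Y powr p \<Longrightarrow> \<exists>\<phi>. up_solutions k = {\<phi>}"
    and "2 < p \<Longrightarrow> (p - 1) / p * Y powr p < lam \<Longrightarrow> subtopology C1_topology (up_solutions k) homeomorphic_space cube m"
proof -
  show "up_solutions k = {}" if "lam \<le> lambda_eig p k"
    using that lambda_eig_less_iff[of k] by (intro up_solutions_empty[OF k]) linarith
  show "\<exists>\<phi>. up_solutions k = {\<phi>}" if l: "lambda_eig p k < lam" and u: "p \<le> 2 \<or> lam \<le> (p - 1) / p * Y powr p"
  proof (rule up_solutions_singleton[OF k])
    show "2 * real k * (pos.I0 / pos.mu) < 1" using l lambda_eig_less_iff by blast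
    show "p \<le> 2 \<or> 1 \<le> T k estar"
    proof (cases "p \<le> 2")
      case False
      then show ?thesis using u T_threshold[of Y k estar] Y by auto
    qed simp
  qed
  show "subtopology C1_topology (up_solutions k) homeomorphic_space cube m"
    if "2 < p" "(p - 1) / p * Y powr p < lam"
    using that T_threshold[of Y k estar] Y by (intro up_solutions_homeomorphic_cube[OF k that(1) _ m]) auto
qed

end

section \<open>Solutions starting with positive slope\<close>

definition E_plus :: "real \<Rightarrow> (real \<Rightarrow> real) \<Rightarrow> real \<Rightarrow> real \<Rightarrow> real \<Rightarrow> nat \<Rightarrow> (real \<Rightarrow> real) set" where
  "E_plus p f zm zp lam k = E_set p p f zm zp lam \<inter> S_plus k"

lemma E_plus_eq_up_solutions:
  assumes st: "standing p p f zm zp" and lam: "0 < lam" and k: "1 \<le> k"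
  shows "E_plus p f zm zp lam k = well.up_solutions p lam (\<lambda>s. spow p s - f s) zp zm k"
proof -
  interpret W: well p lam "\<lambda>s. spow p s - f s" "Apot p f" zp zm by (rule standing_well[OF st lam])
  have "\<phi> \<in> E_plus p f zm zp lam k \<longleftrightarrow> \<phi> \<in> W.up_solutions k" for \<phi>
  proof (cases "\<phi> \<in> C1 \<and> W.bvp \<phi> (D01 \<phi>) \<and> 0 < D01 \<phi> 0")
    case True
    then have "(\<exists>X. W.nodal k X \<phi>) \<longleftrightarrow> simple_zeros (k - 1) \<phi>"
      using k by (intro W.nodal_iff_simple_zeros) auto
    then show ?thesis
      using True E_set_iff_bvp[OF st lam, of \<phi>] by (auto simp: E_plus_def W.up_solutions_def S_plus_def W.bvp_def)
  next
    case False
    then show ?thesis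
      using E_set_iff_bvp[OF st lam, of \<phi>] by (auto simp: E_plus_def W.up_solutions_def S_plus_def)
  qed
  then show ?thesis by blast
qed

lemma up_solutions_one_odd_extension:
  fixes h :: "real \<Rightarrow> real"
  assumes w: "well p lam h A zp zm"
  defines "g \<equiv> \<lambda>s. if 0 \<le> s then h s else - h (- s)"
  shows "well.up_solutions p lam h zp zm 1 = well.up_solutions p lam g zp (- zp) 1"
proof -
  interpret W: well p lam h A zp zm by (rule w)
  interpret V: well p lam g "\<lambda>s. A \<bar>s\<bar>" zp "- zp"
    unfolding g_def by (rule half_well_odd_extension[OF W.pos.half_well_axioms])
  have ode: "ode p lam h 0 1 \<phi> D \<longleftrightarrow> ode p lam g 0 1 \<phi> D" if "\<And>x. x \<in> {0..1} \<Longrightarrow> 0 \<le> \<phi> x" for \<phi> D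
  proof -
    have "h (\<phi> x) = g (\<phi> x)" if "0 < x \<and> x < 1" for x
      using \<open>\<And>x. x \<in> {0..1} \<Longrightarrow> 0 \<le> \<phi> x\<close>[of x] that by (simp add: g_def)
    then show ?thesis unfolding ode_def by auto
  qed
  have bvp: "W.bvp \<phi> D \<longleftrightarrow> V.bvp \<phi> D" if nn: "\<And>x. x \<in> {0..1} \<Longrightarrow> 0 \<le> \<phi> x" for \<phi> D
  proof -
    have "(\<forall>x\<in>{0..1}. zm \<le> \<phi> x \<and> \<phi> x \<le> zp) \<longleftrightarrow> (\<forall>x\<in>{0..1}. - zp \<le> \<phi> x \<and> \<phi> x \<le> zp)"
    proof (rule ball_cong[OF refl])
      fix x :: real assume "x \<in> {0..1}"
      from nn[OF this] show "zm \<le> \<phi> x \<and> \<phi> x \<le> zp \<longleftrightarrow> - zp \<le> \<phi> x \<and> \<phi> x \<le> zp"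
        using W.neg.zb_pos W.pos.zb_pos by auto
    qed
    moreover have "ode p lam h 0 1 \<phi> D \<longleftrightarrow> ode p lam g 0 1 \<phi> D" by (rule ode[OF nn])
    ultimately show ?thesis unfolding W.bvp_def V.bvp_def by (simp only:)
  qed
  show ?thesis
  proof (intro equalityI subsetI)
    fix \<phi> assume \<phi>: "\<phi> \<in> W.up_solutions 1"
    have "W.bvp \<phi> (D01 \<phi>) \<longleftrightarrow> V.bvp \<phi> (D01 \<phi>)" by (rule bvp) (rule W.up_solutions_one_nonneg[OF \<phi>])
    then show "\<phi> \<in> V.up_solutions 1" using \<phi> unfolding W.up_solutions_def V.up_solutions_def by simp
  next
    fix \<phi> assume \<phi>: "\<phi> \<in> V.up_solutions 1"
    have "W.bvp \<phi> (D01 \<phi>) \<longleftrightarrow> V.bvp \<phi> (D01 \<phi>)" by (rule bvp) (rule V.up_solutions_one_nonneg[OF \<phi>])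
    then show "\<phi> \<in> W.up_solutions 1" using \<phi> unfolding W.up_solutions_def V.up_solutions_def by simp
  qed
qed

text \<open>
  For \<open>k \<ge> 2\<close> both sides of the well matter and the threshold involves the level \<open>estar\<close>. For \<open>k = 1\<close> the
  solution stays on the positive side and its level may be as large as \<open>A zp\<close>, even if \<open>A zm\<close> is smaller.
  In the oddly extended well \<open>A zp\<close> is the level \<open>estar\<close>; the core of the single bump has the length that is
  left, and so the exponent is \<open>0\<close>.
\<close>
lemma E_plus_description:
  assumes st: "standing p p f zm zp" and lam: "0 < lam" and k: "1 \<le> k"
  shows "lam \<le> lambda_eig p k \<Longrightarrow> E_plus p f zm zp lam k = {}"
    and "lambda_eig p k < lam \<Longrightarrow> ereal lam \<le> lambda_plus p p f zm zp lam k \<Longrightarrow> \<exists>\<phi>. E_plus p f zm zp lam k = {\<phi>}"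
    and "lambda_plus p p f zm zp lam k < ereal lam \<Longrightarrow>
      subtopology C1_topology (E_plus p f zm zp lam k) homeomorphic_space cube (exp_plus p f zm zp k)"
proof -
  let ?h = "\<lambda>s. spow p s - f s" and ?A = "Apot p f"
  interpret W: well p lam ?h ?A zp zm by (rule standing_well[OF st lam])
  note E = E_plus_eq_up_solutions[OF st lam k]
  have "(lam \<le> lambda_eig p k \<longrightarrow> E_plus p f zm zp lam k = {}) \<and>
    (lambda_eig p k < lam \<longrightarrow> ereal lam \<le> lambda_plus p p f zm zp lam k \<longrightarrow> (\<exists>\<phi>. E_plus p f zm zp lam k = {\<phi>})) \<and>
    (lambda_plus p p f zm zp lam k < ereal lam \<longrightarrow>
      subtopology C1_topology (E_plus p f zm zp lam k) homeomorphic_space cube (exp_plus p f zm zp k))"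
  proof (cases "k = 1")
    case True
    define g where "g = (\<lambda>s. if 0 \<le> s then ?h s else - ?h (- s))"
    interpret V: well p lam g "\<lambda>s. ?A \<bar>s\<bar>" zp "- zp"
      unfolding g_def by (rule half_well_odd_extension[OF W.pos.half_well_axioms])
    have E1: "E_plus p f zm zp lam k = V.up_solutions 1"
      using E up_solutions_one_odd_extension[OF W.well_axioms] True unfolding g_def by simp
    have zp: "0 < zp" by (rule W.pos.zb_pos)
    have I: "V.pos.I zp = timeI p p f zp"
      unfolding timeI_eq[OF st lam less_imp_le[OF zp]] V.pos.I_def W.pos.I_def V.pos.ig_def W.pos.ig_def
      using zp by (intro integral_cong) auto
    have es: "V.estar = ?A \<bar>zp\<bar>" by (simp add: V.estar_def)
    have T: "V.T 1 V.estar = 2 * timeI p p f zp / V.pos.mu"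
      unfolding es V.T_eq using V.pos.lev_zb I by (simp add: V.pos.quarter_def)
    have nn: "0 \<le> timeI p p f zp" if "2 < p"
      unfolding I[symmetric] V.pos.I_def
      by (rule Henstock_Kurzweil_Integration.integral_nonneg[OF V.pos.ig_integrable V.pos.ig_nonneg])
         (use that zp in \<open>simp add: V.pos.adm_def\<close>)
    have m: "card {i. i < 1 \<and> V.coreable i} = Suc 0" using V.coreable_card[of 1] by simp
    note tri = V.up_solutions_trichotomy[of 1 "2 * timeI p p f zp" 0, OF _ _ _ m]
    show ?thesis
      using tri T nn True unfolding E1 by (auto simp: lambda_plus_def exp_plus_def)
  next
    case False
    define Y where "Y = 2 * real ((k + 1) div 2) * Istar p p f zm zp lam + 2 * real (k div 2) * Jstar p p f zm zp lam"
    have IJ: "Istar p p f zm zp lam = W.pos.mu * W.pos.quarter W.estar" "Jstar p p f zm zp lam = W.pos.mu * W.neg.quarter W.estar"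
      using star_values[OF st lam] W.pos.mu_pos by (simp_all add: W.pos.quarter_def W.neg.quarter_def W.estar_def)
    have T: "0 \<le> Y \<and> W.T k W.estar = Y / W.pos.mu" if "2 < p"
    proof -
      have "W.adml W.estar" using that W.estar_pos by (simp add: W.adml_iff)
      then have q: "0 < W.pos.quarter W.estar" "0 < W.neg.quarter W.estar"
        using W.pos.quarter_pos W.neg.quarter_pos by (auto simp: W.adml_def)
      have "Y = W.pos.mu * W.T k W.estar" unfolding Y_def IJ W.T_eq by (simp add: algebra_simps)
      moreover have "0 \<le> W.T k W.estar" unfolding W.T_eq using q by simp
      ultimately show ?thesis using W.pos.mu_pos by simp
    qed
    have lp: "lambda_plus p p f zm zp lam k = (if p \<le> 2 then \<infinity> else ereal ((p - 1) / p * Y powr p))"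
      using False by (auto simp: lambda_plus_def Y_def Let_def elim!: evenE oddE)
    have m: "card {i. i < k \<and> W.coreable i} = Suc (exp_plus p f zm zp k)"
      unfolding W.coreable_card[OF k] exp_plus_def Let_def
      using False k by (auto elim!: evenE oddE)
    note tri = W.up_solutions_trichotomy[OF k _ T m]
    show ?thesis
      using tri False unfolding E lp by auto
  qed
  then show "lam \<le> lambda_eig p k \<Longrightarrow> E_plus p f zm zp lam k = {}"
    "lambda_eig p k < lam \<Longrightarrow> ereal lam \<le> lambda_plus p p f zm zp lam k \<Longrightarrow> \<exists>\<phi>. E_plus p f zm zp lam k = {\<phi>}"
    "lambda_plus p p f zm zp lam k < ereal lam \<Longrightarrow>
      subtopology C1_topology (E_plus p f zm zp lam k) homeomorphic_space cube (exp_plus p f zm zp k)"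
    by blast+
qed

section \<open>Solutions starting with negative slope\<close>

definition E_minus :: "real \<Rightarrow> (real \<Rightarrow> real) \<Rightarrow> real \<Rightarrow> real \<Rightarrow> real \<Rightarrow> nat \<Rightarrow> (real \<Rightarrow> real) set" where
  "E_minus p f zm zp lam k = E_set p p f zm zp lam \<inter> S_minus k"

definition negate :: "(real \<Rightarrow> real) \<Rightarrow> real \<Rightarrow> real" where
  "negate \<phi> = restrict (\<lambda>x. - \<phi> x) {0..1}"

lemma negate_apply: "x \<in> {0..1} \<Longrightarrow> negate \<phi> x = - \<phi> x"
  by (simp add: negate_def)

lemma negate_C1:
  assumes "\<phi> \<in> C1"
  shows "negate \<phi> \<in> C1" "\<And>x. x \<in> {0..1} \<Longrightarrow> D01 (negate \<phi>) x = - D01 \<phi> x"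
proof -
  have d: "((\<lambda>x. - \<phi> x) has_real_derivative - D01 \<phi> x) (at x within {0..1})" if "x \<in> {0..1}" for x
    using assms that by (intro DERIV_minus D01_works) (auto simp: C1_def is_C1_def)
  have c: "continuous_on {0..1} (\<lambda>x. - D01 \<phi> x)" by (intro continuous_intros continuous_on_C1 assms)
  show "negate \<phi> \<in> C1" unfolding negate_def by (rule restrict_C1(1)[OF d c])
  show "D01 (negate \<phi>) x = - D01 \<phi> x" if "x \<in> {0..1}" for x
    unfolding negate_def by (rule restrict_C1(2)[OF d c that])
qed

lemma negate_negate: "\<phi> \<in> C1 \<Longrightarrow> negate (negate \<phi>) = \<phi>"
  by (auto simp: negate_def C1_def restrict_def extensional_def)

lemma negate_dist: "\<phi> \<in> C1 \<Longrightarrow> \<psi> \<in> C1 \<Longrightarrow> C1_dist (negate \<phi>) (negate \<psi>) = C1_dist \<phi> \<psi>"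
proof -
  assume m: "\<phi> \<in> C1" "\<psi> \<in> C1"
  have "(SUP x\<in>{0..1}. \<bar>negate \<phi> x - negate \<psi> x\<bar>) = (SUP x\<in>{0..1}. \<bar>\<phi> x - \<psi> x\<bar>)"
    by (rule SUP_cong) (auto simp: negate_def)
  moreover have "(SUP x\<in>{0..1}. \<bar>D01 (negate \<phi>) x - D01 (negate \<psi>) x\<bar>) = (SUP x\<in>{0..1}. \<bar>D01 \<phi> x - D01 \<psi> x\<bar>)"
    by (rule SUP_cong) (use m in \<open>auto simp: negate_C1\<close>)
  ultimately show ?thesis using m negate_C1(1) by (simp add: C1_dist_def)
qed

lemma negate_homeomorphic_map: "homeomorphic_map C1_topology C1_topology negate"
proof -
  interpret M: Metric_space C1 C1_dist by (rule Metric_space_C1)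
  have top: "topspace C1_topology = C1" by (simp add: C1_topology_def)
  have "continuous_map C1_topology C1_topology negate"
    unfolding continuous_map_atin
  proof
    fix \<phi> assume "\<phi> \<in> topspace C1_topology"
    then have \<phi>: "\<phi> \<in> C1" by (simp add: top)
    have "limitin C1_topology (\<lambda>\<psi>. \<psi>) \<phi> (atin C1_topology \<phi>)"
      using continuous_map_id[of C1_topology] \<phi> unfolding continuous_map_atin id_def top by blast
    then show "limitin C1_topology negate (negate \<phi>) (atin C1_topology \<phi>)"
      unfolding C1_topology_def M.limitin_metric using negate_C1(1) negate_dist \<phi>
      by (auto elim!: eventually_mono)
  qed
  then show ?thesis
    unfolding homeomorphic_map_maps homeomorphic_maps_def
    by (intro exI[of _ negate]) (auto simp: top negate_negate)
qed

lemma negate_E_set: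
  assumes st: "standing p p f zm zp" and lam: "0 < lam" and \<phi>: "\<phi> \<in> E_set p p f zm zp lam"
  shows "negate \<phi> \<in> E_set p p (reflected f) (- zp) (- zm) lam"
proof -
  let ?h = "\<lambda>s. spow p s - f s" and ?h' = "\<lambda>s. spow p s - reflected f s"
  interpret W: well p lam ?h "Apot p f" zp zm by (rule standing_well[OF st lam])
  interpret V: well p lam ?h' "Apot p (reflected f)" "- zm" "- zp"
    by (rule standing_well[OF standing_reflected[OF st] lam])
  have C: "\<phi> \<in> C1" and b: "W.bvp \<phi> (D01 \<phi>)" using \<phi> E_set_iff_bvp[OF st lam] by auto
  have "ode p lam (\<lambda>s. - ?h (- s)) 0 1 (\<lambda>x. - \<phi> x) (\<lambda>x. - D01 \<phi> x)"
    using b by (intro ode_negate) (simp add: W.bvp_def)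
  then have o: "ode p lam ?h' 0 1 (\<lambda>x. - \<phi> x) (\<lambda>x. - D01 \<phi> x)"
    by (simp add: reflected_def add.commute)
  have "ode p lam ?h' 0 1 (negate \<phi>) (D01 (negate \<phi>))"
    unfolding ode_def
  proof (intro conjI allI impI)
    show "continuous_on {0..1} (negate \<phi>)" "continuous_on {0..1} (D01 (negate \<phi>))"
      by (rule continuous_on_C1[OF negate_C1(1)[OF C]])+
    fix x :: real assume x: "0 < x \<and> x < 1"
    then have x01: "x \<in> {0..1}" by simp
    show "(negate \<phi> has_real_derivative D01 (negate \<phi>) x) (at x)"
      unfolding negate_C1(2)[OF C x01]
      by (rule has_field_derivative_transform_within_open[OF odeD(3)[OF o], of _ "{0<..<1}"])
         (use x in \<open>auto simp: negate_def\<close>)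
    have v: "- (lam * ?h' (negate \<phi> x)) = - (lam * ?h' (- \<phi> x))" using x by (simp add: negate_def)
    show "((\<lambda>y. spow p (D01 (negate \<phi>) y)) has_real_derivative - (lam * ?h' (negate \<phi> x))) (at x)"
      unfolding v
      by (rule has_field_derivative_transform_within_open[OF odeD(4)[OF o], of _ "{0<..<1}"])
         (use x C in \<open>auto simp: negate_C1\<close>)
  qed
  then have "V.bvp (negate \<phi>) (D01 (negate \<phi>))" using b by (auto simp: V.bvp_def W.bvp_def negate_def)
  then show ?thesis using E_set_iff_bvp[OF standing_reflected[OF st] lam] negate_C1(1)[OF C] by blast
qed

lemma negate_simple_zeros:
  assumes "\<phi> \<in> C1"
  shows "simple_zeros m (negate \<phi>) \<longleftrightarrow> simple_zeros m \<phi>"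
proof -
  have "{x \<in> {0<..<1}. negate \<phi> x = 0} = {x \<in> {0<..<1}. \<phi> x = 0}" by (auto simp: negate_def)
  moreover have "(\<forall>x\<in>{0<..<1}. negate \<phi> x = 0 \<longrightarrow> D01 (negate \<phi>) x \<noteq> 0) \<longleftrightarrow>
      (\<forall>x\<in>{0<..<1}. \<phi> x = 0 \<longrightarrow> D01 \<phi> x \<noteq> 0)"
    by (rule ball_cong) (auto simp: negate_C1(2)[OF assms] negate_apply)
  ultimately show ?thesis by (simp add: simple_zeros_def)
qed

lemma negate_S:
  assumes "\<phi> \<in> C1"
  shows "negate \<phi> \<in> S_minus k \<longleftrightarrow> \<phi> \<in> S_plus k" "negate \<phi> \<in> S_plus k \<longleftrightarrow> \<phi> \<in> S_minus k"
  unfolding S_minus_def S_plus_def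
  by (auto simp: assms negate_C1[OF assms] negate_simple_zeros[OF assms] negate_apply)

lemma E_set_C1: "\<phi> \<in> E_set p q f zm zp lam \<Longrightarrow> \<phi> \<in> C1"
  by (simp add: E_set_def solutions_def)

text \<open>
  If \<open>\<phi>\<close> solves the problem for \<open>f\<close>, then \<open>- \<phi>\<close> solves it for \<open>- f (- s)\<close>, and the slopes change sign.
\<close>
lemma E_minus_eq_negate:
  assumes st: "standing p p f zm zp" and lam: "0 < lam"
  shows "E_minus p f zm zp lam k = negate ` E_plus p (reflected f) (- zp) (- zm) lam k"
proof (intro equalityI subsetI)
  fix \<phi> assume "\<phi> \<in> E_minus p f zm zp lam k"
  then have \<phi>: "\<phi> \<in> E_set p p f zm zp lam" "\<phi> \<in> S_minus k" by (auto simp: E_minus_def)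
  have "negate \<phi> \<in> E_plus p (reflected f) (- zp) (- zm) lam k"
    using negate_E_set[OF st lam \<phi>(1)] negate_S(2)[OF E_set_C1[OF \<phi>(1)]] \<phi>(2) by (simp add: E_plus_def)
  then show "\<phi> \<in> negate ` E_plus p (reflected f) (- zp) (- zm) lam k"
    using negate_negate[OF E_set_C1[OF \<phi>(1)]] by (metis image_eqI)
next
  fix \<phi> assume "\<phi> \<in> negate ` E_plus p (reflected f) (- zp) (- zm) lam k"
  then obtain \<psi> where \<psi>: "\<phi> = negate \<psi>" "\<psi> \<in> E_set p p (reflected f) (- zp) (- zm) lam" "\<psi> \<in> S_plus k"
    by (auto simp: E_plus_def)
  have "negate \<psi> \<in> E_set p p f zm zp lam"
    using negate_E_set[OF standing_reflected[OF st] lam \<psi>(2)] by simp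
  then show "\<phi> \<in> E_minus p f zm zp lam k"
    using negate_S(1)[OF E_set_C1[OF \<psi>(2)]] \<psi> by (simp add: E_minus_def)
qed

lemma reflected_thresholds:
  assumes st: "standing p p f zm zp" and lam: "0 < lam"
  shows "lambda_minus p p f zm zp lam k = lambda_plus p p (reflected f) (- zp) (- zm) lam k"
    and "exp_minus p f zm zp k = exp_plus p (reflected f) (- zp) (- zm) k"
proof -
  note st' = standing_reflected[OF st]
  have A: "Apot p (reflected f) = (\<lambda>s. Apot p f (- s))" using Apot_reflected[OF standing_cont[OF st]] by blast
  have z: "zm < 0" "0 < zp" using st by (auto simp: standing_def)
  have I: "Istar p p (reflected f) (- zp) (- zm) lam = Jstar p p f zm zp lam"
    "Jstar p p (reflected f) (- zp) (- zm) lam = Istar p p f zm zp lam"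
    unfolding star_values[OF st lam] star_values[OF st' lam] by (simp_all add: A min.commute)
  have t: "timeI p p (reflected f) (- zm) = timeJ p p f zm"
    using timeI_eq[OF st' lam, of "- zm"] timeJ_eq[OF st lam, of "- zm"] z by (simp add: A)
  show "lambda_minus p p f zm zp lam k = lambda_plus p p (reflected f) (- zp) (- zm) lam k"
    unfolding lambda_minus_def lambda_plus_def I t by (simp add: Let_def add.commute)
  show "exp_minus p f zm zp k = exp_plus p (reflected f) (- zp) (- zm) k"
    unfolding exp_minus_def exp_plus_def Let_def by (auto simp: A)
qed

lemma E_minus_description:
  assumes st: "standing p p f zm zp" and lam: "0 < lam" and k: "1 \<le> k"
  shows "lam \<le> lambda_eig p k \<Longrightarrow> E_minus p f zm zp lam k = {}"
    and "lambda_eig p k < lam \<Longrightarrow> ereal lam \<le> lambda_minus p p f zm zp lam k \<Longrightarrow> \<exists>\<phi>. E_minus p f zm zp lam k = {\<phi>}"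
    and "lambda_minus p p f zm zp lam k < ereal lam \<Longrightarrow>
      subtopology C1_topology (E_minus p f zm zp lam k) homeomorphic_space cube (exp_minus p f zm zp k)"
proof -
  let ?E = "E_plus p (reflected f) (- zp) (- zm) lam k"
  note D = E_plus_description[OF standing_reflected[OF st] lam k]
  note E = E_minus_eq_negate[OF st lam, of k] and R = reflected_thresholds[OF st lam, of k]
  show "E_minus p f zm zp lam k = {}" if "lam \<le> lambda_eig p k" using D(1)[OF that] E by simp
  show "\<exists>\<phi>. E_minus p f zm zp lam k = {\<phi>}"
    if l: "lambda_eig p k < lam" "ereal lam \<le> lambda_minus p p f zm zp lam k"
  proof -
    obtain \<phi> where "?E = {\<phi>}" using D(2) l R by auto
    then show ?thesis using E by simp
  qed
  show "subtopology C1_topology (E_minus p f zm zp lam k) homeomorphic_space cube (exp_minus p f zm zp k)"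
    if "lambda_minus p p f zm zp lam k < ereal lam"
  proof -
    have top: "topspace C1_topology = C1"
      using Metric_space.topspace_mtopology[OF Metric_space_C1] by (simp add: C1_topology_def)
    have sub: "?E \<subseteq> C1" using E_set_C1 by (auto simp: E_plus_def)
    have "negate ` (topspace C1_topology \<inter> ?E) = topspace C1_topology \<inter> negate ` ?E"
      using sub negate_C1(1) unfolding top by blast
    then have "homeomorphic_map (subtopology C1_topology ?E) (subtopology C1_topology (negate ` ?E)) negate"
      by (rule homeomorphic_map_subtopologies[OF negate_homeomorphic_map])
    then have "subtopology C1_topology ?E homeomorphic_space subtopology C1_topology (negate ` ?E)"
      by (rule homeomorphic_map_imp_homeomorphic_space)
    moreover have "subtopology C1_topology ?E homeomorphic_space cube (exp_minus p f zm zp k)"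
      using D(3) that R by simp
    ultimately show ?thesis unfolding E using homeomorphic_space_sym homeomorphic_space_trans by blast
  qed
qed

section \<open>The set of all solutions\<close>

lemma zero_fn_in_E_set:
  assumes st: "standing p p f zm zp"
  shows "zero_fn \<in> E_set p p f zm zp lam"
proof -
  have d: "((\<lambda>_. 0) has_real_derivative 0) (at x within {0..1})" for x :: real by simp
  note z = restrict_C1[where \<phi> = "\<lambda>_. 0" and D = "\<lambda>_. 0", OF d continuous_on_const, folded zero_fn_def]
  note C = z(1) and D = z(2)
  have der: "((\<lambda>x. spow p (D01 zero_fn x)) has_real_derivative 0) (at x within {0..1})" if "x \<in> {0..1}" for x
    by (rule has_field_derivative_transform_within[OF d zero_less_one that]) (simp add: D)
  have "is_C1 (\<lambda>x. spow p (D01 zero_fn x))" by (rule is_C1I[OF der]) auto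
  moreover have "D01 (\<lambda>x. spow p (D01 zero_fn x)) x = 0" if "x \<in> {0..1}" for x
    by (rule D01_eqI[OF that der[OF that]])
  ultimately show ?thesis
    using C st by (auto simp: E_set_def solutions_def zero_fn_def standing_def)
qed

text \<open>
  A solution with \<open>\<phi>' 0 = 0\<close> has energy zero and is trivial; any other has finitely many zeros, all simple.
\<close>
lemma E_set_decomposition:
  assumes st: "standing p p f zm zp" and lam: "0 < lam"
  shows "E_set p p f zm zp lam = {zero_fn} \<union> (\<Union>k\<in>{1..}. E_plus p f zm zp lam k \<union> E_minus p f zm zp lam k)"
proof (intro equalityI subsetI)
  fix \<phi> assume \<phi>: "\<phi> \<in> E_set p p f zm zp lam"
  interpret W: well p lam "\<lambda>s. spow p s - f s" "Apot p f" zp zm by (rule standing_well[OF st lam])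
  have C: "\<phi> \<in> C1" and b: "W.bvp \<phi> (D01 \<phi>)" using \<phi> E_set_iff_bvp[OF st lam] by auto
  show "\<phi> \<in> {zero_fn} \<union> (\<Union>k\<in>{1..}. E_plus p f zm zp lam k \<union> E_minus p f zm zp lam k)"
  proof (cases "D01 \<phi> 0 = 0")
    case True
    have "\<phi> x = zero_fn x" for x
      using W.bvp_zero_or_slope[OF b True, of x] C by (auto simp: zero_fn_def C1_def extensional_def restrict_def)
    then show ?thesis by auto
  next
    case False
    obtain k X where k: "1 \<le> k" "W.nodal k X \<phi>" using W.bvp_nodal_exists[OF b False] by blast
    then have s: "simple_zeros (k - 1) \<phi>" using W.nodal_iff_simple_zeros[OF b False k(1)] by blast
    have "\<phi> 0 = 0" "\<phi> 1 = 0" using b by (auto simp: W.bvp_def)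
    then have "\<phi> \<in> S_plus k \<or> \<phi> \<in> S_minus k"
      using C s False by (auto simp: S_plus_def S_minus_def)
    then show ?thesis using \<phi> k(1) by (auto simp: E_plus_def E_minus_def)
  qed
qed (auto simp: E_plus_def E_minus_def zero_fn_in_E_set[OF st])

lemma solutions_in_E_set:
  assumes st: "standing p p f zm zp" and lam: "0 < lam" and out: "outer_sign p f zm zp"
  shows "solutions p p f lam = E_set p p f zm zp lam"
proof -
  let ?h = "\<lambda>s. spow p s - f s"
  have p: "1 < p" and z: "0 < zp" "zm < 0" using st by (auto simp: standing_def)
  have "\<phi> ` {0..1} \<subseteq> {zm..zp}" if \<phi>: "\<phi> \<in> solutions p p f lam" for \<phi>
  proof -
    have C: "\<phi> \<in> C1" and v: "is_C1 (\<lambda>x. spow p (D01 \<phi> x))"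
      and eq: "\<And>x. x \<in> {0<..<1} \<Longrightarrow> - D01 (\<lambda>y. spow p (D01 \<phi> y)) x = lam * ?h (\<phi> x)"
      and bc: "\<phi> 0 = 0" "\<phi> 1 = 0"
      using \<phi> by (auto simp: solutions_def)
    have ode: "ode p lam ?h 0 1 \<phi> (D01 \<phi>)" by (rule solution_ode[OF C v eq])
    have up: "\<phi> x \<le> zp" if "x \<in> {0..1}" for x
      using out by (intro ode_upper_bound[OF p lam ode bc z(1) _ that]) (auto simp: outer_sign_def)
    have low: "- \<phi> x \<le> - zm" if "x \<in> {0..1}" for x
    proof (rule ode_upper_bound[OF p lam ode_negate[OF ode] _ _ _ _ that])
      show "- ?h (- s) \<le> 0" if "- zm < s" for s
      proof -
        have "- s < zm" using that by simp
        then show ?thesis using out unfolding outer_sign_def by fastforce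
      qed
    qed (use bc z in auto)
    show ?thesis using up low by force
  qed
  then show ?thesis by (auto simp: E_set_def)
qed

theorem theorem1p4:
  fixes p q lam zm zp :: real and f :: "real \<Rightarrow> real" and E :: "(real \<Rightarrow> real) set"
  assumes "1 < q" and "q = p"
    and "standing p q f zm zp"
    and "0 < lam"
    and E: "E = E_set p q f zm zp lam \<or> outer_sign q f zm zp \<and> E = solutions p q f lam"
  shows "(lam \<le> lambda_eig p 1 \<longrightarrow> E = {zero_fn}) \<and>
    (\<forall>n\<ge>1. lambda_eig p n < lam \<and> lam \<le> lambda_eig p (n + 1) \<longrightarrow>
      (\<exists>Ep Em :: nat \<Rightarrow> (real \<Rightarrow> real) set.
        E = {zero_fn} \<union> (\<Union>k\<in>{1..n}. Ep k \<union> Em k) \<and>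
        (\<forall>k\<in>{1..n}.
          Ep k \<subseteq> S_plus k \<and>
          (lambda_eig p k < lam \<and> ereal lam \<le> lambda_plus p q f zm zp lam k \<longrightarrow> (\<exists>\<phi>. Ep k = {\<phi>})) \<and>
          (lambda_plus p q f zm zp lam k < ereal lam \<longrightarrow>
            subtopology C1_topology (Ep k) homeomorphic_space cube (exp_plus q f zm zp k)) \<and>
          Em k \<subseteq> S_minus k \<and>
          (lambda_eig p k < lam \<and> ereal lam \<le> lambda_minus p q f zm zp lam k \<longrightarrow> (\<exists>\<phi>. Em k = {\<phi>})) \<and>
          (lambda_minus p q f zm zp lam k < ereal lam \<longrightarrow>
            subtopology C1_topology (Em k) homeomorphic_space cube (exp_minus q f zm zp k)))))"
proof -
  have q: "q = p" by fact
  have st: "standing p p f zm zp" and lam: "0 < lam" using assms by auto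
  have E_eq: "E = E_set p p f zm zp lam"
    using E solutions_in_E_set[OF st lam] unfolding q by auto
  interpret W: well p lam "\<lambda>s. spow p s - f s" "Apot p f" zp zm by (rule standing_well[OF st lam])
  have eig_mono: "lambda_eig p i < lam" if "i \<le> j" "lambda_eig p j < lam" for i j
  proof -
    have "2 * real i * (W.pos.I0 / W.pos.mu) \<le> 2 * real j * (W.pos.I0 / W.pos.mu)"
      using that(1) W.pos.I0_pos W.pos.mu_pos by (intro mult_right_mono) auto
    then show ?thesis using that(2) W.lambda_eig_less_iff[of i] W.lambda_eig_less_iff[of j] by linarith
  qed
  have empty: "E_plus p f zm zp lam k = {}" "E_minus p f zm zp lam k = {}"
    if "lam \<le> lambda_eig p n" "n \<le> k" "1 \<le> k" for n k
  proof -
    have "lam \<le> lambda_eig p k" using eig_mono[OF that(2)] that(1) by linarith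
    then show "E_plus p f zm zp lam k = {}" "E_minus p f zm zp lam k = {}"
      using E_plus_description(1)[OF st lam that(3)] E_minus_description(1)[OF st lam that(3)] by auto
  qed
  note dec = E_set_decomposition[OF st lam]
  show ?thesis
    unfolding q
  proof (intro conjI allI impI)
    assume "lam \<le> lambda_eig p 1"
    then show "E = {zero_fn}" unfolding E_eq dec using empty by auto
  next
    fix n :: nat assume n: "1 \<le> n" and l: "lambda_eig p n < lam \<and> lam \<le> lambda_eig p (n + 1)"
    have "E = {zero_fn} \<union> (\<Union>k\<in>{1..n}. E_plus p f zm zp lam k \<union> E_minus p f zm zp lam k)"
    proof -
      define X where "X k = E_plus p f zm zp lam k \<union> E_minus p f zm zp lam k" for k
      have X_empty: "X k = {}" if "n < k" for k
        unfolding X_def using empty[of "n + 1" k] l that by simp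
      have "(\<Union>k\<in>{1..}. X k) = (\<Union>k\<in>{1..n}. X k)"
      proof (intro equalityI subsetI)
        fix \<phi> assume "\<phi> \<in> (\<Union>k\<in>{1..}. X k)"
        then obtain k where k: "1 \<le> k" "\<phi> \<in> X k" by auto
        then have "k \<le> n" using X_empty[of k] by (cases "n < k") auto
        then show "\<phi> \<in> (\<Union>k\<in>{1..n}. X k)" using k by auto
      qed auto
      then have "(\<Union>k\<in>{1..}. E_plus p f zm zp lam k \<union> E_minus p f zm zp lam k) =
          (\<Union>k\<in>{1..n}. E_plus p f zm zp lam k \<union> E_minus p f zm zp lam k)"
        by (simp only: X_def)
      then show ?thesis unfolding E_eq dec by simp
    qed
    moreover have "E_plus p f zm zp lam k \<subseteq> S_plus k" "E_minus p f zm zp lam k \<subseteq> S_minus k" for k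
      by (auto simp: E_plus_def E_minus_def)
    ultimately show "\<exists>Ep Em :: nat \<Rightarrow> (real \<Rightarrow> real) set.
        E = {zero_fn} \<union> (\<Union>k\<in>{1..n}. Ep k \<union> Em k) \<and>
        (\<forall>k\<in>{1..n}.
          Ep k \<subseteq> S_plus k \<and>
          (lambda_eig p k < lam \<and> ereal lam \<le> lambda_plus p p f zm zp lam k \<longrightarrow> (\<exists>\<phi>. Ep k = {\<phi>})) \<and>
          (lambda_plus p p f zm zp lam k < ereal lam \<longrightarrow>
            subtopology C1_topology (Ep k) homeomorphic_space cube (exp_plus p f zm zp k)) \<and>
          Em k \<subseteq> S_minus k \<and>
          (lambda_eig p k < lam \<and> ereal lam \<le> lambda_minus p p f zm zp lam k \<longrightarrow> (\<exists>\<phi>. Em k = {\<phi>})) \<and>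
          (lambda_minus p p f zm zp lam k < ereal lam \<longrightarrow>
            subtopology C1_topology (Em k) homeomorphic_space cube (exp_minus p f zm zp k)))"
      using E_plus_description(2,3)[OF st lam] E_minus_description(2,3)[OF st lam]
      by (intro exI[of _ "E_plus p f zm zp lam"] exI[of _ "E_minus p f zm zp lam"] conjI ballI impI) auto
  qed
qed

end
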